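(* Let $M^n$ be an $n$-dimensional Lagrangian submanifold of a complex space form $\tilde M^n(4c)$ of complex dimension $n$ and constant holomorphic sectional curvature $4c$. Let $n_1,\ldots,n_k$ be integers satisfying $2\leq n_1\leq\ldots\leq n_k\leq n-1$ and $n_1+\ldots+n_k=n$. Then, at any point of $M^n$, $$\delta(n_1,\ldots,n_k)\leq\frac{n^2\left(k-1-2\sum_{i=2}^k\frac{1}{n_i+2}\right)}{2\left(k-2\sum_{i=2}^k\frac{1}{n_i+2}\right)}\|H\|^2+\frac12\left(n(n-1)-\sum_{i=1}^kn_i(n_i-1)\right)c.$$ Assume moreover that equality holds at a point $p\in M^n$. Let $L_1,\ldots,L_k$ be mutually orthogonal subspaces of $T_pM^n$ with $\dim L_i=n_i$ minimizing $\tau(L_1)+\ldots+\tau(L_k)$ among all such $k$-tuples, let $\{e_1,\ldots,e_n\}$ be an orthonormal basis of $T_pM^n$ adapted to $L_1,\ldots,L_k$ (i.e. $e_A\in L_i$ for all $A\in\Delta_i$, $i=1,\ldots,k$), and let $h^C_{AB}=\langle h(e_A,e_B),Je_C\rangle$. Then: <br> (1) $h^A_{\alpha_i\alpha_j}=0$ for all $i\neq j$ in $\{1,\ldots,k\}$, $\alpha_i\in\Delta_i$, $\alpha_j\in\Delta_j$ and all $A\in\{1,\ldots,n\}$ with $A\neq\alpha_i$ and $A\neq\alpha_j$; <br> (2) if $j\in\{1,\ldots,k\}$ is such that $n_j\neq\min\{n_1,\ldots,n_k\}$, then for every $\beta_j\in\Delta_j$: $h^{\beta_j}_{\alpha_i\alpha_i}=0$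 for all $i\neq j$ and all $\alpha_i\in\Delta_i$, and $\sum_{\alpha_j\in\Delta_j}h^{\beta_j}_{\alpha_j\alpha_j}=0$; <br> (3) if $j\in\{1,\ldots,k\}$ is such that $n_j=\min\{n_1,\ldots,n_k\}$, then for every $\beta_j\in\Delta_j$: $\sum_{\alpha_j\in\Delta_j}h^{\beta_j}_{\alpha_j\alpha_j}=(n_i+2)h^{\beta_j}_{\alpha_i\alpha_i}$ for any $i\neq j$ and any $\alpha_i\in\Delta_i$.
   Context: Delta-invariants. Let $p$ be a point of an $n$-dimensional Riemannian manifold $M^n$. For a linear subspace $L\subseteq T_pM^n$ with orthonormal basis $\{e_1,\ldots,e_\ell\}$, put $\tau(L)=\sum_{1\leq i<j\leq \ell}K(e_i\wedge e_j)$, where $K(e_i\wedge e_j)$ is the sectional curvature of the plane spanned by $e_i,e_j$ (this is independent of the chosen orthonormal basis). Put $\tau=\tau(T_pM^n)$. For integers $2\leq n_1\leq\ldots\leq n_k\leq n-1$ with $n_1+\ldots+n_k\leq n$, define $$\delta(n_1,\ldots,n_k)(p)=\tau-\inf\left\{\sum_{i=1}^k\tau(L_i)\right\},$$ where the infimum runs over all $k$-tuples $(L_1,\ldots,L_k)$ of mutually orthogonal subspaces of $T_pM^n$ with $\dim L_i=n_i$; the infimum is attained. Lagrangian submanifolds. A complex space form $\tilde M^n(4c)$ is a Kähler manifold of complex dimension $n$ with constant holomorphic sectional curvature $4c$, $c\in\mathbb{R}$; its complex structure is denoted $J$ and its metric $\langle\cdot,\cdot\rangle$. A submanifold $M^n$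 of real dimension $n$ (isometrically immersed, with the induced metric) is Lagrangian if $J$ maps its tangent spaces into its normal spaces and vice versa at every point. The second fundamental form $h$ is the normal part of the ambient covariant derivative: $\tilde\nabla_XY=\nabla_XY+h(X,Y)$ with $\nabla$, $\tilde\nabla$ the Levi-Civita connections of $M^n$ and $\tilde M^n(4c)$. The mean curvature vector is $H=\frac1n\,\mathrm{trace}(h)$. For a Lagrangian submanifold the form $\langle h(\cdot,\cdot),J\cdot\rangle$ is totally symmetric, so $h^C_{AB}$ is symmetric in $A,B,C$. Index blocks. $\Delta_1=\{1,\ldots,n_1\}$, $\Delta_2=\{n_1+1,\ldots,n_1+n_2\}$, ..., $\Delta_k=\{n_1+\ldots+n_{k-1}+1,\ldots,n_1+\ldots+n_k\}$; since $n_1+\ldots+n_k=n$, these blocks partition $\{1,\ldots,n\}$. *)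

theory Defs
  imports "HOL-Analysis.Analysis"
begin

section \<open>Smooth maps and manifolds\<close>

text \<open>Only meant for open sets \<open>S\<close>, on which it is the usual notion of a \<open>C\<^sup>k\<close> map.\<close>

primrec Ck_on :: "nat \<Rightarrow> 'a::euclidean_space set \<Rightarrow> ('a \<Rightarrow> 'b::real_normed_vector) \<Rightarrow> bool" where
  "Ck_on 0 S f \<longleftrightarrow> continuous_on S f"
| "Ck_on (Suc k) S f \<longleftrightarrow> (\<forall>x\<in>S. f differentiable (at x)) \<and>
     (\<forall>v. Ck_on k S (\<lambda>x. frechet_derivative f (at x) v))"

definition smooth_on :: "'a::euclidean_space set \<Rightarrow> ('a \<Rightarrow> 'b::real_normed_vector) \<Rightarrow> bool" where
  "smooth_on S f \<longleftrightarrow> (\<forall>k. Ck_on k S f)"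

text \<open>A chart is a pair of its domain and its coordinate map. The model space is an arbitrary
  Euclidean space \<open>'a\<close>; the dimension of the manifold is \<open>DIM('a)\<close>. A manifold is given by an
  atlas (not necessarily maximal) on an open subset of a second countable Hausdorff space.\<close>

type_synonym ('m, 'a) chart = "'m set \<times> ('m \<Rightarrow> 'a)"

definition chart_image :: "('m, 'a) chart \<Rightarrow> 'a set" where
  "chart_image \<phi> = snd \<phi> ` fst \<phi>"

definition chart_inv :: "('m, 'a) chart \<Rightarrow> 'a \<Rightarrow> 'm" where
  "chart_inv \<phi> = inv_into (fst \<phi>) (snd \<phi>)"

definition carrier :: "('m, 'a) chart set \<Rightarrow> 'm set" where
  "carrier \<A> = (\<Union>\<phi>\<in>\<A>. fst \<phi>)"

definition coord_rep :: "('m, 'a) chart \<Rightarrow> ('q, 'b) chart \<Rightarrow> ('m \<Rightarrow> 'q) \<Rightarrow> 'a \<Rightarrow> 'b" where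
  "coord_rep \<phi> \<psi> f = snd \<psi> \<circ> f \<circ> chart_inv \<phi>"

definition smooth_manifold ::
  "('m::{t2_space,second_countable_topology}, 'a::euclidean_space) chart set \<Rightarrow> bool" where
  "smooth_manifold \<A> \<longleftrightarrow>
     (\<forall>\<phi>\<in>\<A>. open (fst \<phi>) \<and> open (chart_image \<phi>) \<and>
        homeomorphism (fst \<phi>) (chart_image \<phi>) (snd \<phi>) (chart_inv \<phi>)) \<and>
     (\<forall>\<phi>\<in>\<A>. \<forall>\<psi>\<in>\<A>. smooth_on (snd \<phi> ` (fst \<phi> \<inter> fst \<psi>)) (coord_rep \<phi> \<psi> id))"

definition smooth_map ::
  "('m::{t2_space,second_countable_topology}, 'a::euclidean_space) chart set \<Rightarrow>
   ('q::{t2_space,second_countable_topology}, 'b::euclidean_space) chart set \<Rightarrow>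
   ('m \<Rightarrow> 'q) \<Rightarrow> bool" where
  "smooth_map \<A> \<B> f \<longleftrightarrow> f ` carrier \<A> \<subseteq> carrier \<B> \<and> continuous_on (carrier \<A>) f \<and>
     (\<forall>\<phi>\<in>\<A>. \<forall>\<psi>\<in>\<B>. smooth_on (snd \<phi> ` {p \<in> fst \<phi>. f p \<in> fst \<psi>}) (coord_rep \<phi> \<psi> f))"


section \<open>Inner products on a tangent space\<close>

text \<open>In a chart, every tangent space is identified with the model space (via the coordinate
  frame) and carries an inner product \<open>b\<close> unrelated to the standard one of the model space.\<close>

definition inner_product :: "('a::euclidean_space \<Rightarrow> 'a \<Rightarrow> real) \<Rightarrow> bool" where
  "inner_product b \<longleftrightarrow> bilinear b \<and> (\<forall>u v. b u v = b v u) \<and> (\<forall>u. u \<noteq> 0 \<longrightarrow> b u u > 0)"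

text \<open>Bases are indexed by \<open>1, \<dots>, dim L\<close>; other values of \<open>e\<close> are irrelevant.\<close>

definition onb :: "('a::euclidean_space \<Rightarrow> 'a \<Rightarrow> real) \<Rightarrow> 'a set \<Rightarrow> (nat \<Rightarrow> 'a) \<Rightarrow> bool" where
  "onb b L e \<longleftrightarrow>
     (\<forall>i\<in>{1..dim L}. \<forall>j\<in>{1..dim L}. b (e i) (e j) = (if i = j then 1 else 0)) \<and>
     span (e ` {1..dim L}) = L"

definition normal_part :: "('a::euclidean_space \<Rightarrow> 'a \<Rightarrow> real) \<Rightarrow> 'a set \<Rightarrow> 'a \<Rightarrow> 'a" where
  "normal_part b T w = (THE \<nu>. (\<forall>t\<in>T. b \<nu> t = 0) \<and> w - \<nu> \<in> T)"


section \<open>Riemannian geometry in a chart\<close>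

text \<open>\<open>G x u v\<close> is the value at the point with coordinates \<open>x\<close> of a metric on vectors with
  components \<open>u\<close>, \<open>v\<close>. The vector \<open>christoffel G x u v\<close> is the covariant derivative \<open>\<nabla>\<^bsub>u\<^esub> v\<close> of the
  constant coordinate field \<open>v\<close>; it is determined by torsion-freeness (symmetry) and
  compatibility with the metric.\<close>

definition christoffel ::
  "('a::euclidean_space \<Rightarrow> 'a \<Rightarrow> 'a \<Rightarrow> real) \<Rightarrow> 'a \<Rightarrow> 'a \<Rightarrow> 'a \<Rightarrow> 'a" where
  "christoffel G x = (THE \<Gamma>. bilinear \<Gamma> \<and> (\<forall>u v. \<Gamma> u v = \<Gamma> v u) \<and>
     (\<forall>u v w. frechet_derivative (\<lambda>y. G y v w) (at x) u = G x (\<Gamma> u v) w + G x v (\<Gamma> u w)))"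

text \<open>\<open>cov_along G F Y x u\<close> is the covariant derivative at \<open>x\<close> in direction \<open>u\<close> of a vector field
  \<open>Y\<close> along the map \<open>F\<close>; \<open>cov_deriv G Y x u\<close> is the case of a vector field on the manifold
  itself.\<close>

definition cov_along ::
  "('b::euclidean_space \<Rightarrow> 'b \<Rightarrow> 'b \<Rightarrow> real) \<Rightarrow> ('a::euclidean_space \<Rightarrow> 'b) \<Rightarrow> ('a \<Rightarrow> 'b) \<Rightarrow> 'a \<Rightarrow> 'a \<Rightarrow> 'b"
  where
  "cov_along G F Y x u = frechet_derivative Y (at x) u +
     christoffel G (F x) (frechet_derivative F (at x) u) (Y x)"

definition cov_deriv ::
  "('a::euclidean_space \<Rightarrow> 'a \<Rightarrow> 'a \<Rightarrow> real) \<Rightarrow> ('a \<Rightarrow> 'a) \<Rightarrow> 'a \<Rightarrow> 'a \<Rightarrow> 'a" where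
  "cov_deriv G Y x u = frechet_derivative Y (at x) u + christoffel G x u (Y x)"

text \<open>\<open>R(u,v)w = \<nabla>\<^bsub>u\<^esub> \<nabla>\<^bsub>v\<^esub> w - \<nabla>\<^bsub>v\<^esub> \<nabla>\<^bsub>u\<^esub> w\<close>, with \<open>u\<close>, \<open>v\<close>, \<open>w\<close> extended to constant coordinate
  fields, so that the bracket term vanishes.\<close>

definition curvature ::
  "('a::euclidean_space \<Rightarrow> 'a \<Rightarrow> 'a \<Rightarrow> real) \<Rightarrow> 'a \<Rightarrow> 'a \<Rightarrow> 'a \<Rightarrow> 'a \<Rightarrow> 'a" where
  "curvature G x u v w =
     cov_deriv G (\<lambda>y. cov_deriv G (\<lambda>_. w) y v) x u - cov_deriv G (\<lambda>y. cov_deriv G (\<lambda>_. w) y u) x v"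

definition sectional_curvature ::
  "('a::euclidean_space \<Rightarrow> 'a \<Rightarrow> 'a \<Rightarrow> real) \<Rightarrow> 'a \<Rightarrow> 'a \<Rightarrow> 'a \<Rightarrow> real" where
  "sectional_curvature G x u v =
     G x (curvature G x u v v) u / (G x u u * G x v v - (G x u v)\<^sup>2)"

definition tau :: "('a::euclidean_space \<Rightarrow> 'a \<Rightarrow> 'a \<Rightarrow> real) \<Rightarrow> 'a \<Rightarrow> 'a set \<Rightarrow> real" where
  "tau G x L = (let e = (SOME e. onb (G x) L e) in
     \<Sum>(i, j)\<in>{(i, j). 1 \<le> i \<and> i < j \<and> j \<le> dim L}. sectional_curvature G x (e i) (e j))"

text \<open>The \<open>k\<close>-tuple \<open>(n\<^sub>1, \<dots>, n\<^sub>k)\<close> is the function \<open>ns\<close> on \<open>{1..k}\<close>; likewise for tuples of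
  subspaces.\<close>

definition orthogonal_tuples ::
  "('a::euclidean_space \<Rightarrow> 'a \<Rightarrow> 'a \<Rightarrow> real) \<Rightarrow> 'a \<Rightarrow> nat \<Rightarrow> (nat \<Rightarrow> nat) \<Rightarrow> (nat \<Rightarrow> 'a set) set" where
  "orthogonal_tuples G x k ns = {L.
     (\<forall>i\<in>{1..k}. subspace (L i) \<and> dim (L i) = ns i) \<and>
     (\<forall>i\<in>{1..k}. \<forall>j\<in>{1..k}. i \<noteq> j \<longrightarrow> (\<forall>u\<in>L i. \<forall>v\<in>L j. G x u v = 0))}"

definition delta ::
  "('a::euclidean_space \<Rightarrow> 'a \<Rightarrow> 'a \<Rightarrow> real) \<Rightarrow> 'a \<Rightarrow> nat \<Rightarrow> (nat \<Rightarrow> nat) \<Rightarrow> real" where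
  "delta G x k ns =
     tau G x UNIV - (INF L\<in>orthogonal_tuples G x k ns. \<Sum>i=1..k. tau G x (L i))"

definition block :: "(nat \<Rightarrow> nat) \<Rightarrow> nat \<Rightarrow> nat set" where
  "block ns i = {(\<Sum>j=1..<i. ns j) + 1 .. (\<Sum>j=1..i. ns j)}"

text \<open>\<open>F\<close> is the coordinate expression of an immersion into a manifold with metric \<open>G\<close>. The second
  fundamental form \<open>h(u,v)\<close> is the normal part of the ambient covariant derivative in direction
  \<open>u\<close> of the image under \<open>dF\<close> of the constant coordinate field \<open>v\<close>.\<close>

definition second_fundamental_form ::
  "('b::euclidean_space \<Rightarrow> 'b \<Rightarrow> 'b \<Rightarrow> real) \<Rightarrow> ('a::euclidean_space \<Rightarrow> 'b) \<Rightarrow> 'a \<Rightarrow> 'a \<Rightarrow> 'a \<Rightarrow> 'b" where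
  "second_fundamental_form G F x u v =
     normal_part (G (F x)) (range (frechet_derivative F (at x)))
       (cov_along G F (\<lambda>y. frechet_derivative F (at y) v) x u)"

text \<open>The trace is taken with respect to the metric \<open>g\<close> of the submanifold.\<close>

definition mean_curvature ::
  "('a::euclidean_space \<Rightarrow> 'a \<Rightarrow> 'a \<Rightarrow> real) \<Rightarrow> ('b::euclidean_space \<Rightarrow> 'b \<Rightarrow> 'b \<Rightarrow> real) \<Rightarrow>
   ('a \<Rightarrow> 'b) \<Rightarrow> 'a \<Rightarrow> 'b" where
  "mean_curvature g G F x = (let e = (SOME e. onb (g x) UNIV e) in
     (1 / real DIM('a)) *\<^sub>R (\<Sum>i=1..DIM('a). second_fundamental_form G F x (e i) (e i)))"


section \<open>Riemannian manifolds, complex space forms, Lagrangian immersions\<close>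

text \<open>Tensor fields are given by their components in each chart of the atlas, subject to the
  transformation law under change of charts.\<close>

definition riemannian_manifold ::
  "('m::{t2_space,second_countable_topology}, 'a::euclidean_space) chart set \<Rightarrow>
   (('m, 'a) chart \<Rightarrow> 'a \<Rightarrow> 'a \<Rightarrow> 'a \<Rightarrow> real) \<Rightarrow> bool" where
  "riemannian_manifold \<A> g \<longleftrightarrow> smooth_manifold \<A> \<and>
     (\<forall>\<phi>\<in>\<A>. \<forall>x\<in>chart_image \<phi>. inner_product (g \<phi> x)) \<and>
     (\<forall>\<phi>\<in>\<A>. \<forall>u v. smooth_on (chart_image \<phi>) (\<lambda>x. g \<phi> x u v)) \<and>
     (\<forall>\<phi>\<in>\<A>. \<forall>\<psi>\<in>\<A>. \<forall>p\<in>fst \<phi> \<inter> fst \<psi>. \<forall>u v.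
        let D = frechet_derivative (coord_rep \<phi> \<psi> id) (at (snd \<phi> p)) in
        g \<phi> (snd \<phi> p) u v = g \<psi> (snd \<psi> p) (D u) (D v))"

definition almost_complex_structure ::
  "('m::{t2_space,second_countable_topology}, 'a::euclidean_space) chart set \<Rightarrow>
   (('m, 'a) chart \<Rightarrow> 'a \<Rightarrow> 'a \<Rightarrow> 'a) \<Rightarrow> bool" where
  "almost_complex_structure \<A> J \<longleftrightarrow>
     (\<forall>\<phi>\<in>\<A>. \<forall>x\<in>chart_image \<phi>. linear (J \<phi> x) \<and> (\<forall>v. J \<phi> x (J \<phi> x v) = - v)) \<and>
     (\<forall>\<phi>\<in>\<A>. \<forall>v. smooth_on (chart_image \<phi>) (\<lambda>x. J \<phi> x v)) \<and>
     (\<forall>\<phi>\<in>\<A>. \<forall>\<psi>\<in>\<A>. \<forall>p\<in>fst \<phi> \<inter> fst \<psi>. \<forall>v.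
        let D = frechet_derivative (coord_rep \<phi> \<psi> id) (at (snd \<phi> p)) in
        D (J \<phi> (snd \<phi> p) v) = J \<psi> (snd \<psi> p) (D v))"

text \<open>The last condition is \<open>\<nabla>J = 0\<close>; it entails that \<open>J\<close> is integrable.\<close>

definition kaehler_manifold ::
  "('m::{t2_space,second_countable_topology}, 'a::euclidean_space) chart set \<Rightarrow>
   (('m, 'a) chart \<Rightarrow> 'a \<Rightarrow> 'a \<Rightarrow> 'a \<Rightarrow> real) \<Rightarrow> (('m, 'a) chart \<Rightarrow> 'a \<Rightarrow> 'a \<Rightarrow> 'a) \<Rightarrow> bool" where
  "kaehler_manifold \<A> g J \<longleftrightarrow> riemannian_manifold \<A> g \<and> almost_complex_structure \<A> J \<and>
     (\<forall>\<phi>\<in>\<A>. \<forall>x\<in>chart_image \<phi>. \<forall>u v. g \<phi> x (J \<phi> x u) (J \<phi> x v) = g \<phi> x u v) \<and>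
     (\<forall>\<phi>\<in>\<A>. \<forall>x\<in>chart_image \<phi>. \<forall>u v.
        cov_deriv (g \<phi>) (\<lambda>y. J \<phi> y v) x u = J \<phi> x (cov_deriv (g \<phi>) (\<lambda>_. v) x u))"

definition complex_space_form ::
  "('m::{t2_space,second_countable_topology}, 'a::euclidean_space) chart set \<Rightarrow>
   (('m, 'a) chart \<Rightarrow> 'a \<Rightarrow> 'a \<Rightarrow> 'a \<Rightarrow> real) \<Rightarrow> (('m, 'a) chart \<Rightarrow> 'a \<Rightarrow> 'a \<Rightarrow> 'a) \<Rightarrow> real \<Rightarrow> bool" where
  "complex_space_form \<A> g J \<kappa> \<longleftrightarrow> kaehler_manifold \<A> g J \<and>
     (\<forall>\<phi>\<in>\<A>. \<forall>x\<in>chart_image \<phi>. \<forall>u. u \<noteq> 0 \<longrightarrow> sectional_curvature (g \<phi>) x u (J \<phi> x u) = \<kappa>)"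

definition isometric_immersion ::
  "('m::{t2_space,second_countable_topology}, 'a::euclidean_space) chart set \<Rightarrow>
   (('m, 'a) chart \<Rightarrow> 'a \<Rightarrow> 'a \<Rightarrow> 'a \<Rightarrow> real) \<Rightarrow>
   ('q::{t2_space,second_countable_topology}, 'b::euclidean_space) chart set \<Rightarrow>
   (('q, 'b) chart \<Rightarrow> 'b \<Rightarrow> 'b \<Rightarrow> 'b \<Rightarrow> real) \<Rightarrow> ('m \<Rightarrow> 'q) \<Rightarrow> bool" where
  "isometric_immersion \<A> g \<B> G f \<longleftrightarrow> smooth_map \<A> \<B> f \<and>
     (\<forall>\<phi>\<in>\<A>. \<forall>\<psi>\<in>\<B>. \<forall>p\<in>fst \<phi>. f p \<in> fst \<psi> \<longrightarrow>
        (let D = frechet_derivative (coord_rep \<phi> \<psi> f) (at (snd \<phi> p)) in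
         inj D \<and> (\<forall>u v. g \<phi> (snd \<phi> p) u v = G \<psi> (snd \<psi> (f p)) (D u) (D v))))"

definition lagrangian_immersion ::
  "('m::{t2_space,second_countable_topology}, 'a::euclidean_space) chart set \<Rightarrow>
   (('m, 'a) chart \<Rightarrow> 'a \<Rightarrow> 'a \<Rightarrow> 'a \<Rightarrow> real) \<Rightarrow>
   ('q::{t2_space,second_countable_topology}, 'b::euclidean_space) chart set \<Rightarrow>
   (('q, 'b) chart \<Rightarrow> 'b \<Rightarrow> 'b \<Rightarrow> 'b \<Rightarrow> real) \<Rightarrow> (('q, 'b) chart \<Rightarrow> 'b \<Rightarrow> 'b \<Rightarrow> 'b) \<Rightarrow>
   ('m \<Rightarrow> 'q) \<Rightarrow> bool" where
  "lagrangian_immersion \<A> g \<B> G J f \<longleftrightarrow> isometric_immersion \<A> g \<B> G f \<and>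
     (\<forall>\<phi>\<in>\<A>. \<forall>\<psi>\<in>\<B>. \<forall>p\<in>fst \<phi>. f p \<in> fst \<psi> \<longrightarrow>
        (let y = snd \<psi> (f p);
             T = range (frechet_derivative (coord_rep \<phi> \<psi> f) (at (snd \<phi> p)));
             N = {w. \<forall>t\<in>T. G \<psi> y w t = 0}
         in J \<psi> y ` T \<subseteq> N \<and> J \<psi> y ` N \<subseteq> T))"

end

theory Submission
  imports Defs
begin

text \<open>By the Gauss equation and \<open>R(u,v,v,u) = c\<close> for orthonormal \<open>u\<close>, \<open>v\<close> spanning a totally real plane,
  \<open>\<tau> - \<Sum>\<^sub>i \<tau>(L\<^sub>i)\<close> is a multiple of \<open>c\<close> plus the sum of \<open>h\<^sup>C\<^sub>A\<^sub>A h\<^sup>C\<^sub>B\<^sub>B - (h\<^sup>C\<^sub>A\<^sub>B)\<^sup>2\<close> over all \<open>C\<close> and all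
  pairs \<open>{A, B}\<close> in different blocks. By total symmetry of \<open>h\<close>, dropping the squares with \<open>C \<notin> {A, B}\<close>
  leaves, for each \<open>\<gamma>\<close> in a block \<open>l\<close> separately, a quadratic form in the numbers \<open>h\<^sup>\<gamma>\<^sub>\<alpha>\<^sub>\<alpha>\<close>. With
  \<open>S\<^sub>i\<close> the sum of these over block \<open>i\<close>, the Cauchy-Schwarz inequality in each block \<open>i \<noteq> l\<close>, and then between
  the blocks with weights \<open>1/2\<close> for \<open>S\<^sub>l\<close> and \<open>1/2 + 1/n\<^sub>i\<close> for the other \<open>S\<^sub>i\<close>, bounds this form by a
  multiple of \<open>(\<Sum>\<^sub>i S\<^sub>i)\<^sup>2\<close>; the multiple is largest when \<open>n\<^sub>l\<close> is minimal. All discarded terms are squares, so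
  equality makes them vanish.\<close>

text \<open>Origin of the constants: fix an upper index in block \<open>l\<close> and let
  \<open>T\<close> be the sum of all \<open>S i\<close>. The products of diagonal entries give
  \<open>T\<^sup>2 / 2\<close> minus half of each \<open>(S i)\<^sup>2\<close>, and the squares that
  remain lie in the blocks \<open>i \<noteq> l\<close>, where they cost a further
  \<open>(S i)\<^sup>2 / n_i\<close>. For fixed \<open>T\<close> the weighted sum of squares is at
  least \<open>T\<^sup>2 / W\<close>, with \<open>W\<close> the sum of the reciprocal weights: 2 for
  block \<open>l\<close> and \<open>2 - 4 / (n_i + 2)\<close> for the others. Hence the factor
  \<open>1 / 2 - 1 / W\<close>. As \<open>W\<close> omits the reciprocal of block \<open>l\<close>,
  it is largest for the smallest block, which is the first; so the sum in the bound starts at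
  \<open>i = 2\<close>. Discarded squares are carried along in identities, so one computation yields
  both the bound and its equality case. The geometric obstacle is that the notions are given by
  description or choice operators in a chart: existence, uniqueness, differentiability and
  independence of bases have to precede the curvature identities. The estimate is shown for every
  tuple of subspaces and then passes to the infimum.\<close>

section \<open>Orthonormal families of an inner product\<close>

lemma bilinear_sum_left:
  assumes "bilinear B" shows "B (\<Sum>i\<in>I. f i) y = (\<Sum>i\<in>I. B (f i) y)"
  using assms linear_sum[of "\<lambda>x. B x y" f I] unfolding bilinear_def by blast

lemma bilinear_sum_right:
  assumes "bilinear B" shows "B x (\<Sum>i\<in>I. f i) = (\<Sum>i\<in>I. B x (f i))"
  using assms linear_sum[of "\<lambda>y. B x y" f I] unfolding bilinear_def by blast

lemma bilinearI:
  assumes "\<And>x x' y. B (x + x') y = B x y + B x' y" "\<And>r x y. B (r *\<^sub>R x) y = r *\<^sub>R B x y"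
    "\<And>x y y'. B x (y + y') = B x y + B x y'" "\<And>r x y. B x (r *\<^sub>R y) = r *\<^sub>R B x y"
  shows "bilinear B"
  unfolding bilinear_def by (auto intro!: linearI assms)

lemma inner_product_bilinear: "inner_product b \<Longrightarrow> bilinear b"
  and inner_product_commute: "inner_product b \<Longrightarrow> b u v = b v u"
  and inner_product_pos: "inner_product b \<Longrightarrow> u \<noteq> 0 \<Longrightarrow> b u u > 0"
  unfolding inner_product_def by auto

lemmas bilinear_simps = bilinear_ladd bilinear_radd bilinear_lmul bilinear_rmul
  bilinear_lneg bilinear_rneg bilinear_lsub bilinear_rsub bilinear_lzero bilinear_rzero

lemma inner_product_eqI:
  assumes b: "inner_product b" and "\<And>w. b u w = b v w" shows "u = v"
proof (rule ccontr)
  assume "u \<noteq> v"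
  then have "b (u - v) (u - v) > 0" using inner_product_pos[OF b] by simp
  with assms(2) show False
    by (simp add: bilinear_lsub[OF inner_product_bilinear[OF b]])
qed

text \<open>The index set is arbitrary, unlike in \<open>onb\<close>: a family gets restricted to
  the blocks of a partition, and adapted bases are also indexed by pairs.\<close>

definition orthonormal_on :: "('a::euclidean_space \<Rightarrow> 'a \<Rightarrow> real) \<Rightarrow> 'i set \<Rightarrow> ('i \<Rightarrow> 'a) \<Rightarrow> bool" where
  "orthonormal_on b I e \<longleftrightarrow> (\<forall>i\<in>I. \<forall>j\<in>I. b (e i) (e j) = (if i = j then 1 else 0))"

lemma orthonormal_onD:
  "orthonormal_on b I e \<Longrightarrow> i \<in> I \<Longrightarrow> j \<in> I \<Longrightarrow> b (e i) (e j) = (if i = j then 1 else 0)"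
  unfolding orthonormal_on_def by blast

lemma orthonormal_on_subset: "orthonormal_on b I e \<Longrightarrow> I' \<subseteq> I \<Longrightarrow> orthonormal_on b I' e"
  unfolding orthonormal_on_def by blast

lemma orthonormal_expand:
  assumes b: "inner_product b" and "finite I" "orthonormal_on b I e" and w: "w \<in> span (e ` I)"
  shows "(\<Sum>i\<in>I. b w (e i) *\<^sub>R e i) = w"
  using w
proof (induction rule: span_induct)
  case base
  note bl = inner_product_bilinear[OF b]
  show ?case
    by (rule subspaceI)
      (simp_all add: bilinear_simps[OF bl] scaleR_left_distrib sum.distrib
        flip: scaleR_scaleR scaleR_sum_right)
next
  case (step x)
  then obtain j where j: "j \<in> I" "x = e j" by blast
  have "(\<Sum>i\<in>I. b x (e i) *\<^sub>R e i) = (\<Sum>i\<in>I. if i = j then e i else 0)"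
    using j orthonormal_onD[OF assms(3)] by (intro sum.cong) auto
  then show ?case using j \<open>finite I\<close> by simp
qed

lemma orthonormal_coeff:
  assumes b: "inner_product b" and "finite I" "orthonormal_on b I e" "j \<in> I"
  shows "b (\<Sum>i\<in>I. c i *\<^sub>R e i) (e j) = c j"
proof -
  note bl = inner_product_bilinear[OF b]
  have "b (\<Sum>i\<in>I. c i *\<^sub>R e i) (e j) = (\<Sum>i\<in>I. if i = j then c i else 0)"
    unfolding bilinear_sum_left[OF bl]
    by (intro sum.cong) (auto simp: bilinear_simps[OF bl] orthonormal_onD[OF assms(3)] \<open>j \<in> I\<close>)
  then show ?thesis using assms by simp
qed

lemma orthonormal_inj_on:
  assumes "orthonormal_on b I e" shows "inj_on e I"
proof (rule inj_onI)
  fix i j assume ij: "i \<in> I" "j \<in> I" "e i = e j"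
  show "i = j"
    using orthonormal_onD[OF assms ij(1,2)] orthonormal_onD[OF assms ij(1,1)] ij(3)
    by (auto split: if_splits)
qed

lemma orthonormal_independent:
  assumes b: "inner_product b" and I: "finite I" and e: "orthonormal_on b I e"
  shows "independent (e ` I)"
proof (rule independent_if_scalars_zero)
  fix f x assume *: "(\<Sum>x\<in>e ` I. f x *\<^sub>R x) = 0" and "x \<in> e ` I"
  then obtain j where j: "j \<in> I" "x = e j" by blast
  have "0 = (\<Sum>i\<in>I. f (e i) *\<^sub>R e i)"
    using * by (simp add: sum.reindex[OF orthonormal_inj_on[OF e]])
  then have "f (e j) = b 0 (e j)"
    using orthonormal_coeff[OF b I e j(1), of "\<lambda>i. f (e i)"] by simp
  then show "f x = 0" using j by (simp add: bilinear_lzero[OF inner_product_bilinear[OF b]])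
qed (use I in simp)

lemma orthonormal_dim_span:
  assumes "inner_product b" "finite I" "orthonormal_on b I e"
  shows "dim (span (e ` I)) = card I"
  using orthonormal_independent[OF assms] orthonormal_inj_on[OF assms(3)]
  by (metis card_image dim_eq_card_independent dim_span)

lemma orthonormal_span_eq:
  assumes "inner_product b" "finite I" "orthonormal_on b I e"
    and "subspace L" "e ` I \<subseteq> L" "card I = dim L"
  shows "span (e ` I) = L"
proof (rule subspace_dim_equal)
  show "dim L \<le> dim (span (e ` I))"
    using orthonormal_dim_span[OF assms(1-3)] assms(6) by simp
  show "span (e ` I) \<subseteq> L" using assms(4,5) by (simp add: span_minimal)
qed (use assms(4) in auto)

lemma parseval:
  assumes b: "inner_product b" and I: "finite I" "orthonormal_on b I e" and w: "w \<in> span (e ` I)"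
  shows "b w z = (\<Sum>i\<in>I. b w (e i) * b z (e i))"
proof -
  note bl = inner_product_bilinear[OF b]
  have "b w z = b (\<Sum>i\<in>I. b w (e i) *\<^sub>R e i) z"
    using orthonormal_expand[OF b I w] by simp
  also have "\<dots> = (\<Sum>i\<in>I. b w (e i) * b z (e i))"
    by (simp add: bilinear_sum_left[OF bl] bilinear_lmul[OF bl] inner_product_commute[OF b, of z])
  finally show ?thesis .
qed

text \<open>Gram-Schmidt inside \<open>L\<close>. Allowing every \<open>m \<le> dim L\<close> is
  what makes the induction on \<open>m\<close> go through.\<close>

lemma orthonormal_exists:
  assumes b: "inner_product b" and L: "subspace L" and "m \<le> dim L"
  shows "\<exists>e. orthonormal_on b {1..m} e \<and> e ` {1..m} \<subseteq> L"
  using \<open>m \<le> dim L\<close>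
proof (induction m)
  case 0
  then show ?case by (auto simp: orthonormal_on_def)
next
  case (Suc m)
  note bl = inner_product_bilinear[OF b]
  from Suc obtain e where e: "orthonormal_on b {1..m} e" "e ` {1..m} \<subseteq> L" by auto
  have sub: "span (e ` {1..m}) \<subseteq> L" using e L by (simp add: span_minimal)
  have "dim (span (e ` {1..m})) = m" using orthonormal_dim_span[OF b _ e(1)] by simp
  then have "span (e ` {1..m}) \<noteq> L" using Suc.prems by auto
  with sub obtain w where w: "w \<in> L" "w \<notin> span (e ` {1..m})" by blast
  define r where "r = w - (\<Sum>i\<in>{1..m}. b w (e i) *\<^sub>R e i)"
  have "r \<noteq> 0"
  proof
    assume "r = 0"
    then have "w = (\<Sum>i\<in>{1..m}. b w (e i) *\<^sub>R e i)" by (simp add: r_def)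
    also have "\<dots> \<in> span (e ` {1..m})" by (intro span_sum span_scale span_base) auto
    finally show False using w by simp
  qed
  then have pos: "b r r > 0" by (rule inner_product_pos[OF b])
  have rL: "r \<in> L"
    unfolding r_def using w e L by (intro subspace_diff subspace_sum subspace_scale) auto
  have r0: "b r (e j) = 0" if "j \<in> {1..m}" for j
    using orthonormal_coeff[OF b _ e(1) that, of "\<lambda>i. b w (e i)"]
    by (simp add: r_def bilinear_lsub[OF bl])
  define q where "q = (1 / sqrt (b r r)) *\<^sub>R r"
  have q: "b q q = 1" "q \<in> L" "\<And>j. j \<in> {1..m} \<Longrightarrow> b q (e j) = 0"
    using pos rL L r0 by (auto simp: q_def bilinear_simps[OF bl] subspace_scale)
  have "orthonormal_on b {1..Suc m} (e(Suc m := q))"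
    unfolding orthonormal_on_def
  proof (intro ballI)
    fix i j assume "i \<in> {1..Suc m}" "j \<in> {1..Suc m}"
    then have "i = Suc m \<or> i \<in> {1..m}" "j = Suc m \<or> j \<in> {1..m}" by auto
    then show "b ((e(Suc m := q)) i) ((e(Suc m := q)) j) = (if i = j then 1 else 0)"
      using q(1) q(3)[of i] q(3)[of j] orthonormal_onD[OF e(1), of i j]
        inner_product_commute[OF b, of "e i" q]
      by (elim disjE) simp_all
  qed
  moreover have "(e(Suc m := q)) ` {1..Suc m} \<subseteq> L" using e(2) q(2) by (auto simp: image_subset_iff)
  ultimately show ?case by (intro exI[of _ "e(Suc m := q)"] conjI)
qed

lemma onb_iff:
  "onb b L e \<longleftrightarrow> orthonormal_on b {1..dim L} e \<and> span (e ` {1..dim L}) = L"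
  unfolding onb_def orthonormal_on_def ..

lemma onb_exists:
  assumes "inner_product b" "subspace L" shows "\<exists>e. onb b L e"
proof -
  obtain e where e: "orthonormal_on b {1..dim L} e" "e ` {1..dim L} \<subseteq> L"
    using orthonormal_exists[OF assms order_refl] by blast
  then have "span (e ` {1..dim L}) = L"
    by (intro orthonormal_span_eq[OF assms(1) _ _ assms(2)]) auto
  with e show ?thesis unfolding onb_iff by blast
qed

text \<open>The matrix \<open>b (e i) (f k)\<close> has orthonormal columns by Parseval, so
  expanding each \<open>e i\<close> in the \<open>f k\<close> leaves only diagonal terms. This
  removes the dependence on the bases picked by \<open>SOME\<close> in \<open>tau\<close> and
  \<open>mean_curvature\<close>; for the latter \<open>\<beta>\<close> is vector valued.\<close>

lemma trace_orthonormal_unique: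
  assumes b: "inner_product b" and \<beta>: "bilinear \<beta>"
    and I: "finite I" "orthonormal_on b I e" and K: "finite K" "orthonormal_on b K f"
    and span: "span (e ` I) = span (f ` K)"
  shows "(\<Sum>i\<in>I. \<beta> (e i) (e i)) = (\<Sum>k\<in>K. \<beta> (f k) (f k))"
proof -
  have *: "\<beta> (e i) (e i) = (\<Sum>k\<in>K. \<Sum>l\<in>K. (b (e i) (f k) * b (e i) (f l)) *\<^sub>R \<beta> (f k) (f l))"
    if "i \<in> I" for i
  proof -
    have "e i \<in> span (f ` K)" using that by (simp add: span_base flip: span)
    from orthonormal_expand[OF b K this] have "\<beta> (e i) (e i) =
      \<beta> (\<Sum>k\<in>K. b (e i) (f k) *\<^sub>R f k) (\<Sum>l\<in>K. b (e i) (f l) *\<^sub>R f l)" by simp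
    also have "\<dots> = (\<Sum>k\<in>K. \<Sum>l\<in>K. \<beta> (b (e i) (f k) *\<^sub>R f k) (b (e i) (f l) *\<^sub>R f l))"
      unfolding bilinear_sum_left[OF \<beta>] unfolding bilinear_sum_right[OF \<beta>] ..
    finally show ?thesis by (simp add: bilinear_simps[OF \<beta>] mult.commute)
  qed
  have "(\<Sum>i\<in>I. \<beta> (e i) (e i)) =
      (\<Sum>k\<in>K. \<Sum>l\<in>K. (\<Sum>i\<in>I. b (e i) (f k) * b (e i) (f l)) *\<^sub>R \<beta> (f k) (f l))"
    unfolding scaleR_sum_left sum.swap[where A = K and B = I] by (rule sum.cong[OF refl *])
  also have "\<dots> = (\<Sum>k\<in>K. \<Sum>l\<in>K. if l = k then \<beta> (f k) (f l) else 0)"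
  proof (intro sum.cong refl)
    fix k l assume kl: "k \<in> K" "l \<in> K"
    then have "f k \<in> span (e ` I)" by (simp add: span_base span)
    from parseval[OF b I this, of "f l"]
    have "(\<Sum>i\<in>I. b (e i) (f k) * b (e i) (f l)) = b (f k) (f l)"
      by (simp add: inner_product_commute[OF b, of "e _"])
    then show "(\<Sum>i\<in>I. b (e i) (f k) * b (e i) (f l)) *\<^sub>R \<beta> (f k) (f l) = (if l = k then \<beta> (f k) (f l) else 0)"
      using orthonormal_onD[OF K(2) kl] by auto
  qed
  also have "\<dots> = (\<Sum>k\<in>K. \<beta> (f k) (f k))" using K by simp
  finally show ?thesis .
qed


section \<open>The algebraic inequality\<close>

text \<open>Cauchy-Schwarz with its remainder kept: for positive weights and fixed \<open>T\<close>,
  the sum of \<open>w i * (S i)\<^sup>2\<close> is smallest at \<open>S i = T / (W * w i)\<close>,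
  and the left-hand side measures the deviation from that point.\<close>

lemma sum_square_deviation_weighted:
  fixes S w :: "'k \<Rightarrow> real"
  assumes "finite K" and w: "\<And>i. i \<in> K \<Longrightarrow> w i \<noteq> 0"
    and W: "(\<Sum>i\<in>K. 1 / w i) = W" "W \<noteq> 0" and T: "(\<Sum>i\<in>K. S i) = T"
  shows "(\<Sum>i\<in>K. w i * (S i - T / (W * w i))\<^sup>2) = (\<Sum>i\<in>K. w i * (S i)\<^sup>2) - T\<^sup>2 / W"
proof -
  have "(\<Sum>i\<in>K. w i * (S i - T / (W * w i))\<^sup>2) =
      (\<Sum>i\<in>K. w i * (S i)\<^sup>2 - 2 * T / W * S i + T\<^sup>2 / W\<^sup>2 * (1 / w i))"
    using w W(2) by (intro sum.cong refl) (simp add: field_simps power2_eq_square)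
  also have "\<dots> = (\<Sum>i\<in>K. w i * (S i)\<^sup>2) - 2 * T / W * T + T\<^sup>2 / W\<^sup>2 * W"
    by (simp only: sum.distrib sum_subtractf flip: sum_distrib_left) (simp add: W T)
  also have "\<dots> = (\<Sum>i\<in>K. w i * (S i)\<^sup>2) - T\<^sup>2 / W"
    using W(2) by (simp add: field_simps power2_eq_square)
  finally show ?thesis .
qed

lemma sum_square_deviation:
  fixes a :: "'i \<Rightarrow> real"
  assumes "finite D" "D \<noteq> {}" "(\<Sum>\<alpha>\<in>D. a \<alpha>) = S"
  shows "(\<Sum>\<alpha>\<in>D. (a \<alpha> - S / card D)\<^sup>2) = (\<Sum>\<alpha>\<in>D. (a \<alpha>)\<^sup>2) - S\<^sup>2 / card D"
proof -
  have "(\<Sum>\<alpha>\<in>D. (a \<alpha> - S / card D)\<^sup>2) = (\<Sum>\<alpha>\<in>D. (a \<alpha>)\<^sup>2 - 2 * S / card D * a \<alpha> + S\<^sup>2 / (card D)\<^sup>2)"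
    by (intro sum.cong refl) (simp add: power2_diff power_divide)
  also have "\<dots> = (\<Sum>\<alpha>\<in>D. (a \<alpha>)\<^sup>2) - 2 * S / card D * S + card D * (S\<^sup>2 / (card D)\<^sup>2)"
    by (simp only: sum.distrib sum_subtractf flip: sum_distrib_left) (simp add: assms(3))
  also have "\<dots> = (\<Sum>\<alpha>\<in>D. (a \<alpha>)\<^sup>2) - S\<^sup>2 / card D"
    using assms(1,2) by (simp add: field_simps power2_eq_square card_gt_0_iff)
  finally show ?thesis .
qed

text \<open>The slack for one upper index \<open>\<gamma>\<close> in block \<open>l\<close>, with
  \<open>a \<alpha>\<close> standing for \<open>h \<gamma> \<alpha> \<alpha>\<close>. The last sum
  is the loss within the blocks other than \<open>l\<close>, the middle one the loss between blocks,
  and the first term the price of replacing \<open>W\<close>, which depends on \<open>l\<close>, by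
  a common \<open>M\<close>. In \<open>w\<close> the summand \<open>1 / N i\<close> comes from the
  step within block \<open>i\<close>.\<close>

lemma block_defect:
  fixes a :: "'i \<Rightarrow> real" and D :: "'k \<Rightarrow> 'i set"
  assumes K: "finite K" "l \<in> K" and D: "\<And>i. i \<in> K \<Longrightarrow> finite (D i) \<and> D i \<noteq> {}"
    and N: "\<And>i. N i = real (card (D i))"
    and S: "\<And>i. S i = (\<Sum>\<alpha>\<in>D i. a \<alpha>)" and T: "T = (\<Sum>i\<in>K. S i)"
    and w: "\<And>i. w i = (if i = l then 1 / 2 else 1 / 2 + 1 / N i)"
    and W: "W = 2 * real (card K) - 4 * (\<Sum>i\<in>K - {l}. 1 / (N i + 2))" "W > 0"
  shows "(1 / 2 - 1 / M) * T\<^sup>2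
      - ((T\<^sup>2 - (\<Sum>i\<in>K. (S i)\<^sup>2)) / 2 - (\<Sum>i\<in>K - {l}. \<Sum>\<alpha>\<in>D i. (a \<alpha>)\<^sup>2))
    = (1 / W - 1 / M) * T\<^sup>2 + (\<Sum>i\<in>K. w i * (S i - T / (W * w i))\<^sup>2)
      + (\<Sum>i\<in>K - {l}. \<Sum>\<alpha>\<in>D i. (a \<alpha> - S i / N i)\<^sup>2)"
proof -
  have N_pos: "N i > 0" if "i \<in> K" for i
    using D[OF that] by (simp add: N card_gt_0_iff)
  have split: "(\<Sum>i\<in>K. f i) = f l + (\<Sum>i\<in>K - {l}. f i)" for f :: "'k \<Rightarrow> real"
    using K by (rule sum.remove)
  \<comment> \<open>Here \<open>w i = (N i + 2) / (2 * N i)\<close>, so the reciprocal is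
    \<open>2 * N i / (N i + 2)\<close>; this is the source of \<open>n_i + 2\<close> in the
    bound.\<close>
  have inv_w: "1 / w i = 2 - 4 * (1 / (N i + 2))" if "i \<in> K - {l}" for i
    using N_pos[of i] that by (simp add: w divide_simps)
  have "(\<Sum>i\<in>K. 1 / w i) = 2 + (\<Sum>i\<in>K - {l}. 2 - 4 * (1 / (N i + 2)))"
    unfolding split using inv_w by (simp add: w)
  also have "\<dots> = W"
    using K card_gt_0_iff[of K] by (auto simp: W sum_subtractf sum_distrib_left card_Diff_singleton algebra_simps)
  finally have "(\<Sum>i\<in>K. w i * (S i - T / (W * w i))\<^sup>2) = (\<Sum>i\<in>K. w i * (S i)\<^sup>2) - T\<^sup>2 / W"
    by (intro sum_square_deviation_weighted) (use K W N_pos T in \<open>auto simp: w add_pos_pos less_imp_neq[symmetric]\<close>)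
  also have "(\<Sum>i\<in>K. w i * (S i)\<^sup>2) = (\<Sum>i\<in>K. (S i)\<^sup>2) / 2 + (\<Sum>i\<in>K - {l}. (S i)\<^sup>2 / N i)"
    unfolding split by (simp add: w sum_divide_distrib sum.distrib[symmetric] algebra_simps add_divide_distrib)
  finally have 1: "(\<Sum>i\<in>K. w i * (S i - T / (W * w i))\<^sup>2) =
      (\<Sum>i\<in>K. (S i)\<^sup>2) / 2 + (\<Sum>i\<in>K - {l}. (S i)\<^sup>2 / N i) - T\<^sup>2 / W" .
  have 2: "(\<Sum>i\<in>K - {l}. \<Sum>\<alpha>\<in>D i. (a \<alpha> - S i / N i)\<^sup>2) =
      (\<Sum>i\<in>K - {l}. \<Sum>\<alpha>\<in>D i. (a \<alpha>)\<^sup>2) - (\<Sum>i\<in>K - {l}. (S i)\<^sup>2 / N i)"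
    unfolding sum_subtractf[symmetric]
    by (intro sum.cong refl) (use D in \<open>simp add: N S sum_square_deviation\<close>)
  show ?thesis unfolding 1 2 by (simp add: field_simps)
qed

section \<open>Sums over pairs of indices from different blocks\<close>

lemma sum_offdiagonal_swap:
  assumes "finite K"
  shows "(\<Sum>i\<in>K. \<Sum>j\<in>K - {i}. f i j) = (\<Sum>j\<in>K. \<Sum>i\<in>K - {j}. f i j)"
proof -
  have "(\<Sum>i\<in>K. \<Sum>j\<in>K - {i}. f i j) = (\<Sum>i\<in>K. \<Sum>j | j \<in> K \<and> j \<noteq> i. f i j)"
    by (intro sum.cong) auto
  also have "\<dots> = (\<Sum>j\<in>K. \<Sum>i | i \<in> K \<and> j \<noteq> i. f i j)"
    by (rule sum.swap_restrict) (use assms in auto)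
  also have "\<dots> = (\<Sum>j\<in>K. \<Sum>i\<in>K - {j}. f i j)"
    by (intro sum.cong) auto
  finally show ?thesis .
qed

lemma sum_offdiagonal_product:
  fixes S :: "'k \<Rightarrow> real"
  assumes "finite K"
  shows "(\<Sum>i\<in>K. \<Sum>j\<in>K - {i}. S i * S j) = (\<Sum>i\<in>K. S i)\<^sup>2 - (\<Sum>i\<in>K. (S i)\<^sup>2)"
proof -
  have "(\<Sum>i\<in>K. \<Sum>j\<in>K - {i}. S i * S j) = (\<Sum>i\<in>K. S i * (\<Sum>j\<in>K. S j) - (S i)\<^sup>2)"
    using assms by (intro sum.cong refl)
      (simp add: sum_diff1 sum_distrib_left[symmetric] algebra_simps power2_eq_square)
  then show ?thesis by (simp add: sum_subtractf power2_eq_square flip: sum_distrib_right)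
qed

text \<open>Blocks stay abstract because the estimate is used with two partitions: the integer
  intervals \<open>block ns i\<close> for the given adapted basis, and pairs of a block and a
  position for the bases constructed for arbitrary tuples.\<close>

locale index_blocks =
  fixes K :: "'k set" and D :: "'k \<Rightarrow> 'i set" and I :: "'i set"
  assumes finite_K: "finite K" and finite_D: "i \<in> K \<Longrightarrow> finite (D i)"
    and D_nonempty: "i \<in> K \<Longrightarrow> D i \<noteq> {}"
    and disjoint: "i \<in> K \<Longrightarrow> j \<in> K \<Longrightarrow> i \<noteq> j \<Longrightarrow> D i \<inter> D j = {}"
    and I_eq: "I = (\<Union>i\<in>K. D i)"
begin

lemma finite_I: "finite I" using finite_K finite_D by (auto simp: I_eq)

lemma sum_I: "(\<Sum>A\<in>I. f A) = (\<Sum>i\<in>K. \<Sum>A\<in>D i. f A)" for f :: "'i \<Rightarrow> 'b::comm_monoid_add"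
  unfolding I_eq by (rule sum.UNION_disjoint) (use finite_K finite_D disjoint in auto)

text \<open>By total symmetry the entry with \<open>C = A\<close> is \<open>h B A A\<close> and the
  one with \<open>C = B\<close> is \<open>h A B B\<close>. These are diagonal entries whose upper
  index lies in another block, so grouping by the upper index decouples the expression. Ordered
  pairs count each unordered pair twice, whence the factor 2.\<close>

lemma sum_cross_blocks:
  fixes h :: "'i \<Rightarrow> 'i \<Rightarrow> 'i \<Rightarrow> real"
  assumes sym: "\<And>A B C. h C A B = h C B A" "\<And>A B C. h C A B = h A C B"
  defines "S \<equiv> \<lambda>C i. \<Sum>\<alpha>\<in>D i. h C \<alpha> \<alpha>"
  shows "(\<Sum>i\<in>K. \<Sum>j\<in>K - {i}. \<Sum>A\<in>D i. \<Sum>B\<in>D j. \<Sum>C\<in>I. h C A A * h C B B - (h C A B)\<^sup>2) =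
    2 * (\<Sum>l\<in>K. \<Sum>\<gamma>\<in>D l. (((\<Sum>i\<in>K. S \<gamma> i)\<^sup>2 - (\<Sum>i\<in>K. (S \<gamma> i)\<^sup>2)) / 2
        - (\<Sum>i\<in>K - {l}. \<Sum>\<alpha>\<in>D i. (h \<gamma> \<alpha> \<alpha>)\<^sup>2)))
    - (\<Sum>i\<in>K. \<Sum>j\<in>K - {i}. \<Sum>A\<in>D i. \<Sum>B\<in>D j. \<Sum>C\<in>I - {A, B}. (h C A B)\<^sup>2)"
proof -
  have term_eq: "(\<Sum>C\<in>I. h C A A * h C B B - (h C A B)\<^sup>2) = (\<Sum>C\<in>I. h C A A * h C B B)
      - (h A B B)\<^sup>2 - (h B A A)\<^sup>2 - (\<Sum>C\<in>I - {A, B}. (h C A B)\<^sup>2)"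
    if "i \<in> K" "j \<in> K - {i}" "A \<in> D i" "B \<in> D j" for i j A B
  proof -
    have "A \<noteq> B" "A \<in> I" "B \<in> I" using that disjoint[of i j] by (auto simp: I_eq)
    then have "(\<Sum>C\<in>I. (h C A B)\<^sup>2) = (\<Sum>C\<in>{A, B}. (h C A B)\<^sup>2) + (\<Sum>C\<in>I - {A, B}. (h C A B)\<^sup>2)"
      by (subst add.commute, intro sum.subset_diff finite_I) auto
    also have "(\<Sum>C\<in>{A, B}. (h C A B)\<^sup>2) = (h A B B)\<^sup>2 + (h B A A)\<^sup>2"
      using \<open>A \<noteq> B\<close> trans[OF sym(1) sym(2), of A A B] sym(2)[of B A B] by simp
    finally show ?thesis by (simp add: sum_subtractf)
  qed
  have "(\<Sum>i\<in>K. \<Sum>j\<in>K - {i}. \<Sum>A\<in>D i. \<Sum>B\<in>D j. \<Sum>C\<in>I. h C A A * h C B B - (h C A B)\<^sup>2) =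
    (\<Sum>i\<in>K. \<Sum>j\<in>K - {i}. \<Sum>A\<in>D i. \<Sum>B\<in>D j. \<Sum>C\<in>I. h C A A * h C B B)
    - (\<Sum>i\<in>K. \<Sum>j\<in>K - {i}. \<Sum>A\<in>D i. \<Sum>B\<in>D j. (h A B B)\<^sup>2)
    - (\<Sum>i\<in>K. \<Sum>j\<in>K - {i}. \<Sum>A\<in>D i. \<Sum>B\<in>D j. (h B A A)\<^sup>2)
    - (\<Sum>i\<in>K. \<Sum>j\<in>K - {i}. \<Sum>A\<in>D i. \<Sum>B\<in>D j. \<Sum>C\<in>I - {A, B}. (h C A B)\<^sup>2)"
    unfolding sum_subtractf[symmetric] by (intro sum.cong refl term_eq)
  moreover have "(\<Sum>i\<in>K. \<Sum>j\<in>K - {i}. \<Sum>A\<in>D i. \<Sum>B\<in>D j. \<Sum>C\<in>I. h C A A * h C B B) =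
      (\<Sum>C\<in>I. \<Sum>i\<in>K. \<Sum>j\<in>K - {i}. S C i * S C j)"
    by (simp only: S_def sum_product sum.swap[where B = I])
  moreover have "(\<Sum>i\<in>K. \<Sum>j\<in>K - {i}. \<Sum>A\<in>D i. \<Sum>B\<in>D j. (h A B B)\<^sup>2) =
      (\<Sum>l\<in>K. \<Sum>\<gamma>\<in>D l. \<Sum>i\<in>K - {l}. \<Sum>\<alpha>\<in>D i. (h \<gamma> \<alpha> \<alpha>)\<^sup>2)"
    by (intro sum.cong refl sum.swap)
  moreover have "(\<Sum>i\<in>K. \<Sum>j\<in>K - {i}. \<Sum>A\<in>D i. \<Sum>B\<in>D j. (h B A A)\<^sup>2) =
      (\<Sum>l\<in>K. \<Sum>\<gamma>\<in>D l. \<Sum>i\<in>K - {l}. \<Sum>\<alpha>\<in>D i. (h \<gamma> \<alpha> \<alpha>)\<^sup>2)"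
  proof -
    have inner: "(\<Sum>i\<in>K'. \<Sum>A\<in>D i. \<Sum>B\<in>L. f A B) = (\<Sum>B\<in>L. \<Sum>i\<in>K'. \<Sum>A\<in>D i. f A B)"
      for K' L and f :: "'i \<Rightarrow> 'i \<Rightarrow> real"
    proof -
      have "(\<Sum>i\<in>K'. \<Sum>A\<in>D i. \<Sum>B\<in>L. f A B) = (\<Sum>i\<in>K'. \<Sum>B\<in>L. \<Sum>A\<in>D i. f A B)"
        by (intro sum.cong refl sum.swap)
      then show ?thesis using sum.swap[of "\<lambda>i B. \<Sum>A\<in>D i. f A B" L K'] by simp
    qed
    show ?thesis
      by (subst sum_offdiagonal_swap[OF finite_K]) (intro sum.cong refl inner)
  qed
  ultimately show ?thesis
    by (simp add: sum_I sum_offdiagonal_product[OF finite_K] sum_subtractf sum_divide_distrib[symmetric] algebra_simps)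
qed

text \<open>\<open>Y - X\<close> is a sum of nonnegative terms, and each conclusion of the equality
  case is the vanishing of one kind of term. One constant \<open>M\<close> above all
  \<open>W l\<close> is used so that the bounds for the different upper indices add up to a multiple
  of the squared norm of the trace.\<close>

lemma cross_blocks_inequality:
  fixes h :: "'i \<Rightarrow> 'i \<Rightarrow> 'i \<Rightarrow> real" and M :: real
  assumes sym: "\<And>A B C. h C A B = h C B A" "\<And>A B C. h C A B = h A C B"
  defines "N \<equiv> \<lambda>i. real (card (D i))"
  defines "W \<equiv> \<lambda>l. 2 * real (card K) - 4 * (\<Sum>i\<in>K - {l}. 1 / (N i + 2))"
  defines "X \<equiv> \<Sum>i\<in>K. \<Sum>j\<in>K - {i}. \<Sum>A\<in>D i. \<Sum>B\<in>D j. \<Sum>C\<in>I. h C A A * h C B B - (h C A B)\<^sup>2"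
  defines "Y \<equiv> 2 * (1 / 2 - 1 / M) * (\<Sum>C\<in>I. (\<Sum>A\<in>I. h C A A)\<^sup>2)"
  assumes W: "\<And>l. l \<in> K \<Longrightarrow> W l > 0" "\<And>l. l \<in> K \<Longrightarrow> W l \<le> M"
  shows "X \<le> Y"
    and "X = Y \<Longrightarrow> i \<in> K \<Longrightarrow> j \<in> K \<Longrightarrow> i \<noteq> j \<Longrightarrow> A \<in> D i \<Longrightarrow> B \<in> D j \<Longrightarrow> C \<in> I \<Longrightarrow> C \<noteq> A \<Longrightarrow>
      C \<noteq> B \<Longrightarrow> h C A B = 0"
    and "X = Y \<Longrightarrow> l \<in> K \<Longrightarrow> \<gamma> \<in> D l \<Longrightarrow> i \<in> K \<Longrightarrow> i \<noteq> l \<Longrightarrow> \<alpha> \<in> D i \<Longrightarrow>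
      (\<Sum>\<beta>\<in>D l. h \<gamma> \<beta> \<beta>) = (N i + 2) * h \<gamma> \<alpha> \<alpha>"
    and "X = Y \<Longrightarrow> l \<in> K \<Longrightarrow> \<gamma> \<in> D l \<Longrightarrow> W l < M \<Longrightarrow> (\<Sum>\<beta>\<in>D l. h \<gamma> \<beta> \<beta>) = 0"
proof -
  define S where "S = (\<lambda>C i. \<Sum>\<alpha>\<in>D i. h C \<alpha> \<alpha>)"
  define T where "T = (\<lambda>C. \<Sum>i\<in>K. S C i)"
  define w where "w = (\<lambda>l i. if i = l then 1 / 2 else 1 / 2 + 1 / N i)"
  \<comment> \<open>\<open>E\<close> collects the squares with \<open>C\<close> outside
    \<open>{A, B}\<close>; \<open>d1\<close>, \<open>d2\<close>, \<open>d3\<close> are the change of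
    constant, the loss between blocks and the loss within blocks from
    \<open>block_defect\<close>.\<close>
  define E where "E = (\<Sum>i\<in>K. \<Sum>j\<in>K - {i}. \<Sum>A\<in>D i. \<Sum>B\<in>D j. \<Sum>C\<in>I - {A, B}. (h C A B)\<^sup>2)"
  define d1 where "d1 = (\<lambda>l \<gamma>. (1 / W l - 1 / M) * (T \<gamma>)\<^sup>2)"
  define d2 where "d2 = (\<lambda>l \<gamma>. \<Sum>i\<in>K. w l i * (S \<gamma> i - T \<gamma> / (W l * w l i))\<^sup>2)"
  define d3 where "d3 = (\<lambda>l \<gamma>. \<Sum>i\<in>K - {l}. \<Sum>\<alpha>\<in>D i. (h \<gamma> \<alpha> \<alpha> - S \<gamma> i / N i)\<^sup>2)"
  have N_pos: "N i > 0" if "i \<in> K" for i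
    using that finite_D D_nonempty by (simp add: N_def card_gt_0_iff)
  have w_pos: "w l i > 0" if "i \<in> K" for l i
    using N_pos[OF that] by (simp add: w_def add_pos_pos)
  have T: "(\<Sum>A\<in>I. h C A A) = T C" for C by (simp add: sum_I T_def S_def)
  have T_eq: "(\<Sum>i\<in>K. S C i) = T C" for C by (simp add: T_def)
  have defect: "(1 / 2 - 1 / M) * (T \<gamma>)\<^sup>2 - (((\<Sum>i\<in>K. S \<gamma> i)\<^sup>2 - (\<Sum>i\<in>K. (S \<gamma> i)\<^sup>2)) / 2
        - (\<Sum>i\<in>K - {l}. \<Sum>\<alpha>\<in>D i. (h \<gamma> \<alpha> \<alpha>)\<^sup>2)) = d1 l \<gamma> + d2 l \<gamma> + d3 l \<gamma>"
    if "l \<in> K" for l \<gamma>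
    unfolding d1_def d2_def d3_def T_eq
    by (rule block_defect[where D = D and N = N and S = "S \<gamma>" and w = "w l" and W = "W l"])
      (use that finite_K finite_D D_nonempty W in \<open>auto simp: N_def S_def T_def w_def W_def\<close>)
  have X: "X = 2 * (\<Sum>l\<in>K. \<Sum>\<gamma>\<in>D l. (((\<Sum>i\<in>K. S \<gamma> i)\<^sup>2 - (\<Sum>i\<in>K. (S \<gamma> i)\<^sup>2)) / 2
        - (\<Sum>i\<in>K - {l}. \<Sum>\<alpha>\<in>D i. (h \<gamma> \<alpha> \<alpha>)\<^sup>2))) - E"
    unfolding X_def E_def S_def by (rule sum_cross_blocks[OF sym])
  have Y: "Y = 2 * (\<Sum>l\<in>K. \<Sum>\<gamma>\<in>D l. (1 / 2 - 1 / M) * (T \<gamma>)\<^sup>2)"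
    unfolding Y_def T by (simp only: sum_I sum_distrib_left mult.assoc)
  have YX: "Y - X = 2 * (\<Sum>l\<in>K. \<Sum>\<gamma>\<in>D l. d1 l \<gamma> + d2 l \<gamma> + d3 l \<gamma>) + E"
  proof -
    have "(\<Sum>l\<in>K. \<Sum>\<gamma>\<in>D l. d1 l \<gamma> + d2 l \<gamma> + d3 l \<gamma>) =
        (\<Sum>l\<in>K. \<Sum>\<gamma>\<in>D l. (1 / 2 - 1 / M) * (T \<gamma>)\<^sup>2) -
        (\<Sum>l\<in>K. \<Sum>\<gamma>\<in>D l. (((\<Sum>i\<in>K. S \<gamma> i)\<^sup>2 - (\<Sum>i\<in>K. (S \<gamma> i)\<^sup>2)) / 2
        - (\<Sum>i\<in>K - {l}. \<Sum>\<alpha>\<in>D i. (h \<gamma> \<alpha> \<alpha>)\<^sup>2)))"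
      unfolding sum_subtractf[symmetric] by (intro sum.cong refl) (simp only: defect)
    then show ?thesis unfolding X Y by simp
  qed
  have E_nonneg: "E \<ge> 0" unfolding E_def by (intro sum_nonneg zero_le_power2)
  have d1_nonneg: "d1 l \<gamma> \<ge> 0" if "l \<in> K" for l \<gamma>
    unfolding d1_def using W[OF that] by (intro mult_nonneg_nonneg) (auto simp: frac_le)
  have d2_nonneg: "d2 l \<gamma> \<ge> 0" for l \<gamma>
    unfolding d2_def by (intro sum_nonneg mult_nonneg_nonneg) (use w_pos less_imp_le in auto)
  have d3_nonneg: "d3 l \<gamma> \<ge> 0" for l \<gamma>
    unfolding d3_def by (intro sum_nonneg zero_le_power2)
  have d_nonneg: "d1 l \<gamma> + d2 l \<gamma> + d3 l \<gamma> \<ge> 0" if "l \<in> K" for l \<gamma>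
    using d1_nonneg[OF that] d2_nonneg d3_nonneg by (simp add: add_nonneg_nonneg)
  have sum_nonneg': "(\<Sum>l\<in>K. \<Sum>\<gamma>\<in>D l. d1 l \<gamma> + d2 l \<gamma> + d3 l \<gamma>) \<ge> 0"
    by (intro sum_nonneg d_nonneg)
  show "X \<le> Y" using YX E_nonneg sum_nonneg' by linarith
  assume eq: "X = Y"
  then have E0: "E = 0" and sum0: "(\<Sum>l\<in>K. \<Sum>\<gamma>\<in>D l. d1 l \<gamma> + d2 l \<gamma> + d3 l \<gamma>) = 0"
    using YX E_nonneg sum_nonneg' by linarith+
  show "h C A B = 0" if "i \<in> K" "j \<in> K" "i \<noteq> j" "A \<in> D i" "B \<in> D j" "C \<in> I" "C \<noteq> A" "C \<noteq> B" for i j A B C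
  proof -
    have "(\<Sum>j\<in>K - {i}. \<Sum>A\<in>D i. \<Sum>B\<in>D j. \<Sum>C\<in>I - {A, B}. (h C A B)\<^sup>2) = 0"
      by (rule sum_nonneg_0[OF finite_K _ E0[unfolded E_def] that(1)]) (intro sum_nonneg zero_le_power2)
    then have "(\<Sum>A\<in>D i. \<Sum>B\<in>D j. \<Sum>C\<in>I - {A, B}. (h C A B)\<^sup>2) = 0"
      by (rule sum_nonneg_0[rotated 2]) (use that finite_K in \<open>auto intro!: sum_nonneg\<close>)
    then have "(\<Sum>B\<in>D j. \<Sum>C\<in>I - {A, B}. (h C A B)\<^sup>2) = 0"
      by (rule sum_nonneg_0[rotated 2]) (use that finite_D in \<open>auto intro!: sum_nonneg\<close>)
    then have "(\<Sum>C\<in>I - {A, B}. (h C A B)\<^sup>2) = 0"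
      by (rule sum_nonneg_0[rotated 2]) (use that finite_D in \<open>auto intro!: sum_nonneg\<close>)
    then have "(h C A B)\<^sup>2 = 0"
      by (rule sum_nonneg_0[rotated 2]) (use that finite_I in auto)
    then show ?thesis by simp
  qed
  have d0: "d1 l \<gamma> = 0 \<and> d2 l \<gamma> = 0 \<and> d3 l \<gamma> = 0" if "l \<in> K" "\<gamma> \<in> D l" for l \<gamma>
  proof -
    have "(\<Sum>\<gamma>\<in>D l. d1 l \<gamma> + d2 l \<gamma> + d3 l \<gamma>) = 0"
      by (rule sum_nonneg_0[OF finite_K _ sum0 that(1)]) (intro sum_nonneg d_nonneg)
    from sum_nonneg_0[OF finite_D[OF that(1)] d_nonneg[OF that(1)] this that(2)]
    show ?thesis using d1_nonneg[OF that(1), of \<gamma>] d2_nonneg[of l \<gamma>] d3_nonneg[of l \<gamma>] by linarith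
  qed
  have S_eq: "S \<gamma> i = T \<gamma> / (W l * w l i)" if "l \<in> K" "\<gamma> \<in> D l" "i \<in> K" for l \<gamma> i
  proof -
    have "d2 l \<gamma> = 0" using d0[OF that(1,2)] by simp
    from sum_nonneg_0[OF finite_K _ this[unfolded d2_def] that(3)]
    have "w l i * (S \<gamma> i - T \<gamma> / (W l * w l i))\<^sup>2 = 0"
      by (simp add: mult_nonneg_nonneg less_imp_le[OF w_pos])
    then show ?thesis using w_pos[OF that(3), of l] by simp
  qed
  have h_eq: "h \<gamma> \<alpha> \<alpha> = S \<gamma> i / N i" if "l \<in> K" "\<gamma> \<in> D l" "i \<in> K" "i \<noteq> l" "\<alpha> \<in> D i" for l \<gamma> i \<alpha>
  proof -
    have "d3 l \<gamma> = 0" using d0[OF that(1,2)] by simp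
    then have "(\<Sum>\<alpha>\<in>D i. (h \<gamma> \<alpha> \<alpha> - S \<gamma> i / N i)\<^sup>2) = 0"
      unfolding d3_def by (rule sum_nonneg_0[rotated 2]) (use that finite_K in \<open>auto intro!: sum_nonneg\<close>)
    from sum_nonneg_0[OF finite_D[OF that(3)] _ this that(5)]
    show ?thesis by simp
  qed
  have S_l: "(\<Sum>\<beta>\<in>D l. h \<gamma> \<beta> \<beta>) = 2 * T \<gamma> / W l" if "l \<in> K" "\<gamma> \<in> D l" for l \<gamma>
    using S_eq[OF that that(1)] by (simp add: S_def w_def)
  show "(\<Sum>\<beta>\<in>D l. h \<gamma> \<beta> \<beta>) = (N i + 2) * h \<gamma> \<alpha> \<alpha>"
    if "l \<in> K" "\<gamma> \<in> D l" "i \<in> K" "i \<noteq> l" "\<alpha> \<in> D i" for l \<gamma> i \<alpha>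
  proof -
    \<comment> \<open>The sum over block \<open>l\<close> is \<open>2 * T \<gamma> / W l\<close>,
      while \<open>h \<gamma> \<alpha> \<alpha>\<close> is
      \<open>T \<gamma> / (W l * w l i * N i)\<close>; the factor between them is
      \<open>2 * w l i * N i\<close>.\<close>
    have "N i + 2 = 2 * (w l i * N i)" using N_pos[OF that(3)] that(4) by (simp add: w_def field_simps)
    moreover have "h \<gamma> \<alpha> \<alpha> = T \<gamma> / (W l * w l i) / N i"
      using h_eq[OF that] S_eq[OF that(1-3)] by simp
    ultimately show ?thesis
      using S_l[OF that(1,2)] N_pos[OF that(3)] W(1)[OF that(1)] w_pos[OF that(3), of l] by simp
  qed
  show "(\<Sum>\<beta>\<in>D l. h \<gamma> \<beta> \<beta>) = 0" if "l \<in> K" "\<gamma> \<in> D l" "W l < M" for l \<gamma>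
  proof -
    \<comment> \<open>A block with \<open>W l < M\<close> has a positive coefficient in
      \<open>d1\<close>, so the whole trace \<open>T \<gamma>\<close> vanishes, and with it the sum
      over block \<open>l\<close>.\<close>
    have "1 / W l - 1 / M \<noteq> 0" using W(1)[OF that(1)] that(3) by (simp add: field_simps)
    with d0[OF that(1,2)] have "T \<gamma> = 0" by (simp add: d1_def)
    with S_l[OF that(1,2)] show ?thesis by simp
  qed
qed

end


section \<open>Curvature tensors of constant holomorphic sectional curvature\<close>

text \<open>The octahedron argument: the Bianchi identities at the four cyclic shifts of
  \<open>u\<close>, \<open>v\<close>, \<open>w\<close>, \<open>z\<close>, rewritten by the two skew
  symmetries, combine linearly.\<close>

lemma curvature_pair_symmetry:
  fixes R :: "'a \<Rightarrow> 'a \<Rightarrow> 'a \<Rightarrow> 'a \<Rightarrow> real"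
  assumes skew12: "\<And>u v w z. R v u w z = - R u v w z"
    and skew34: "\<And>u v w z. R u v z w = - R u v w z"
    and bianchi: "\<And>u v w z. R u v w z + R v w u z + R w u v z = 0"
  shows "R u v w z = R w z u v"
  using bianchi[of u v w z] bianchi[of v w z u] bianchi[of w z u v] bianchi[of z u v w]
    skew12[of u v w z] skew12[of w v u z] skew12[of u w v z] skew12[of z w v u] skew12[of w z u v]
    skew12[of z v w u] skew12[of z u v w] skew12[of u z w v] skew12[of v z u w]
    skew34[of u v w z] skew34[of v w u z] skew34[of w u v z] skew34[of v w z u] skew34[of w z v u]
    skew34[of w z u v] skew34[of z v w u] skew34[of z u w v] skew34[of z u v w] skew34[of u w z v]
    skew34[of u v z w] skew34[of v z u w]
  by linarith

text \<open>Polarising the constancy of the holomorphic sectional curvature gives \<open>A + 3 B\<close>, where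
  \<open>A = R u v v u\<close> and \<open>B = R u (J v) (J v) u\<close>; replacing \<open>v\<close> by \<open>J v\<close> exchanges \<open>A\<close> and \<open>B\<close>.\<close>

lemma holomorphic_curvature_totally_real:
  fixes R :: "'a::euclidean_space \<Rightarrow> 'a \<Rightarrow> 'a \<Rightarrow> 'a \<Rightarrow> real"
  assumes bil12: "\<And>w z. bilinear (\<lambda>u v. R u v w z)" and bil34: "\<And>u v. bilinear (R u v)"
    and skew12: "\<And>u v w z. R v u w z = - R u v w z"
    and skew34: "\<And>u v w z. R u v z w = - R u v w z"
    and bianchi: "\<And>u v w z. R u v w z + R v w u z + R w u v z = 0"
    and J: "linear J" "\<And>v. J (J v) = - v" and RJ: "\<And>u v w z. R u v (J w) (J z) = R u v w z"
    and b: "inner_product b" and bJ: "\<And>u v. b (J u) (J v) = b u v"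
    and hol: "\<And>u. R u (J u) (J u) u = 4 * c * (b u u)\<^sup>2"
    and uv: "b u (J v) = 0"
  shows "R u v v u = c * (b u u * b v v - (b u v)\<^sup>2)"
proof -
  note bl = inner_product_bilinear[OF b]
  note lin = bilinear_simps[OF bil12] bilinear_simps[OF bil34] bilinear_simps[OF bl]
  note pair = curvature_pair_symmetry[of R, OF skew12 skew34 bianchi]
  have RJ': "R (J u) (J v) w z = R u v w z" for u v w z
    using pair[of "J u" "J v" w z] pair[of w z u v] RJ[of w z u v] by simp
  have polar: "R u v v u + 3 * R u (J v) (J v) u = 4 * c * (b u u * b v v + 2 * (b u v)\<^sup>2)" for u v
  proof -
    \<comment> \<open>Adding \<open>hol\<close> at \<open>u + v\<close> and at \<open>u - v\<close>
      cancels the terms odd in \<open>v\<close>; the six summands are the placements of two copies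
      of \<open>u\<close> and two of \<open>v\<close>.\<close>
    have "R u (J u) (J v) v + R u (J v) (J u) v + R u (J v) (J v) u + R v (J u) (J u) v
        + R v (J u) (J v) u + R v (J v) (J u) u = 4 * c * (2 * (b u u * b v v) + 4 * (b u v)\<^sup>2)"
      using hol[of "u + v"] hol[of "u - v"] hol[of u] hol[of v]
      by (simp add: lin linear_add[OF J(1)] linear_diff[OF J(1)] inner_product_commute[OF b, of v u]
          power2_eq_square algebra_simps)
    \<comment> \<open>Four of the six summands equal \<open>B\<close>, and the Bianchi identity
      turns each of the other two into \<open>A + B\<close>; the total is
      \<open>2 * A + 6 * B\<close>.\<close>
    moreover have "R v (J v) (J u) u = R u (J u) (J v) v"
      using pair[of v "J v" "J u" u] skew12[of "J u" u v "J v"] skew34[of u "J u" v "J v"] by simp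
    moreover have "R u (J v) (J u) v = R u (J v) (J v) u"
      using RJ[of u "J v" "J u" v] skew34[of u "J v" u "J v"] by (simp add: J lin)
    moreover have "R v (J u) (J v) u = R v (J u) (J u) v"
      using RJ[of v "J u" "J v" u] skew34[of v "J u" v "J u"] by (simp add: J lin)
    moreover have "R v (J u) (J u) v = R u (J v) (J v) u"
      using RJ'[of u "J v" "J v" u] RJ[of "J u" "- v" "J v" u] skew12[of v "J u" v "J u"]
        skew34[of "J u" v v "J u"] skew12[of v "J u" "J u" v]
      by (simp add: J lin)
    moreover have "R u (J u) (J v) v = R u v v u + R u (J v) (J v) u"
      using bianchi[of u "J u" "J v" v] RJ'[of u v u v] skew34[of u v u v] skew12[of "J v" u "J u" v]
        \<open>R u (J v) (J u) v = R u (J v) (J v) u\<close>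
      by simp
    ultimately show ?thesis by (simp add: algebra_simps)
  qed
  \<comment> \<open>The mixed term is absent because \<open>b u (J v) = 0\<close>. Three times this
    equation minus the polarised one for \<open>v\<close> has left-hand side
    \<open>8 * A\<close>.\<close>
  have "R u (J v) (J v) u + 3 * R u v v u = 4 * c * (b u u * b v v)"
    using polar[of u "J v"] by (simp add: J lin uv bJ)
  with polar[of u v] show ?thesis by (simp add: algebra_simps)
qed


section \<open>Derivatives\<close>

lemma smooth_onD:
  assumes "smooth_on S f"
  shows "x \<in> S \<Longrightarrow> f differentiable (at x)"
    and "smooth_on S (\<lambda>x. frechet_derivative f (at x) v)"
    and "continuous_on S f"
proof -
  have *: "Ck_on k S f" for k using assms unfolding smooth_on_def by blast
  show "x \<in> S \<Longrightarrow> f differentiable (at x)" using *[of "Suc 0"] by simp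
  show "smooth_on S (\<lambda>x. frechet_derivative f (at x) v)"
    unfolding smooth_on_def using *[of "Suc _"] by simp
  show "continuous_on S f" using *[of 0] by simp
qed

lemma smooth_on_has_derivative:
  "smooth_on S f \<Longrightarrow> x \<in> S \<Longrightarrow> (f has_derivative frechet_derivative f (at x)) (at x)"
  using smooth_onD(1) frechet_derivative_works by blast

text \<open>The second difference is the increment along \<open>u\<close> of a difference along
  \<open>v\<close>; the mean value theorem along \<open>u\<close> and then along \<open>v\<close>
  turns it into a single value of the mixed derivative.\<close>

lemma mixed_difference:
  fixes f :: "'a::real_normed_vector \<Rightarrow> real"
  assumes f': "\<And>y. y \<in> S \<Longrightarrow> (f has_derivative f' y) (at y)"
    and f'': "\<And>y. y \<in> S \<Longrightarrow> ((\<lambda>y. f' y u) has_derivative f'' y) (at y)"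
    and h: "h > 0" and S: "\<And>s t. s \<in> {0..h} \<Longrightarrow> t \<in> {0..h} \<Longrightarrow> x + s *\<^sub>R u + t *\<^sub>R v \<in> S"
  shows "\<exists>s\<in>{0..h}. \<exists>t\<in>{0..h}. f (x + h *\<^sub>R u + h *\<^sub>R v) - f (x + h *\<^sub>R u) - f (x + h *\<^sub>R v) + f x =
    h * (h * f'' (x + s *\<^sub>R u + t *\<^sub>R v) v)"
proof -
  have d1: "((\<lambda>s. f (x + s *\<^sub>R u + c *\<^sub>R v)) has_field_derivative f' (x + s *\<^sub>R u + c *\<^sub>R v) u) (at s)"
    if "s \<in> {0..h}" "c \<in> {0..h}" for s c
  proof -
    have "((\<lambda>s. x + s *\<^sub>R u + c *\<^sub>R v) has_derivative (\<lambda>d. d *\<^sub>R u)) (at s)"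
      by (auto intro!: derivative_eq_intros)
    from has_derivative_compose[OF this f'[OF S[OF that]]]
    show ?thesis
      using linear_cmul[OF has_derivative_linear[OF f'[OF S[OF that]]]]
      by (simp add: has_field_derivative_def mult_commute_abs o_def)
  qed
  have d2: "((\<lambda>t. f' (x + s *\<^sub>R u + t *\<^sub>R v) u) has_field_derivative f'' (x + s *\<^sub>R u + t *\<^sub>R v) v) (at t)"
    if "s \<in> {0..h}" "t \<in> {0..h}" for s t
  proof -
    have "((\<lambda>t. x + s *\<^sub>R u + t *\<^sub>R v) has_derivative (\<lambda>d. d *\<^sub>R v)) (at t)"
      by (auto intro!: derivative_eq_intros)
    from has_derivative_compose[OF this f''[OF S[OF that]]]
    show ?thesis
      using linear_cmul[OF has_derivative_linear[OF f''[OF S[OF that]]]]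
      by (simp add: has_field_derivative_def mult_commute_abs o_def)
  qed
  define g where "g = (\<lambda>s. f (x + s *\<^sub>R u + h *\<^sub>R v) - f (x + s *\<^sub>R u + 0 *\<^sub>R v))"
  have "\<exists>z>0. z < h \<and> g h - g 0 =
      (h - 0) * (f' (x + z *\<^sub>R u + h *\<^sub>R v) u - f' (x + z *\<^sub>R u + 0 *\<^sub>R v) u)"
    unfolding g_def by (rule MVT2[OF h], intro DERIV_diff d1) (use h in auto)
  then obtain s where "0 < s" "s < h" and g: "g h - g 0 =
      (h - 0) * (f' (x + s *\<^sub>R u + h *\<^sub>R v) u - f' (x + s *\<^sub>R u + 0 *\<^sub>R v) u)" by blast
  then have s: "s \<in> {0..h}" by simp
  have "\<exists>z>0. z < h \<and> f' (x + s *\<^sub>R u + h *\<^sub>R v) u - f' (x + s *\<^sub>R u + 0 *\<^sub>R v) u =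
      (h - 0) * f'' (x + s *\<^sub>R u + z *\<^sub>R v) v"
    by (rule MVT2[OF h], intro d2) (use s in auto)
  then obtain t where "0 < t" "t < h"
    and t: "f' (x + s *\<^sub>R u + h *\<^sub>R v) u - f' (x + s *\<^sub>R u + 0 *\<^sub>R v) u =
      (h - 0) * f'' (x + s *\<^sub>R u + t *\<^sub>R v) v" by blast
  then have "t \<in> {0..h}" by simp
  show ?thesis
    using g[unfolded t] by (intro bexI[OF _ s] bexI[OF _ \<open>t \<in> {0..h}\<close>]) (simp add: g_def)
qed

text \<open>The second difference is symmetric in \<open>u\<close> and \<open>v\<close>. Evaluating
  it in both orders equates the two mixed derivatives at points of a small parallelogram, and
  continuity compares these values with those at \<open>x\<close>.\<close>

lemma second_derivative_symmetric_real:
  fixes f :: "'a::real_normed_vector \<Rightarrow> real"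
  assumes S: "open S" "x \<in> S" and f': "\<And>y. y \<in> S \<Longrightarrow> (f has_derivative f' y) (at y)"
    and f'': "\<And>y w. y \<in> S \<Longrightarrow> ((\<lambda>y. f' y w) has_derivative f'' w y) (at y)"
    and cont: "\<And>v w. continuous_on S (\<lambda>y. f'' w y v)"
  shows "f'' u x v = f'' v x u"
proof (rule ccontr)
  assume neq: "f'' u x v \<noteq> f'' v x u"
  define \<epsilon> where "\<epsilon> = \<bar>f'' u x v - f'' v x u\<bar> / 2"
  have \<epsilon>: "\<epsilon> > 0" using neq by (simp add: \<epsilon>_def)
  have ev: "\<exists>d>0. \<forall>y. dist y x < d \<longrightarrow> dist (f'' w y z) (f'' w x z) < \<epsilon>" for w z
  proof -
    have "isCont (\<lambda>y. f'' w y z) x"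
      using cont[of w z] S continuous_on_eq_continuous_at by blast
    then show ?thesis using \<epsilon> unfolding continuous_at_eps_delta by blast
  qed
  obtain d1 d2 r where d: "d1 > 0" "\<And>y. dist y x < d1 \<Longrightarrow> dist (f'' u y v) (f'' u x v) < \<epsilon>"
      "d2 > 0" "\<And>y. dist y x < d2 \<Longrightarrow> dist (f'' v y u) (f'' v x u) < \<epsilon>"
      "r > 0" "ball x r \<subseteq> S"
    using ev[of u v] ev[of v u] open_contains_ball S by metis
  \<comment> \<open>The summand 1 keeps the denominator positive when \<open>u = v = 0\<close>; the
    factor 2 keeps the parallelogram strictly inside the ball where both mixed derivatives vary by
    less than \<open>\<epsilon>\<close>.\<close>
  define h where "h = min d1 (min d2 r) / (2 * (norm u + norm v + 1))"
  have pos: "norm u + norm v + 1 > 0" by (simp add: add_nonneg_pos)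
  have h: "h > 0" using d pos by (simp add: h_def)
  have small: "dist (x + s *\<^sub>R u + t *\<^sub>R v) x < min d1 (min d2 r)" if "s \<in> {0..h}" "t \<in> {0..h}" for s t
  proof -
    have "dist (x + s *\<^sub>R u + t *\<^sub>R v) x = norm (s *\<^sub>R u + t *\<^sub>R v)" by (simp add: dist_norm)
    also have "\<dots> \<le> s * norm u + t * norm v" using that by (intro norm_triangle_le) simp
    also have "\<dots> \<le> h * norm u + h * norm v" using that by (intro add_mono mult_right_mono) auto
    also have "\<dots> \<le> h * (norm u + norm v + 1)" using h by (simp add: algebra_simps)
    also have "\<dots> = min d1 (min d2 r) / 2" unfolding h_def using pos by (simp add: less_imp_neq[symmetric] del: distrib_left_numeral)
    also have "\<dots> < min d1 (min d2 r)" using d(1,3,5) by (simp add: min_def)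
    finally show ?thesis .
  qed
  have in_S: "x + s *\<^sub>R u + t *\<^sub>R v \<in> S" if "s \<in> {0..h}" "t \<in> {0..h}" for s t
    using small[OF that] d(6) by (auto simp: dist_commute)
  from mixed_difference[of S f f' u "f'' u" h x v, OF f' f'' h in_S]
  obtain s t where st: "s \<in> {0..h}" "t \<in> {0..h}"
    "f (x + h *\<^sub>R u + h *\<^sub>R v) - f (x + h *\<^sub>R u) - f (x + h *\<^sub>R v) + f x =
      h * (h * f'' u (x + s *\<^sub>R u + t *\<^sub>R v) v)" by blast
  have in_S': "x + s *\<^sub>R v + t *\<^sub>R u \<in> S" if "s \<in> {0..h}" "t \<in> {0..h}" for s t
    using in_S[OF that(2,1)] by (simp add: algebra_simps)
  from mixed_difference[of S f f' v "f'' v" h x u, OF f' f'' h in_S']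
  obtain s' t' where st': "s' \<in> {0..h}" "t' \<in> {0..h}"
    "f (x + h *\<^sub>R v + h *\<^sub>R u) - f (x + h *\<^sub>R v) - f (x + h *\<^sub>R u) + f x =
      h * (h * f'' v (x + s' *\<^sub>R v + t' *\<^sub>R u) u)" by blast
  have "h * (h * f'' u (x + s *\<^sub>R u + t *\<^sub>R v) v) = h * (h * f'' v (x + s' *\<^sub>R v + t' *\<^sub>R u) u)"
    using st(3) st'(3) by (simp add: algebra_simps)
  then have "f'' u (x + s *\<^sub>R u + t *\<^sub>R v) v = f'' v (x + s' *\<^sub>R v + t' *\<^sub>R u) u" using h by simp
  moreover have "dist (f'' u (x + s *\<^sub>R u + t *\<^sub>R v) v) (f'' u x v) < \<epsilon>"
    using small[OF st(1,2)] by (intro d) simp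
  moreover have "dist (f'' v (x + s' *\<^sub>R v + t' *\<^sub>R u) u) (f'' v x u) < \<epsilon>"
    using small[OF st'(2,1)] by (intro d) (simp add: algebra_simps)
  moreover have "2 * \<epsilon> = \<bar>f'' u x v - f'' v x u\<bar>" by (simp add: \<epsilon>_def)
  ultimately show False unfolding dist_real_def by linarith
qed

lemma second_derivative_symmetric:
  fixes f :: "'a::euclidean_space \<Rightarrow> 'b::euclidean_space"
  assumes S: "open S" "x \<in> S" and f: "smooth_on S f"
  shows "frechet_derivative (\<lambda>y. frechet_derivative f (at y) u) (at x) v =
    frechet_derivative (\<lambda>y. frechet_derivative f (at y) v) (at x) u"
proof (rule euclidean_eqI)
  fix i :: 'b
  note sm = smooth_onD(2)[OF f]
  show "frechet_derivative (\<lambda>y. frechet_derivative f (at y) u) (at x) v \<bullet> i =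
    frechet_derivative (\<lambda>y. frechet_derivative f (at y) v) (at x) u \<bullet> i"
    by (rule second_derivative_symmetric_real[OF S, where f = "\<lambda>y. f y \<bullet> i"
          and f' = "\<lambda>y w. frechet_derivative f (at y) w \<bullet> i"
          and f'' = "\<lambda>w y v. frechet_derivative (\<lambda>y. frechet_derivative f (at y) w) (at y) v \<bullet> i"])
      (intro has_derivative_inner_left smooth_on_has_derivative[OF f] smooth_on_has_derivative[OF sm]
        continuous_on_inner continuous_on_const smooth_onD(3)[OF smooth_onD(2)[OF sm]]; assumption)+
qed

text \<open>A product rule from derivatives at fixed arguments \<open>a\<close> alone: expanding the
  argument in the finite \<open>Basis\<close> leaves products of scalar coefficients with the
  families \<open>T y i\<close>.\<close>

lemma has_derivative_linear_family:
  fixes T :: "'a::real_normed_vector \<Rightarrow> 'b::euclidean_space \<Rightarrow> 'c::real_normed_vector"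
  assumes lin: "\<forall>\<^sub>F y in nhds x. linear (T y)"
    and T': "\<And>a. ((\<lambda>y. T y a) has_derivative T' a) (at x)"
    and A: "(A has_derivative A') (at x)"
  shows "((\<lambda>y. T y (A y)) has_derivative (\<lambda>u. T' (A x) u + T x (A' u))) (at x)"
proof -
  have expand: "\<forall>\<^sub>F y in nhds x. (\<Sum>i\<in>Basis. (a y \<bullet> i) *\<^sub>R T y i) = T y (a y)" for a
    using lin
  proof eventually_elim
    case (elim y)
    have "T y (a y) = T y (\<Sum>i\<in>Basis. (a y \<bullet> i) *\<^sub>R i)" by (simp add: euclidean_representation)
    also have "\<dots> = (\<Sum>i\<in>Basis. (a y \<bullet> i) *\<^sub>R T y i)"
      by (simp add: linear_sum[OF elim] linear_cmul[OF elim])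
    finally show ?case ..
  qed
  have der: "((\<lambda>y. T y (a y)) has_derivative
      (\<lambda>u. \<Sum>i\<in>Basis. (a x \<bullet> i) *\<^sub>R T' i u + (a' u \<bullet> i) *\<^sub>R T x i)) (at x)"
    if "(a has_derivative a') (at x)" for a a'
  proof (rule has_derivative_transform_eventually)
    show "((\<lambda>y. \<Sum>i\<in>Basis. (a y \<bullet> i) *\<^sub>R T y i) has_derivative
      (\<lambda>u. \<Sum>i\<in>Basis. (a x \<bullet> i) *\<^sub>R T' i u + (a' u \<bullet> i) *\<^sub>R T x i)) (at x)"
      by (intro has_derivative_sum has_derivative_scaleR has_derivative_inner_left that T')
    show "\<forall>\<^sub>F y in at x. (\<Sum>i\<in>Basis. (a y \<bullet> i) *\<^sub>R T y i) = T y (a y)"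
      by (rule eventually_nhds_conv_at[THEN iffD1, OF expand, THEN conjunct1])
    show "(\<Sum>i\<in>Basis. (a x \<bullet> i) *\<^sub>R T x i) = T x (a x)"
      by (rule eventually_nhds_x_imp_x[OF expand])
  qed simp
  \<comment> \<open>Inserting a constant argument into \<open>der\<close> shows, by uniqueness of
    derivatives, that \<open>T' a u\<close> is linear in \<open>a\<close>; this reassembles the sums
    over \<open>Basis\<close>.\<close>
  have "T' a u = (\<Sum>i\<in>Basis. (a \<bullet> i) *\<^sub>R T' i u)" for a u
    using has_derivative_unique[OF T'[of a] der[OF has_derivative_const[of a]]]
    by (auto dest: fun_cong[of _ _ u])
  moreover have "T x a = (\<Sum>i\<in>Basis. (a \<bullet> i) *\<^sub>R T x i)" for a
    using eventually_nhds_x_imp_x[OF expand[of "\<lambda>_. a"]] by simp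
  ultimately have "(\<Sum>i\<in>Basis. (A x \<bullet> i) *\<^sub>R T' i u + (A' u \<bullet> i) *\<^sub>R T x i) = T' (A x) u + T x (A' u)" for u
    unfolding sum.distrib by (metis (no_types))
  with der[OF A] show ?thesis by simp
qed

lemma has_derivative_bilinear_family:
  fixes \<beta> :: "'a::real_normed_vector \<Rightarrow> 'b::euclidean_space \<Rightarrow> 'c::euclidean_space \<Rightarrow> 'd::real_normed_vector"
  assumes bil: "\<forall>\<^sub>F y in nhds x. bilinear (\<beta> y)"
    and \<beta>': "\<And>a b. ((\<lambda>y. \<beta> y a b) has_derivative \<beta>' a b) (at x)"
    and A: "(A has_derivative A') (at x)" and B: "(B has_derivative B') (at x)"
  shows "((\<lambda>y. \<beta> y (A y) (B y)) has_derivative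
    (\<lambda>u. \<beta>' (A x) (B x) u + \<beta> x (A x) (B' u) + \<beta> x (A' u) (B x))) (at x)"
proof -
  have lin: "\<forall>\<^sub>F y in nhds x. linear (\<beta> y a)" "\<forall>\<^sub>F y in nhds x. linear (\<lambda>a. \<beta> y a (B y))" for a
    using bil by (eventually_elim, simp add: bilinear_def)+
  have "((\<lambda>y. \<beta> y a (B y)) has_derivative (\<lambda>u. \<beta>' a (B x) u + \<beta> x a (B' u))) (at x)" for a
    by (rule has_derivative_linear_family[OF lin(1) \<beta>' B])
  from has_derivative_linear_family[OF lin(2) this A] show ?thesis .
qed

text \<open>\<open>X\<close> is read off from the inverse of \<open>(y, v) \<mapsto> (y, S y v)\<close>, so that the inverse function theorem
  applies without any formula for the inverse matrix.\<close>

lemma differentiable_linear_solve: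
  fixes S :: "'a::euclidean_space \<Rightarrow> 'b::euclidean_space \<Rightarrow> 'b"
  assumes U: "open U" "x \<in> U" and lin: "\<And>y. y \<in> U \<Longrightarrow> linear (S y)" and inj: "\<And>y. y \<in> U \<Longrightarrow> inj (S y)"
    and S: "\<And>y a. y \<in> U \<Longrightarrow> (\<lambda>y. S y a) differentiable (at y)"
    and k: "k differentiable (at x)" and X: "\<And>y. y \<in> U \<Longrightarrow> S y (X y) = k y"
  shows "X differentiable (at x)"
proof -
  define S' where "S' = (\<lambda>y a. frechet_derivative (\<lambda>y. S y a) (at y))"
  have S': "((\<lambda>y. S y a) has_derivative S' y a) (at y)" if "y \<in> U" for y a
    using S[OF that] by (simp add: S'_def flip: frechet_derivative_works)
  define f where "f = (\<lambda>p. (fst p, S (fst p) (snd p)))"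
  define g where "g = (\<lambda>p. (fst p, inv (S (fst p)) (snd p)))"
  have df: "(f has_derivative (\<lambda>q. (fst q, S' y v (fst q) + S y (snd q)))) (at (y, v))" if "y \<in> U" for y v
  proof -
    have "\<forall>\<^sub>F p in nhds (y, v). p \<in> U \<times> UNIV"
      using that U by (intro eventually_nhds_in_open open_Times) auto
    then have lin': "\<forall>\<^sub>F p in nhds (y, v). linear (S (fst p))"
      by eventually_elim (use lin in auto)
    have fst: "(fst has_derivative fst) (at (y, v))" and snd: "(snd has_derivative snd) (at (y, v))"
      by (auto intro!: derivative_eq_intros)
    have "((\<lambda>p. S (fst p) a) has_derivative (\<lambda>q. S' y a (fst q))) (at (y, v))" for a
      using has_derivative_compose[OF fst, of "\<lambda>y. S y a"] S'[OF that] by simp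
    from has_derivative_linear_family[OF lin' this snd]
    show ?thesis unfolding f_def using has_derivative_Pair[OF fst] by simp
  qed
  have surj: "surj (S x)" using lin inj U linear_injective_imp_surjective by blast
  \<comment> \<open>The derivative of \<open>f\<close> is block triangular, and the map given here
    is its inverse.\<close>
  have "(g has_derivative (\<lambda>q. (fst q, inv (S x) (snd q - S' x (X x) (fst q))))) (at (f (x, X x)))"
  proof (rule has_derivative_inverse_strong[where f = f and S = "U \<times> UNIV"])
    show "open (U \<times> (UNIV :: 'b set))" "(x, X x) \<in> U \<times> UNIV" using U by (auto intro: open_Times)
    show "continuous_on (U \<times> UNIV) f"
      by (rule continuous_at_imp_continuous_on) (use df has_derivative_continuous in blast)
    show "g (f p) = p" if "p \<in> U \<times> UNIV" for p
      using that inj by (auto simp: f_def g_def inv_f_f)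
    show "(f has_derivative (\<lambda>q. (fst q, S' x (X x) (fst q) + S x (snd q)))) (at (x, X x))"
      by (rule df[OF U(2)])
    show "(\<lambda>q. (fst q, S' x (X x) (fst q) + S x (snd q))) \<circ>
        (\<lambda>q. (fst q, inv (S x) (snd q - S' x (X x) (fst q)))) = id"
      using surj by (auto simp: surj_f_inv_f)
  qed
  then have "g differentiable (at (x, k x))"
    using X[OF U(2)] by (auto simp: f_def differentiable_def)
  moreover have "(\<lambda>y. (y, k y)) differentiable (at x)"
    using k by (intro differentiable_Pair) auto
  ultimately have "(g \<circ> (\<lambda>y. (y, k y))) differentiable (at x)"
    by (intro differentiable_chain_at) auto
  then have "(snd \<circ> (g \<circ> (\<lambda>y. (y, k y)))) differentiable (at x)"
    by (rule differentiable_chain_at[OF _ bounded_linear_imp_differentiable[OF bounded_linear_snd]])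
  then obtain d where "((snd \<circ> (g \<circ> (\<lambda>y. (y, k y)))) has_derivative d) (at x)"
    unfolding differentiable_def by blast
  then have "(X has_derivative d) (at x)"
    by (rule has_derivative_transform_within_open[OF _ U])
      (use X[symmetric] inj in \<open>simp add: g_def inv_f_f\<close>)
  then show ?thesis unfolding differentiable_def by blast
qed


section \<open>The Levi-Civita connection in a chart\<close>

lemma frechet_derivative_cong_open:
  assumes "open U" "x \<in> U" and eq: "\<And>y. y \<in> U \<Longrightarrow> f y = g y"
  shows "frechet_derivative f (at x) = frechet_derivative g (at x)"
proof -
  have "(f has_derivative f') (at x) \<longleftrightarrow> (g has_derivative f') (at x)" for f'
    using has_derivative_transform_within_open[OF _ assms(1,2), of f f' UNIV g]
      has_derivative_transform_within_open[OF _ assms(1,2), of g f' UNIV f] eq by metis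
  then show ?thesis unfolding frechet_derivative_def by simp
qed

lemma bilinear_frechet_derivative_family:
  fixes \<beta> :: "'a::euclidean_space \<Rightarrow> 'b::euclidean_space \<Rightarrow> 'c::euclidean_space \<Rightarrow> 'd::real_normed_vector"
  assumes U: "open U" "x \<in> U" and bil: "\<And>y. y \<in> U \<Longrightarrow> bilinear (\<beta> y)"
    and diff: "\<And>v w. (\<lambda>y. \<beta> y v w) differentiable (at x)"
  shows "bilinear (\<lambda>v w. frechet_derivative (\<lambda>y. \<beta> y v w) (at x) u)"
proof (rule bilinearI)
  have D: "((\<lambda>y. \<beta> y v w) has_derivative frechet_derivative (\<lambda>y. \<beta> y v w) (at x)) (at x)" for v w
    using diff frechet_derivative_works by blast
  fix v v' w r
  show "frechet_derivative (\<lambda>y. \<beta> y (v + v') w) (at x) u =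
      frechet_derivative (\<lambda>y. \<beta> y v w) (at x) u + frechet_derivative (\<lambda>y. \<beta> y v' w) (at x) u"
    by (subst frechet_derivative_cong_open[OF U, of _ "\<lambda>y. \<beta> y v w + \<beta> y v' w"])
      (simp_all add: bilinear_ladd[OF bil] flip: frechet_derivative_at[OF has_derivative_add[OF D D]])
  show "frechet_derivative (\<lambda>y. \<beta> y (r *\<^sub>R v) w) (at x) u = r *\<^sub>R frechet_derivative (\<lambda>y. \<beta> y v w) (at x) u"
    by (subst frechet_derivative_cong_open[OF U, of _ "\<lambda>y. r *\<^sub>R \<beta> y v w"])
      (simp_all add: bilinear_lmul[OF bil] flip: frechet_derivative_at[OF has_derivative_scaleR_right[OF D]])
next
  have D: "((\<lambda>y. \<beta> y v w) has_derivative frechet_derivative (\<lambda>y. \<beta> y v w) (at x)) (at x)" for v w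
    using diff frechet_derivative_works by blast
  fix v w w' r
  show "frechet_derivative (\<lambda>y. \<beta> y v (w + w')) (at x) u =
      frechet_derivative (\<lambda>y. \<beta> y v w) (at x) u + frechet_derivative (\<lambda>y. \<beta> y v w') (at x) u"
    by (subst frechet_derivative_cong_open[OF U, of _ "\<lambda>y. \<beta> y v w + \<beta> y v w'"])
      (simp_all add: bilinear_radd[OF bil] flip: frechet_derivative_at[OF has_derivative_add[OF D D]])
  show "frechet_derivative (\<lambda>y. \<beta> y v (r *\<^sub>R w)) (at x) u = r *\<^sub>R frechet_derivative (\<lambda>y. \<beta> y v w) (at x) u"
    by (subst frechet_derivative_cong_open[OF U, of _ "\<lambda>y. r *\<^sub>R \<beta> y v w"])
      (simp_all add: bilinear_rmul[OF bil] flip: frechet_derivative_at[OF has_derivative_scaleR_right[OF D]])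
qed

lemma inner_product_represents:
  fixes b :: "'a::euclidean_space \<Rightarrow> 'a \<Rightarrow> real"
  assumes b: "inner_product b" and \<phi>: "linear \<phi>"
  shows "\<exists>z. \<forall>w. b z w = \<phi> w"
proof -
  obtain e where e: "orthonormal_on b {1..DIM('a)} e" "span (e ` {1..DIM('a)}) = UNIV"
    using onb_exists[OF b subspace_UNIV] by (auto simp: onb_iff)
  note bl = inner_product_bilinear[OF b]
  have "b (\<Sum>i=1..DIM('a). \<phi> (e i) *\<^sub>R e i) w = \<phi> w" for w
  proof -
    have "\<phi> w = \<phi> (\<Sum>i=1..DIM('a). b w (e i) *\<^sub>R e i)"
      using orthonormal_expand[OF b _ e(1), of w] e(2) by simp
    also have "\<dots> = b (\<Sum>i=1..DIM('a). \<phi> (e i) *\<^sub>R e i) w"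
      by (simp add: linear_sum[OF \<phi>] linear_cmul[OF \<phi>] bilinear_sum_left[OF bl] bilinear_lmul[OF bl]
          inner_product_commute[OF b, of w] mult.commute)
    finally show ?thesis ..
  qed
  then show ?thesis by blast
qed

text \<open>The usual cyclic permutation of the arguments. Being free of any metric, it applies both
  to the Christoffel symbols and to the tangential part of the ambient derivative, which therefore
  agree.\<close>

lemma koszul:
  fixes L d :: "'a \<Rightarrow> 'a \<Rightarrow> 'a \<Rightarrow> real"
  assumes "\<And>u v w. L u v w = L v u w" and "\<And>u v w. d v w u = L u v w + L u w v"
  shows "L u v w = (d v w u + d u w v - d u v w) / 2"
  using assms(1)[of v u w] assms(1)[of w u v] assms(1)[of w v u] assms(2)[of v w u] assms(2)[of u w v] assms(2)[of u v w]
  by simp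

locale local_metric =
  fixes U :: "'a::euclidean_space set" and G :: "'a \<Rightarrow> 'a \<Rightarrow> 'a \<Rightarrow> real"
  assumes open_U: "open U" and ip: "x \<in> U \<Longrightarrow> inner_product (G x)"
    and smooth_G: "smooth_on U (\<lambda>x. G x v w)"
begin

definition dG :: "'a \<Rightarrow> 'a \<Rightarrow> 'a \<Rightarrow> 'a \<Rightarrow> real" where
  "dG x v w u = frechet_derivative (\<lambda>y. G y v w) (at x) u"

lemma bilinear_G: "x \<in> U \<Longrightarrow> bilinear (G x)"
  using ip inner_product_bilinear by blast

lemma G_commute: "x \<in> U \<Longrightarrow> G x v w = G x w v"
  using ip inner_product_commute by blast

lemma G_has_derivative: "x \<in> U \<Longrightarrow> ((\<lambda>y. G y v w) has_derivative dG x v w) (at x)"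
  using smooth_on_has_derivative[OF smooth_G] unfolding dG_def by blast

lemma dG_linear: "x \<in> U \<Longrightarrow> linear (dG x v w)"
  using G_has_derivative has_derivative_linear by blast

lemma dG_bilinear: "x \<in> U \<Longrightarrow> bilinear (\<lambda>v w. dG x v w u)"
  unfolding dG_def
  by (rule bilinear_frechet_derivative_family[OF open_U _ bilinear_G smooth_onD(1)[OF smooth_G]])

lemma dG_commute: "x \<in> U \<Longrightarrow> dG x v w u = dG x w v u"
  unfolding dG_def using frechet_derivative_cong_open[OF open_U, of x "\<lambda>y. G y v w" "\<lambda>y. G y w v"] G_commute
  by simp

definition koszul_form :: "'a \<Rightarrow> 'a \<Rightarrow> 'a \<Rightarrow> 'a \<Rightarrow> real" where
  "koszul_form x u v w = (dG x v w u + dG x u w v - dG x u v w) / 2"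

text \<open>The predicate under the \<open>THE\<close> of \<open>christoffel\<close>, named so that
  existence and uniqueness can be stated.\<close>

definition levi_civita :: "'a \<Rightarrow> ('a \<Rightarrow> 'a \<Rightarrow> 'a) \<Rightarrow> bool" where
  "levi_civita x \<Gamma> \<longleftrightarrow> bilinear \<Gamma> \<and> (\<forall>u v. \<Gamma> u v = \<Gamma> v u) \<and>
     (\<forall>u v w. frechet_derivative (\<lambda>y. G y v w) (at x) u = G x (\<Gamma> u v) w + G x v (\<Gamma> u w))"

lemma levi_civita_koszul:
  assumes "x \<in> U" "levi_civita x \<Gamma>" shows "G x (\<Gamma> u v) w = koszul_form x u v w"
  unfolding koszul_form_def
  by (rule koszul) (use assms G_commute[OF assms(1)] in \<open>auto simp: levi_civita_def dG_def\<close>)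

text \<open>Koszul's formula prescribes the inner product of \<open>\<Gamma> u v\<close> with every
  \<open>w\<close>, and nondegeneracy turns this functional into a vector.\<close>

lemma levi_civita_exists:
  assumes x: "x \<in> U" shows "\<exists>\<Gamma>. levi_civita x \<Gamma>"
proof -
  note lin = bilinear_simps[OF dG_bilinear[OF x]] linear_add[OF dG_linear[OF x]]
    linear_cmul[OF dG_linear[OF x]] bilinear_simps[OF bilinear_G[OF x]]
  have "linear (koszul_form x u v)" for u v
    by (rule linearI) (simp_all add: koszul_form_def lin field_simps)
  then have "\<forall>u v. \<exists>z. \<forall>w. G x z w = koszul_form x u v w"
    using inner_product_represents[OF ip[OF x]] by blast
  then obtain \<Gamma> where \<Gamma>: "\<And>u v w. G x (\<Gamma> u v) w = koszul_form x u v w" by metis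
  have "levi_civita x \<Gamma>"
    unfolding levi_civita_def
  proof (intro conjI allI)
    show "bilinear \<Gamma>"
      by (rule bilinearI; rule inner_product_eqI[OF ip[OF x]])
        (simp_all add: \<Gamma> lin koszul_form_def field_simps)
    show "\<Gamma> u v = \<Gamma> v u" for u v
      by (rule inner_product_eqI[OF ip[OF x]]) (simp add: \<Gamma> koszul_form_def dG_commute[OF x, of u v])
    show "frechet_derivative (\<lambda>y. G y v w) (at x) u = G x (\<Gamma> u v) w + G x v (\<Gamma> u w)" for u v w
      by (simp add: \<Gamma> G_commute[OF x, of v] koszul_form_def dG_commute[OF x, of w v] field_simps flip: dG_def)
  qed
  then show ?thesis by blast
qed

lemma levi_civita_christoffel:
  assumes x: "x \<in> U" shows "levi_civita x (christoffel G x)"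
proof -
  obtain \<Gamma> where \<Gamma>: "levi_civita x \<Gamma>" using levi_civita_exists[OF x] ..
  have "\<Gamma>' = \<Gamma>" if "levi_civita x \<Gamma>'" for \<Gamma>'
  proof (intro ext)
    show "\<Gamma>' u v = \<Gamma> u v" for u v
      by (rule inner_product_eqI[OF ip[OF x]])
        (simp only: levi_civita_koszul[OF x that] levi_civita_koszul[OF x \<Gamma>])
  qed
  from theI[of "levi_civita x", OF \<Gamma> this] show ?thesis
    unfolding christoffel_def levi_civita_def .
qed

lemma christoffel_bilinear: "x \<in> U \<Longrightarrow> bilinear (christoffel G x)"
  and christoffel_commute: "x \<in> U \<Longrightarrow> christoffel G x u v = christoffel G x v u"
  and christoffel_metric: "x \<in> U \<Longrightarrow> dG x v w u = G x (christoffel G x u v) w + G x v (christoffel G x u w)"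
  using levi_civita_christoffel[of x] unfolding levi_civita_def dG_def by blast+

lemma christoffel_koszul: "x \<in> U \<Longrightarrow> G x (christoffel G x u v) w = koszul_form x u v w"
  using levi_civita_koszul levi_civita_christoffel by blast

text \<open>A description gives no formula to differentiate. The symbols are instead seen as the
  solution of a linear system: their products with the basis vectors are the differentiable values
  of \<open>koszul_form\<close>, and positivity of the metric makes the system injective.\<close>

lemma christoffel_differentiable:
  assumes x: "x \<in> U" shows "(\<lambda>y. christoffel G y u v) differentiable (at x)"
proof (rule differentiable_linear_solve[OF open_U x])
  fix y assume y: "y \<in> U"
  note bl = bilinear_G[OF y]
  show lin: "linear (\<lambda>a. \<Sum>i\<in>Basis. G y a i *\<^sub>R i)"
    by (rule linearI) (simp_all add: bilinear_simps[OF bl] scaleR_left_distrib sum.distrib scaleR_sum_right)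
  show "inj (\<lambda>a. \<Sum>i\<in>Basis. G y a i *\<^sub>R i)"
    unfolding linear_injective_0[OF lin]
  proof (intro allI impI)
    fix a assume "(\<Sum>i\<in>Basis. G y a i *\<^sub>R i) = 0"
    then have *: "G y a i = 0" if "i \<in> Basis" for i
      using that by (metis inner_sum_left_Basis inner_zero_left)
    have "G y a a = G y a (\<Sum>i\<in>Basis. (a \<bullet> i) *\<^sub>R i)" by (simp add: euclidean_representation)
    also have "\<dots> = 0" by (simp add: bilinear_sum_right[OF bl] bilinear_rmul[OF bl] *)
    finally show "a = 0" using inner_product_pos[OF ip[OF y], of a] by force
  qed
  show "(\<lambda>y. \<Sum>i\<in>Basis. G y a i *\<^sub>R i) differentiable (at y)" for a
    using smooth_onD(1)[OF smooth_G y] by (intro differentiable_sum differentiable_scaleR) auto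
  show "(\<Sum>i\<in>Basis. G y (christoffel G y u v) i *\<^sub>R i) = (\<Sum>i\<in>Basis. koszul_form y u v i *\<^sub>R i)"
    by (simp add: christoffel_koszul[OF y])
next
  have "(\<lambda>y. koszul_form y u v i) differentiable (at x)" for i
    unfolding koszul_form_def dG_def
    using smooth_onD(1)[OF smooth_onD(2)[OF smooth_G] x] by (intro derivative_intros) auto
  then show "(\<lambda>y. \<Sum>i\<in>Basis. koszul_form y u v i *\<^sub>R i) differentiable (at x)"
    by (intro differentiable_sum differentiable_scaleR) auto
qed

definition d\<Gamma> :: "'a \<Rightarrow> 'a \<Rightarrow> 'a \<Rightarrow> 'a \<Rightarrow> 'a" where
  "d\<Gamma> x v w u = frechet_derivative (\<lambda>y. christoffel G y v w) (at x) u"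

lemma christoffel_has_derivative:
  "x \<in> U \<Longrightarrow> ((\<lambda>y. christoffel G y v w) has_derivative d\<Gamma> x v w) (at x)"
  unfolding d\<Gamma>_def by (rule frechet_derivative_works[THEN iffD1, OF christoffel_differentiable])

lemma d\<Gamma>_bilinear: "x \<in> U \<Longrightarrow> bilinear (\<lambda>v w. d\<Gamma> x v w u)"
  unfolding d\<Gamma>_def
  by (rule bilinear_frechet_derivative_family[OF open_U _ christoffel_bilinear christoffel_differentiable])

lemma d\<Gamma>_linear: "x \<in> U \<Longrightarrow> linear (d\<Gamma> x v w)"
  using christoffel_has_derivative has_derivative_linear by blast

lemma d\<Gamma>_commute: "x \<in> U \<Longrightarrow> d\<Gamma> x v w u = d\<Gamma> x w v u"
  unfolding d\<Gamma>_def
  using frechet_derivative_cong_open[OF open_U, of x "\<lambda>y. christoffel G y v w" "\<lambda>y. christoffel G y w v"]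
    christoffel_commute by simp

section \<open>Algebraic symmetries of the curvature tensor\<close>

lemma curvature_eq:
  "curvature G x u v w = d\<Gamma> x v w u - d\<Gamma> x u w v
     + christoffel G x u (christoffel G x v w) - christoffel G x v (christoffel G x u w)"
  by (simp add: curvature_def cov_deriv_def d\<Gamma>_def)

lemma curvature_bilinear12: "x \<in> U \<Longrightarrow> bilinear (\<lambda>u v. curvature G x u v w)"
  by (rule bilinearI)
    (simp_all add: curvature_eq bilinear_simps[OF christoffel_bilinear] bilinear_simps[OF d\<Gamma>_bilinear]
      linear_add[OF d\<Gamma>_linear] linear_cmul[OF d\<Gamma>_linear] algebra_simps)

lemma curvature_linear3: "x \<in> U \<Longrightarrow> linear (curvature G x u v)"
  by (rule linearI)
    (simp_all add: curvature_eq bilinear_simps[OF christoffel_bilinear] bilinear_simps[OF d\<Gamma>_bilinear]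
      algebra_simps)

lemma curvature_skew: "curvature G x v u w = - curvature G x u v w"
  by (simp add: curvature_eq)

lemma curvature_bianchi:
  "x \<in> U \<Longrightarrow> curvature G x u v w + curvature G x v w u + curvature G x w u v = 0"
  by (simp add: curvature_eq d\<Gamma>_commute[of x w] d\<Gamma>_commute[of x v u] christoffel_commute[of x w]
      christoffel_commute[of x v u])

end


section \<open>Covariant derivatives along a map\<close>

lemma cov_along_cong:
  assumes "open U" "x \<in> U" "\<And>y. y \<in> U \<Longrightarrow> Y y = Z y"
  shows "cov_along G F Y x u = cov_along G F Z x u"
  using frechet_derivative_cong_open[OF assms] assms(2,3) by (simp add: cov_along_def)

text \<open>The image fields \<open>dF y v\<close> live only along the immersion, so covariant
  differentiation is developed for fields along a map; the identity map recovers ordinary vector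
  fields.\<close>

locale metric_along_map = local_metric V G
  for V :: "'b::euclidean_space set" and G :: "'b \<Rightarrow> 'b \<Rightarrow> 'b \<Rightarrow> real" +
  fixes W :: "'a::euclidean_space set" and F :: "'a \<Rightarrow> 'b"
  assumes open_W: "open W" and smooth_F: "smooth_on W F" and F_in: "x \<in> W \<Longrightarrow> F x \<in> V"
begin

abbreviation dF :: "'a \<Rightarrow> 'a \<Rightarrow> 'b" where
  "dF x \<equiv> frechet_derivative F (at x)"

lemma F_has_derivative: "x \<in> W \<Longrightarrow> (F has_derivative dF x) (at x)"
  by (rule smooth_on_has_derivative[OF smooth_F])

lemma dF_linear: "x \<in> W \<Longrightarrow> linear (dF x)"
  using F_has_derivative has_derivative_linear by blast

lemma dF_smooth: "smooth_on W (\<lambda>x. dF x v)"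
  by (rule smooth_onD(2)[OF smooth_F])

lemma eventually_W: "x \<in> W \<Longrightarrow> \<forall>\<^sub>F y in nhds x. y \<in> W"
  using open_W by (rule eventually_nhds_in_open)

lemma G_along_has_derivative:
  assumes x: "x \<in> W" and Y: "Y differentiable (at x)" and Z: "Z differentiable (at x)"
  shows "((\<lambda>y. G (F y) (Y y) (Z y)) has_derivative
    (\<lambda>u. G (F x) (cov_along G F Y x u) (Z x) + G (F x) (Y x) (cov_along G F Z x u))) (at x)"
proof -
  note Fx = F_in[OF x]
  have "\<forall>\<^sub>F y in nhds x. bilinear (G (F y))"
    using eventually_W[OF x] by eventually_elim (simp add: bilinear_G F_in)
  moreover have "((\<lambda>y. G (F y) a b) has_derivative (\<lambda>u. dG (F x) a b (dF x u))) (at x)" for a b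
    by (rule has_derivative_compose[OF F_has_derivative[OF x] G_has_derivative[OF Fx]])
  ultimately have "((\<lambda>y. G (F y) (Y y) (Z y)) has_derivative (\<lambda>u. dG (F x) (Y x) (Z x) (dF x u)
      + G (F x) (Y x) (frechet_derivative Z (at x) u) + G (F x) (frechet_derivative Y (at x) u) (Z x))) (at x)"
    by (rule has_derivative_bilinear_family) (use Y Z frechet_derivative_works in blast)+
  then show ?thesis
    by (rule has_derivative_eq_rhs)
      (auto simp: cov_along_def christoffel_metric[OF Fx] bilinear_simps[OF bilinear_G[OF Fx]])
qed

lemma frechet_derivative_G_along:
  assumes "x \<in> W" "Y differentiable (at x)" "Z differentiable (at x)"
  shows "frechet_derivative (\<lambda>y. G (F y) (Y y) (Z y)) (at x) u =
    G (F x) (cov_along G F Y x u) (Z x) + G (F x) (Y x) (cov_along G F Z x u)"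
  using frechet_derivative_at[OF G_along_has_derivative[OF assms]] by metis

lemma cov_along_has_derivative:
  assumes x: "x \<in> W" and Y: "smooth_on W Y"
  shows "((\<lambda>y. cov_along G F Y y v) has_derivative
    (\<lambda>u. frechet_derivative (\<lambda>y. frechet_derivative Y (at y) v) (at x) u
      + (d\<Gamma> (F x) (dF x v) (Y x) (dF x u)
        + christoffel G (F x) (dF x v) (frechet_derivative Y (at x) u)
        + christoffel G (F x) (frechet_derivative (\<lambda>y. dF y v) (at x) u) (Y x)))) (at x)"
proof -
  note Fx = F_in[OF x]
  have "\<forall>\<^sub>F y in nhds x. bilinear (christoffel G (F y))"
    using eventually_W[OF x] by eventually_elim (simp add: christoffel_bilinear F_in)
  moreover have "((\<lambda>y. christoffel G (F y) a b) has_derivative (\<lambda>u. d\<Gamma> (F x) a b (dF x u))) (at x)" for a b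
    by (rule has_derivative_compose[OF F_has_derivative[OF x] christoffel_has_derivative[OF Fx]])
  ultimately show ?thesis
    unfolding cov_along_def
    by (intro has_derivative_add has_derivative_bilinear_family smooth_on_has_derivative[OF _ x]
        smooth_onD(2) smooth_F Y)
qed

lemma cov_along_differentiable:
  "x \<in> W \<Longrightarrow> smooth_on W Y \<Longrightarrow> (\<lambda>y. cov_along G F Y y v) differentiable (at x)"
  using cov_along_has_derivative unfolding differentiable_def by blast

lemma cov_along_linear:
  assumes x: "x \<in> W" and Y: "Y differentiable (at x)"
  shows "linear (cov_along G F Y x)"
proof -
  note lin = linear_frechet_derivative[OF Y] dF_linear[OF x]
  show ?thesis
    by (rule linearI) (simp_all add: cov_along_def linear_add[OF lin(1)] linear_cmul[OF lin(1)]
        linear_add[OF lin(2)] linear_cmul[OF lin(2)] algebra_simps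
        bilinear_simps[OF christoffel_bilinear[OF F_in[OF x]]])
qed

lemma cov_along_torsion_free:
  "x \<in> W \<Longrightarrow> cov_along G F (\<lambda>y. dF y v) x u = cov_along G F (\<lambda>y. dF y u) x v"
  using second_derivative_symmetric[OF open_W _ smooth_F, of x u v] christoffel_commute[OF F_in, of x]
  by (simp add: cov_along_def)

text \<open>The second derivatives of \<open>Y\<close> and of \<open>F\<close> are symmetric and
  cancel in the commutator; what remains is \<open>curvature_eq\<close> with \<open>dF x u\<close>
  and \<open>dF x v\<close> inserted.\<close>

lemma curvature_along:
  assumes x: "x \<in> W" and Y: "smooth_on W Y"
  shows "cov_along G F (\<lambda>y. cov_along G F Y y v) x u - cov_along G F (\<lambda>y. cov_along G F Y y u) x v =
    curvature G (F x) (dF x u) (dF x v) (Y x)"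
proof -
  have *: "cov_along G F (\<lambda>y. cov_along G F Y y v) x u =
      frechet_derivative (\<lambda>y. frechet_derivative Y (at y) v) (at x) u
      + d\<Gamma> (F x) (dF x v) (Y x) (dF x u)
      + (christoffel G (F x) (dF x v) (frechet_derivative Y (at x) u)
        + christoffel G (F x) (dF x u) (frechet_derivative Y (at x) v))
      + christoffel G (F x) (frechet_derivative (\<lambda>y. dF y v) (at x) u) (Y x)
      + christoffel G (F x) (dF x u) (christoffel G (F x) (dF x v) (Y x))" for u v
    unfolding cov_along_def[of _ _ "\<lambda>y. cov_along G F Y y v"]
    by (simp add: frechet_derivative_at[OF cov_along_has_derivative[OF x Y], symmetric])
      (simp add: cov_along_def bilinear_simps[OF christoffel_bilinear[OF F_in[OF x]]])
  show ?thesis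
    unfolding * curvature_eq
    using second_derivative_symmetric[OF open_W x smooth_F, of u v] second_derivative_symmetric[OF open_W x Y, of u v]
    by (simp add: algebra_simps)
qed

end

context local_metric
begin

sublocale id: metric_along_map U G U "\<lambda>y. y"
proof
  have const: "Ck_on k U (\<lambda>y. v)" for k and v :: 'a
    by (induction k arbitrary: v) auto
  show "smooth_on U (\<lambda>y. y)"
    unfolding smooth_on_def
  proof
    fix k show "Ck_on k U (\<lambda>y. y)"
      by (cases k) (simp_all add: const)
  qed
qed (use open_U in auto)

lemma const_smooth: "smooth_on U (\<lambda>y. v)"
proof -
  have "Ck_on k U (\<lambda>y. v)" for k
    by (induction k arbitrary: v) auto
  then show ?thesis by (simp add: smooth_on_def)
qed

lemma cov_along_const [simp]: "cov_along G (\<lambda>y. y) (\<lambda>y. w) x v = christoffel G x v w"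
  by (simp add: cov_along_def)

lemma frechet_derivative_G_christoffel:
  assumes x: "x \<in> U"
  shows "frechet_derivative (\<lambda>y. G y (christoffel G y v w) z) (at x) u =
    G x (cov_along G (\<lambda>y. y) (\<lambda>y. christoffel G y v w) x u) z
    + G x (christoffel G x v w) (christoffel G x u z)"
  using id.frechet_derivative_G_along[OF x christoffel_differentiable[OF x], of "\<lambda>_. z" v w u] by simp

lemma curvature_cov_along:
  "x \<in> U \<Longrightarrow> curvature G x u v w = cov_along G (\<lambda>y. y) (\<lambda>y. christoffel G y v w) x u
    - cov_along G (\<lambda>y. y) (\<lambda>y. christoffel G y u w) x v"
  using id.curvature_along[OF _ const_smooth, of x w v u] by simp

text \<open>The second derivative of \<open>G y w z\<close> in the directions \<open>u\<close>,
  \<open>v\<close> is symmetric. After expansion by metric compatibility the products of first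
  covariant derivatives are symmetric as well, so the terms with second covariant derivatives are,
  which is the claim.\<close>

lemma curvature_metric_skew:
  assumes x: "x \<in> U"
  shows "G x (curvature G x u v w) z = - G x (curvature G x u v z) w"
proof -
  define N where "N = (\<lambda>u v w. cov_along G (\<lambda>y. y) (\<lambda>y. christoffel G y v w) x u)"
  have D: "frechet_derivative (\<lambda>y. dG y w z v) (at x) u = G x (N u v w) z + G x (christoffel G x v w) (christoffel G x u z)
      + (G x (N u v z) w + G x (christoffel G x v z) (christoffel G x u w))" for u v
  proof -
    have "frechet_derivative (\<lambda>y. dG y w z v) (at x) u =
        frechet_derivative (\<lambda>y. G y (christoffel G y v w) z + G y (christoffel G y v z) w) (at x) u"
      by (rule fun_cong[OF frechet_derivative_cong_open[OF open_U x]])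
        (simp add: christoffel_metric G_commute)
    also have "\<dots> = frechet_derivative (\<lambda>y. G y (christoffel G y v w) z) (at x) u
        + frechet_derivative (\<lambda>y. G y (christoffel G y v z) w) (at x) u"
      using frechet_derivative_at[OF has_derivative_add[OF
            id.G_along_has_derivative[OF x christoffel_differentiable[OF x] differentiable_const]
            id.G_along_has_derivative[OF x christoffel_differentiable[OF x] differentiable_const]], of v w z v z w]
      by (metis (no_types, lifting) id.frechet_derivative_G_along[OF x christoffel_differentiable[OF x] differentiable_const])
    finally show ?thesis by (simp add: frechet_derivative_G_christoffel[OF x] N_def)
  qed
  have "frechet_derivative (\<lambda>y. dG y w z v) (at x) u = frechet_derivative (\<lambda>y. dG y w z u) (at x) v"
    unfolding dG_def by (rule second_derivative_symmetric[OF open_U x smooth_G])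
  then have "G x (N u v w) z + G x (N u v z) w = G x (N v u w) z + G x (N v u z) w"
    using D[of v u] D[of u v] G_commute[OF x, of "christoffel G x v w" "christoffel G x u z"]
      G_commute[OF x, of "christoffel G x v z" "christoffel G x u w"] by linarith
  then show ?thesis
    by (simp add: curvature_cov_along[OF x] N_def bilinear_lsub[OF bilinear_G[OF x]])
qed

end


section \<open>Lagrangian immersions in a chart\<close>

locale local_kaehler = local_metric V G
  for V :: "'b::euclidean_space set" and G +
  fixes J :: "'b \<Rightarrow> 'b \<Rightarrow> 'b"
  assumes J_linear: "y \<in> V \<Longrightarrow> linear (J y)" and J_J: "y \<in> V \<Longrightarrow> J y (J y v) = - v"
    and J_smooth: "smooth_on V (\<lambda>y. J y v)" and J_isometry: "y \<in> V \<Longrightarrow> G y (J y u) (J y v) = G y u v"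
    and J_parallel: "y \<in> V \<Longrightarrow> cov_deriv G (\<lambda>y. J y v) y u = J y (cov_deriv G (\<lambda>_. v) y u)"
begin

lemma J_skew: "y \<in> V \<Longrightarrow> G y u (J y v) = - G y (J y u) v"
  using J_isometry[of y u "J y v"] by (simp add: J_J bilinear_simps[OF bilinear_G])

lemma J_has_derivative:
  "y \<in> V \<Longrightarrow> ((\<lambda>y. J y v) has_derivative
    (\<lambda>u. J y (christoffel G y u v) - christoffel G y u (J y v))) (at y)"
  using smooth_on_has_derivative[OF J_smooth, of y v] J_parallel[of y v]
  by (simp add: cov_deriv_def algebra_simps has_derivative_eq_rhs fun_eq_iff)

end

locale kaehler_along_map = local_kaehler V G J + metric_along_map V G W F
  for V :: "'b::euclidean_space set" and G J and W :: "'a::euclidean_space set" and F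
begin

lemma J_along_has_derivative:
  assumes x: "x \<in> W" and Y: "Y differentiable (at x)"
  shows "((\<lambda>y. J (F y) (Y y)) has_derivative
    (\<lambda>u. J (F x) (cov_along G F Y x u) - christoffel G (F x) (dF x u) (J (F x) (Y x)))) (at x)"
proof -
  note Fx = F_in[OF x]
  have "\<forall>\<^sub>F y in nhds x. linear (J (F y))"
    using eventually_W[OF x] by eventually_elim (simp add: J_linear F_in)
  moreover have "((\<lambda>y. J (F y) v) has_derivative (\<lambda>u. J (F x) (christoffel G (F x) (dF x u) v)
      - christoffel G (F x) (dF x u) (J (F x) v))) (at x)" for v
    by (rule has_derivative_compose[OF F_has_derivative[OF x] J_has_derivative[OF Fx]])
  ultimately have "((\<lambda>y. J (F y) (Y y)) has_derivative
      (\<lambda>u. (J (F x) (christoffel G (F x) (dF x u) (Y x)) - christoffel G (F x) (dF x u) (J (F x) (Y x)))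
        + J (F x) (frechet_derivative Y (at x) u))) (at x)"
    by (rule has_derivative_linear_family) (use Y frechet_derivative_works in blast)
  then show ?thesis
    by (rule has_derivative_eq_rhs) (simp add: cov_along_def linear_add[OF J_linear[OF Fx]] fun_eq_iff)
qed

lemma J_along_differentiable:
  "x \<in> W \<Longrightarrow> Y differentiable (at x) \<Longrightarrow> (\<lambda>y. J (F y) (Y y)) differentiable (at x)"
  using J_along_has_derivative unfolding differentiable_def by blast

lemma J_cov_along:
  assumes "x \<in> W" "Y differentiable (at x)"
  shows "cov_along G F (\<lambda>y. J (F y) (Y y)) x u = J (F x) (cov_along G F Y x u)"
  unfolding cov_along_def[of _ _ "\<lambda>y. J (F y) (Y y)"]
  by (simp add: frechet_derivative_at[OF J_along_has_derivative[OF assms], symmetric])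

end

context local_kaehler
begin

sublocale id: kaehler_along_map V G J V "\<lambda>y. y" ..

text \<open>\<open>J\<close> is parallel, so it passes through both covariant derivatives whose
  commutator is the curvature.\<close>

lemma curvature_J:
  assumes x: "x \<in> V"
  shows "curvature G x u v (J x w) = J x (curvature G x u v w)"
proof -
  have nabla_J: "cov_along G (\<lambda>y. y) (\<lambda>y. J y w) y v = J y (christoffel G y v w)" if "y \<in> V" for y v
    using id.J_cov_along[OF that, of "\<lambda>_. w"] by simp
  have "cov_along G (\<lambda>y. y) (\<lambda>y. cov_along G (\<lambda>y. y) (\<lambda>y. J y w) y v) x u =
      J x (cov_along G (\<lambda>y. y) (\<lambda>y. christoffel G y v w) x u)" for u v
    by (rule trans[OF cov_along_cong[OF open_U x nabla_J] id.J_cov_along[OF x christoffel_differentiable[OF x]]])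
  then show ?thesis
    using id.curvature_along[OF x J_smooth, of w v u]
    by (simp add: curvature_cov_along[OF x] linear_diff[OF J_linear[OF x]])
qed

lemma constant_holomorphic_curvature:
  assumes x: "x \<in> V" and hol: "\<And>u. u \<noteq> 0 \<Longrightarrow> sectional_curvature G x u (J x u) = 4 * c"
    and uv: "G x u (J x v) = 0"
  shows "G x (curvature G x u v v) u = c * (G x u u * G x v v - (G x u v)\<^sup>2)"
proof (rule holomorphic_curvature_totally_real[where R = "\<lambda>u v w z. G x (curvature G x u v w) z" and J = "J x"])
  note bl = bilinear_simps[OF bilinear_G[OF x]]
  show "bilinear (\<lambda>u v. G x (curvature G x u v w) z)" for w z
    by (rule bilinearI) (simp_all add: bilinear_simps[OF curvature_bilinear12[OF x]] bl)
  show "bilinear (\<lambda>w z. G x (curvature G x u v w) z)" for u v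
    by (rule bilinearI)
      (simp_all add: linear_add[OF curvature_linear3[OF x]] linear_cmul[OF curvature_linear3[OF x]] bl)
  show "G x (curvature G x v u w) z = - G x (curvature G x u v w) z" for u v w z
    by (subst curvature_skew) (simp add: bl)
  show "G x (curvature G x u v z) w = - G x (curvature G x u v w) z" for u v w z
    by (rule curvature_metric_skew[OF x])
  show "G x (curvature G x u v w) z + G x (curvature G x v w u) z + G x (curvature G x w u v) z = 0" for u v w z
    using arg_cong[OF curvature_bianchi[OF x, of u v w], of "\<lambda>a. G x a z"] by (simp add: bl)
  show "G x (curvature G x u v (J x w)) (J x z) = G x (curvature G x u v w) z" for u v w z
    by (simp add: curvature_J[OF x] J_isometry[OF x])
  show "G x (curvature G x u (J x u) (J x u)) u = 4 * c * (G x u u)\<^sup>2" for u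
  proof (cases "u = 0")
    case True
    then show ?thesis by (simp add: bl)
  next
    case False
    have "G x u (J x u) = 0" using J_skew[OF x, of u u] G_commute[OF x, of u "J x u"] by simp
    moreover have "G x u u > 0" using False inner_product_pos[OF ip[OF x]] by simp
    \<comment> \<open>\<open>u\<close> and \<open>J x u\<close> are orthogonal and of equal length,
      so the denominator of the sectional curvature is \<open>(G x u u)\<^sup>2\<close>.\<close>
    moreover have "G x (curvature G x u (J x u) (J x u)) u / (G x u u)\<^sup>2 = 4 * c"
      using hol[OF False] \<open>G x u (J x u) = 0\<close>
      by (simp add: sectional_curvature_def J_isometry[OF x] power2_eq_square)
    ultimately show ?thesis by (simp add: divide_eq_eq)
  qed
qed (rule J_linear[OF x] J_J[OF x] ip[OF x] J_isometry[OF x] uv)+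

end

section \<open>The second fundamental form and the Gauss equation\<close>

lemma normal_part_eqI:
  assumes b: "inner_product b" and T: "subspace T" and \<nu>: "\<And>t. t \<in> T \<Longrightarrow> b \<nu> t = 0" "w - \<nu> \<in> T"
  shows "normal_part b T w = \<nu>"
  unfolding normal_part_def
proof (rule the_equality)
  show "(\<forall>t\<in>T. b \<nu> t = 0) \<and> w - \<nu> \<in> T" using \<nu> by blast
next
  fix \<nu>' assume \<nu>': "(\<forall>t\<in>T. b \<nu>' t = 0) \<and> w - \<nu>' \<in> T"
  then have T': "\<nu>' - \<nu> \<in> T" using subspace_diff[OF T \<nu>(2), of "w - \<nu>'"] by simp
  then have "b (\<nu>' - \<nu>) (\<nu>' - \<nu>) = 0"
    using \<nu>(1) \<nu>' by (subst bilinear_lsub[OF inner_product_bilinear[OF b]]) simp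
  then show "\<nu>' = \<nu>" using inner_product_pos[OF b, of "\<nu>' - \<nu>"] by force
qed

locale lagrangian_chart = kaehler_along_map V G J W F + sub: local_metric W g
  for V :: "'b::euclidean_space set" and G J and W :: "'a::euclidean_space set" and F and g +
  assumes isometric: "x \<in> W \<Longrightarrow> g x u v = G (F x) (dF x u) (dF x v)"
    and totally_real: "x \<in> W \<Longrightarrow> G (F x) (J (F x) (dF x u)) (dF x v) = 0"
    and J_normal: "x \<in> W \<Longrightarrow> (\<And>u. G (F x) w (dF x u) = 0) \<Longrightarrow> J (F x) w \<in> range (dF x)"
begin

abbreviation h :: "'a \<Rightarrow> 'a \<Rightarrow> 'a \<Rightarrow> 'b" where
  "h \<equiv> second_fundamental_form G F"

text \<open>The tangential part of the ambient derivative of \<open>dF y v\<close> is symmetric and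
  compatible with \<open>g\<close>, so \<open>koszul\<close> gives for it the same formula as for
  the Levi-Civita connection of \<open>g\<close>.\<close>

lemma tangential_part:
  assumes x: "x \<in> W"
  shows "G (F x) (cov_along G F (\<lambda>y. dF y v) x u) (dF x w) = g x (christoffel g x u v) w"
proof -
  have "frechet_derivative (\<lambda>y. g y v w) (at x) u =
      frechet_derivative (\<lambda>y. G (F y) (dF y v) (dF y w)) (at x) u" for u v w
    by (rule fun_cong[OF frechet_derivative_cong_open[OF open_W x]]) (rule isometric)
  then have "sub.dG x v w u = G (F x) (cov_along G F (\<lambda>y. dF y v) x u) (dF x w)
      + G (F x) (cov_along G F (\<lambda>y. dF y w) x u) (dF x v)" for u v w
    using frechet_derivative_G_along[OF x smooth_onD(1)[OF dF_smooth x] smooth_onD(1)[OF dF_smooth x]]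
      G_commute[OF F_in[OF x]] by (simp add: sub.dG_def)
  then show ?thesis
    unfolding sub.christoffel_koszul[OF x] sub.koszul_form_def
    by (intro koszul) (simp_all add: cov_along_torsion_free[OF x])
qed

lemma second_fundamental_form_eq:
  assumes x: "x \<in> W"
  shows "h x u v = cov_along G F (\<lambda>y. dF y v) x u - dF x (christoffel g x u v)"
  unfolding second_fundamental_form_def
  by (rule normal_part_eqI[OF ip[OF F_in[OF x]] linear_subspace_image[OF dF_linear[OF x] subspace_UNIV]])
    (use isometric[OF x] in \<open>auto simp: bilinear_simps[OF bilinear_G[OF F_in[OF x]]] tangential_part[OF x]\<close>)

lemma h_normal: "x \<in> W \<Longrightarrow> G (F x) (h x u v) (dF x w) = 0"
  by (simp add: second_fundamental_form_eq bilinear_simps[OF bilinear_G[OF F_in]] tangential_part isometric)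

lemma h_commute: "x \<in> W \<Longrightarrow> h x u v = h x v u"
  by (simp add: second_fundamental_form_eq cov_along_torsion_free[of x u v] sub.christoffel_commute[of x u v])

lemma h_bilinear:
  assumes x: "x \<in> W" shows "bilinear (h x)"
proof -
  note lin = cov_along_linear[OF x smooth_onD(1)[OF dF_smooth x]]
  have left: "h x (u + u') v = h x u v + h x u' v" "h x (r *\<^sub>R u) v = r *\<^sub>R h x u v" for u u' v r
    by (simp_all add: second_fundamental_form_eq[OF x] linear_add[OF lin] linear_cmul[OF lin]
        bilinear_simps[OF sub.christoffel_bilinear[OF x]] linear_add[OF dF_linear[OF x]]
        linear_cmul[OF dF_linear[OF x]] algebra_simps)
  have right: "h x u (v + v') = h x u v + h x u v'" "h x u (r *\<^sub>R v) = r *\<^sub>R h x u v" for u v v' r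
    by (simp_all only: h_commute[OF x, of u] left)
  show ?thesis by (rule bilinearI) (rule left right)+
qed

text \<open>Differentiating \<open>tangential_part\<close> once more, the tangential parts of the
  product terms agree on both sides and cancel, leaving the inner products of the second fundamental
  form.\<close>

lemma gauss_equation:
  assumes x: "x \<in> W"
  shows "G (F x) (curvature G (F x) (dF x u) (dF x v) (dF x w)) (dF x z) =
    g x (curvature g x u v w) z - G (F x) (h x v w) (h x u z) + G (F x) (h x u w) (h x v z)"
proof -
  note bl = bilinear_simps[OF bilinear_G[OF F_in[OF x]]]
  define N where "N = (\<lambda>u v w. cov_along G F (\<lambda>y. cov_along G F (\<lambda>y. dF y w) y v) x u)"
  define M where "M = (\<lambda>u v w. cov_along g (\<lambda>y. y) (\<lambda>y. christoffel g y v w) x u)"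
  have N: "G (F x) (N u v w) (dF x z) = g x (M u v w) z - G (F x) (h x v w) (h x u z)" for u v w z
  proof -
    have "G (F x) (N u v w) (dF x z)
        + G (F x) (cov_along G F (\<lambda>y. dF y w) x v) (cov_along G F (\<lambda>y. dF y z) x u) =
        frechet_derivative (\<lambda>y. G (F y) (cov_along G F (\<lambda>y. dF y w) y v) (dF y z)) (at x) u"
      unfolding N_def
      using frechet_derivative_G_along[OF x cov_along_differentiable[OF x dF_smooth] smooth_onD(1)[OF dF_smooth x]]
      by simp
    also have "\<dots> = frechet_derivative (\<lambda>y. g y (christoffel g y v w) z) (at x) u"
      by (rule fun_cong[OF frechet_derivative_cong_open[OF open_W x]]) (rule tangential_part)
    also have "\<dots> = g x (M u v w) z + g x (christoffel g x v w) (christoffel g x u z)"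
      unfolding M_def by (rule sub.frechet_derivative_G_christoffel[OF x])
    also have "G (F x) (cov_along G F (\<lambda>y. dF y w) x v) (cov_along G F (\<lambda>y. dF y z) x u) =
        G (F x) (h x v w + dF x (christoffel g x v w)) (h x u z + dF x (christoffel g x u z))"
      by (simp add: second_fundamental_form_eq[OF x])
    also have "\<dots> = G (F x) (h x v w) (h x u z) + g x (christoffel g x v w) (christoffel g x u z)"
      using h_normal[OF x] G_commute[OF F_in[OF x], of "dF x _" "h x _ _"]
      by (simp add: bl isometric[OF x])
    finally show ?thesis by simp
  qed
  have "curvature G (F x) (dF x u) (dF x v) (dF x w) = N u v w - N v u w"
    using curvature_along[OF x dF_smooth, of w v u] by (simp add: N_def)
  moreover have "curvature g x u v w = M u v w - M v u w"
    using sub.curvature_cov_along[OF x] by (simp add: M_def)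
  ultimately show ?thesis
    by (simp add: bl bilinear_lsub[OF sub.bilinear_G[OF x]] N)
qed

text \<open>The fields \<open>dF y v\<close> and \<open>J (F y) (dF y w)\<close> are orthogonal
  along the whole immersion. Differentiating this relation and moving the parallel, skew
  \<open>J\<close> across gives the symmetry; with \<open>h_commute\<close> it becomes
  total.\<close>

lemma h_J_commute:
  assumes x: "x \<in> W"
  shows "G (F x) (h x u v) (J (F x) (dF x w)) = G (F x) (h x u w) (J (F x) (dF x v))"
proof -
  note bl = bilinear_simps[OF bilinear_G[OF F_in[OF x]]]
  note dd = smooth_onD(1)[OF dF_smooth x]
  have h: "G (F x) (cov_along G F (\<lambda>y. dF y v) x u) (J (F x) (dF x w)) =
      G (F x) (h x u v) (J (F x) (dF x w))" for v w
    using totally_real[OF x] by (simp add: second_fundamental_form_eq[OF x] bl G_commute[OF F_in[OF x], of "dF x _"])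
  have "0 = frechet_derivative (\<lambda>y. G (F y) (dF y v) (J (F y) (dF y w))) (at x) u"
    using frechet_derivative_cong_open[OF open_W x, of "\<lambda>y. G (F y) (dF y v) (J (F y) (dF y w))" "\<lambda>_. 0"]
      totally_real G_commute[OF F_in] by simp
  also have "\<dots> = G (F x) (cov_along G F (\<lambda>y. dF y v) x u) (J (F x) (dF x w))
      + G (F x) (dF x v) (J (F x) (cov_along G F (\<lambda>y. dF y w) x u))"
    using frechet_derivative_G_along[OF x dd J_along_differentiable[OF x dd]] J_cov_along[OF x dd] by simp
  also have "G (F x) (dF x v) (J (F x) (cov_along G F (\<lambda>y. dF y w) x u)) =
      - G (F x) (cov_along G F (\<lambda>y. dF y w) x u) (J (F x) (dF x v))"
    using J_skew[OF F_in[OF x]] G_commute[OF F_in[OF x]] by simp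
  finally show ?thesis by (simp add: h)
qed

end


section \<open>The scalar curvature of subspaces\<close>

text \<open>\<open>tau\<close> sums over \<open>i < j\<close>, whereas only full double sums are
  traces that can be compared between bases.\<close>

lemma sum_ordered_pairs:
  fixes q :: "nat \<Rightarrow> nat \<Rightarrow> real"
  assumes sym: "\<And>i j. q i j = q j i" and diag: "\<And>i. i \<in> {1..m} \<Longrightarrow> q i i = 0"
  shows "(\<Sum>(i, j)\<in>{(i, j). 1 \<le> i \<and> i < j \<and> j \<le> m}. q i j) = (\<Sum>i=1..m. \<Sum>j=1..m. q i j) / 2"
proof -
  let ?P = "{(i, j). 1 \<le> i \<and> i < j \<and> j \<le> m}"
  have fin: "finite ?P" by (rule finite_subset[of _ "{1..m} \<times> {1..m}"]) auto
  have "(\<Sum>i=1..m. \<Sum>j=1..m. q i j) = (\<Sum>(i, j)\<in>{1..m} \<times> {1..m}. q i j)"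
    by (simp add: sum.cartesian_product)
  also have "{1..m} \<times> {1..m} = ?P \<union> prod.swap ` ?P \<union> (\<lambda>i. (i, i)) ` {1..m}"
    by (auto simp: image_iff prod.swap_def split: prod.splits)
  also have "(\<Sum>(i, j)\<in>\<dots>. q i j) = (\<Sum>(i, j)\<in>?P. q i j) + (\<Sum>(i, j)\<in>prod.swap ` ?P. q i j)
      + (\<Sum>(i, j)\<in>(\<lambda>i. (i, i)) ` {1..m}. q i j)"
    using fin by (subst sum.union_disjoint; auto simp: sum.union_disjoint)+
  also have "(\<Sum>(i, j)\<in>(\<lambda>i. (i, i)) ` {1..m}. q i j) = 0"
    by (rule sum.neutral) (use diag in auto)
  also have "(\<Sum>(i, j)\<in>prod.swap ` ?P. q i j) = (\<Sum>(i, j)\<in>?P. q i j)"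
    by (subst sum.reindex) (auto simp: inj_on_def sym intro!: sum.cong)
  finally show ?thesis by simp
qed

lemma (in index_blocks) sum_pairs_minus_blocks:
  fixes q :: "'i \<Rightarrow> 'i \<Rightarrow> real"
  shows "(\<Sum>A\<in>I. \<Sum>B\<in>I. q A B) - (\<Sum>i\<in>K. \<Sum>A\<in>D i. \<Sum>B\<in>D i. q A B) =
    (\<Sum>i\<in>K. \<Sum>j\<in>K - {i}. \<Sum>A\<in>D i. \<Sum>B\<in>D j. q A B)"
proof -
  have "(\<Sum>A\<in>I. \<Sum>B\<in>I. q A B) = (\<Sum>i\<in>K. \<Sum>j\<in>K. \<Sum>A\<in>D i. \<Sum>B\<in>D j. q A B)"
    unfolding sum_I by (intro sum.cong refl sum.swap)
  also have "\<dots> = (\<Sum>i\<in>K. (\<Sum>A\<in>D i. \<Sum>B\<in>D i. q A B) + (\<Sum>j\<in>K - {i}. \<Sum>A\<in>D i. \<Sum>B\<in>D j. q A B))"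
    by (intro sum.cong refl sum.remove finite_K)
  finally show ?thesis by (simp add: sum.distrib)
qed

locale lagrangian_space_form = lagrangian_chart V G J W F g
  for V :: "'b::euclidean_space set" and G J and W :: "'a::euclidean_space set" and F and g +
  fixes c :: real
  assumes holomorphic: "y \<in> V \<Longrightarrow> u \<noteq> 0 \<Longrightarrow> sectional_curvature G y u (J y u) = 4 * c"
begin

text \<open>The numerator of the sectional curvature, as given by the Gauss equation, polarised:
  being bilinear in \<open>u\<close>, \<open>u'\<close> and in \<open>v\<close>, \<open>v'\<close>
  separately, it makes \<open>tau\<close> half of a double trace.\<close>

definition \<Omega> :: "'a \<Rightarrow> 'a \<Rightarrow> 'a \<Rightarrow> 'a \<Rightarrow> 'a \<Rightarrow> real" where
  "\<Omega> x u u' v v' = c * (g x u u' * g x v v' - g x u v * g x u' v')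
    + G (F x) (h x u u') (h x v v') - G (F x) (h x u v) (h x u' v')"

lemma \<Omega>_bilinear:
  assumes x: "x \<in> W"
  shows "bilinear (\<lambda>u u'. \<Omega> x u u' v v')" "bilinear (\<Omega> x u u')"
  by (rule bilinearI; simp add: \<Omega>_def bilinear_simps[OF sub.bilinear_G[OF x]] bilinear_simps[OF h_bilinear[OF x]]
      bilinear_simps[OF bilinear_G[OF F_in[OF x]]] algebra_simps)+

lemma sectional_curvature_numerator:
  assumes x: "x \<in> W" shows "g x (curvature g x u v v) u = \<Omega> x u u v v"
proof -
  have "G (F x) (dF x u) (J (F x) (dF x v)) = 0"
    using totally_real[OF x, of v u] G_commute[OF F_in[OF x]] by simp
  from constant_holomorphic_curvature[OF F_in[OF x] holomorphic[OF F_in[OF x]] this]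
  show ?thesis
    using gauss_equation[OF x, of u v v u] G_commute[OF F_in[OF x], of "h x v v"] h_commute[OF x, of v u]
    by (simp add: \<Omega>_def isometric[OF x] power2_eq_square)
qed

lemma tau_orthonormal:
  assumes x: "x \<in> W" and I: "finite I" "orthonormal_on (g x) I e"
    and L: "subspace L" "e ` I \<subseteq> L" "card I = dim L"
  shows "tau g x L = (\<Sum>A\<in>I. \<Sum>B\<in>I. \<Omega> x (e A) (e A) (e B) (e B)) / 2"
proof -
  note b = sub.ip[OF x]
  define f where "f = (SOME f. onb (g x) L f)"
  have "onb (g x) L f" unfolding f_def using onb_exists[OF b L(1)] by (rule someI_ex)
  then have f: "orthonormal_on (g x) {1..dim L} f" and span_f: "span (f ` {1..dim L}) = L"
    by (auto simp: onb_iff)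
  have span: "span (e ` I) = span (f ` {1..dim L})"
    using orthonormal_span_eq[OF b I L] span_f by simp
  have "tau g x L = (\<Sum>(i, j)\<in>{(i, j). 1 \<le> i \<and> i < j \<and> j \<le> dim L}. \<Omega> x (f i) (f i) (f j) (f j))"
    unfolding tau_def Let_def f_def[symmetric]
    by (intro sum.cong refl)
      (auto simp: sectional_curvature_def sectional_curvature_numerator[OF x] orthonormal_onD[OF f])
  also have "\<dots> = (\<Sum>i=1..dim L. \<Sum>j=1..dim L. \<Omega> x (f i) (f i) (f j) (f j)) / 2"
  proof (rule sum_ordered_pairs)
    show "\<Omega> x (f i) (f i) (f j) (f j) = \<Omega> x (f j) (f j) (f i) (f i)" for i j
      using sub.G_commute[OF x, of "f i" "f j"] h_commute[OF x, of "f i" "f j"]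
        G_commute[OF F_in[OF x], of "h x (f i) (f i)" "h x (f j) (f j)"]
      by (simp add: \<Omega>_def mult.commute)
  qed (simp add: \<Omega>_def)
  also have "(\<Sum>i=1..dim L. \<Sum>j=1..dim L. \<Omega> x (f i) (f i) (f j) (f j)) =
      (\<Sum>i=1..dim L. \<Sum>B\<in>I. \<Omega> x (f i) (f i) (e B) (e B))"
    by (intro sum.cong refl trace_orthonormal_unique[OF b \<Omega>_bilinear(2)[OF x] _ f I span[symmetric]]) simp
  also have "\<dots> = (\<Sum>B\<in>I. \<Sum>i=1..dim L. \<Omega> x (f i) (f i) (e B) (e B))" by (rule sum.swap)
  also have "\<dots> = (\<Sum>B\<in>I. \<Sum>A\<in>I. \<Omega> x (e A) (e A) (e B) (e B))"
    by (intro sum.cong refl trace_orthonormal_unique[OF b \<Omega>_bilinear(1)[OF x] _ f I span[symmetric]]) simp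
  also have "\<dots> = (\<Sum>A\<in>I. \<Sum>B\<in>I. \<Omega> x (e A) (e A) (e B) (e B))" by (rule sum.swap)
  finally show ?thesis .
qed

text \<open>\<open>J\<close> carries normal vectors isometrically to tangent ones, so this is
  Parseval in the tangent space; the two signs from moving \<open>J\<close> across cancel.\<close>

lemma normal_inner_expand:
  assumes x: "x \<in> W" and I: "finite I" "orthonormal_on (g x) I e" "span (e ` I) = UNIV"
    and w: "\<And>u. G (F x) w (dF x u) = 0" and z: "\<And>u. G (F x) z (dF x u) = 0"
  shows "G (F x) w z = (\<Sum>C\<in>I. G (F x) w (J (F x) (dF x (e C))) * G (F x) z (J (F x) (dF x (e C))))"
proof -
  note Fx = F_in[OF x]
  obtain a where a: "J (F x) w = dF x a" using J_normal[OF x w] by auto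
  obtain a' where a': "J (F x) z = dF x a'" using J_normal[OF x z] by auto
  have "G (F x) w z = g x a a'"
    using J_isometry[OF Fx, of w z] by (simp add: a a' isometric[OF x])
  also have "\<dots> = (\<Sum>C\<in>I. g x a (e C) * g x a' (e C))"
    by (rule parseval[OF sub.ip[OF x] I(1,2)]) (simp add: I(3))
  also have "\<dots> = (\<Sum>C\<in>I. G (F x) w (J (F x) (dF x (e C))) * G (F x) z (J (F x) (dF x (e C))))"
    by (simp add: isometric[OF x] a[symmetric] a'[symmetric] J_skew[OF Fx])
  finally show ?thesis .
qed

text \<open>\<open>coeff x e C A B\<close> is the coefficient \<open>h^C_AB\<close> in the frame
  \<open>e\<close>.\<close>

definition coeff :: "'a \<Rightarrow> ('i \<Rightarrow> 'a) \<Rightarrow> 'i \<Rightarrow> 'i \<Rightarrow> 'i \<Rightarrow> real" where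
  "coeff x e C A B = G (F x) (h x (e A) (e B)) (J (F x) (dF x (e C)))"

lemma coeff_commute:
  assumes x: "x \<in> W" shows "coeff x e C A B = coeff x e C B A" "coeff x e C A B = coeff x e A C B"
  unfolding coeff_def using h_commute[OF x, of "e A" "e B"] h_commute[OF x, of "e C" "e B"]
    h_J_commute[OF x, of "e B" "e A" "e C"] by simp_all

lemma mean_curvature_norm:
  assumes x: "x \<in> W" and I: "finite I" "orthonormal_on (g x) I e" "card I = DIM('a)"
  shows "(real DIM('a))\<^sup>2 * G (F x) (mean_curvature g G F x) (mean_curvature g G F x) =
    (\<Sum>C\<in>I. (\<Sum>A\<in>I. coeff x e C A A)\<^sup>2)"
proof -
  note b = sub.ip[OF x] and Gbl = bilinear_G[OF F_in[OF x]]
  define f where "f = (SOME f. onb (g x) UNIV f)"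
  have "onb (g x) UNIV f" unfolding f_def using onb_exists[OF b subspace_UNIV] by (rule someI_ex)
  then have f: "orthonormal_on (g x) {1..DIM('a)} f" "span (f ` {1..DIM('a)}) = UNIV"
    by (auto simp: onb_iff)
  have span: "span (e ` I) = UNIV"
    using orthonormal_span_eq[OF b I(1,2) subspace_UNIV] I(3) by simp
  have "mean_curvature g G F x = (1 / real DIM('a)) *\<^sub>R (\<Sum>i=1..DIM('a). h x (f i) (f i))"
    unfolding mean_curvature_def Let_def f_def ..
  also have "(\<Sum>i=1..DIM('a). h x (f i) (f i)) = (\<Sum>A\<in>I. h x (e A) (e A))"
    by (rule trace_orthonormal_unique[OF b h_bilinear[OF x] _ f(1) I(1,2)]) (simp, simp only: span f(2))
  finally have "(real DIM('a))\<^sup>2 * G (F x) (mean_curvature g G F x) (mean_curvature g G F x) =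
      G (F x) (\<Sum>A\<in>I. h x (e A) (e A)) (\<Sum>A\<in>I. h x (e A) (e A))"
    by (simp add: bilinear_simps[OF Gbl] power2_eq_square)
  also have "\<dots> = (\<Sum>C\<in>I. (\<Sum>A\<in>I. coeff x e C A A)\<^sup>2)"
    by (subst normal_inner_expand[OF x I(1,2) span])
      (simp_all add: bilinear_sum_left[OF Gbl] h_normal[OF x] coeff_def power2_eq_square)
  finally show ?thesis .
qed

text \<open>Removing the pairs within a block leaves the pairs across blocks. There
  \<open>A \<noteq> B\<close>, so the space form contributes exactly \<open>c\<close> to each pair,
  and the Gauss terms expand in the normal frame \<open>J (F x) (dF x (e C))\<close>.\<close>

lemma tau_defect:
  fixes D :: "nat \<Rightarrow> 'i set"
  assumes x: "x \<in> W" and blocks: "index_blocks {1..k} D I" and card_D: "\<And>i. i \<in> {1..k} \<Longrightarrow> card (D i) = ns i"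
    and n: "(\<Sum>i=1..k. ns i) = DIM('a)"
    and L: "L \<in> orthogonal_tuples g x k ns"
    and e: "orthonormal_on (g x) I e" "\<And>i. i \<in> {1..k} \<Longrightarrow> e ` D i \<subseteq> L i"
  shows "tau g x UNIV - (\<Sum>i=1..k. tau g x (L i)) =
    ((\<Sum>i=1..k. \<Sum>j\<in>{1..k} - {i}. \<Sum>A\<in>D i. \<Sum>B\<in>D j. \<Sum>C\<in>I.
        coeff x e C A A * coeff x e C B B - (coeff x e C A B)\<^sup>2)
      + (real DIM('a) * (real DIM('a) - 1) - (\<Sum>i=1..k. real (ns i) * (real (ns i) - 1))) * c) / 2"
proof -
  interpret index_blocks "{1..k}" D I by (rule blocks)
  have "card I = (\<Sum>i\<in>{1..k}. card (D i))"
    using sum_I[of "\<lambda>_. 1::nat"] finite_I finite_D by simp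
  then have card_I: "card I = DIM('a)" using n card_D by simp
  have span: "span (e ` I) = UNIV"
    using orthonormal_span_eq[OF sub.ip[OF x] finite_I e(1) subspace_UNIV] card_I by simp
  define q where "q = (\<lambda>A B. \<Omega> x (e A) (e A) (e B) (e B))"
  have "tau g x (L i) = (\<Sum>A\<in>D i. \<Sum>B\<in>D i. q A B) / 2" if i: "i \<in> {1..k}" for i
    unfolding q_def
    by (rule tau_orthonormal[OF x finite_D[OF i] orthonormal_on_subset[OF e(1)] _ e(2)[OF i]])
      (use i L I_eq card_D in \<open>auto simp: orthogonal_tuples_def\<close>)
  moreover have "tau g x UNIV = (\<Sum>A\<in>I. \<Sum>B\<in>I. q A B) / 2"
    unfolding q_def using tau_orthonormal[OF x finite_I e(1) subspace_UNIV] card_I by simp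
  ultimately have "tau g x UNIV - (\<Sum>i=1..k. tau g x (L i)) =
      ((\<Sum>A\<in>I. \<Sum>B\<in>I. q A B) - (\<Sum>i=1..k. \<Sum>A\<in>D i. \<Sum>B\<in>D i. q A B)) / 2"
    by (simp add: sum_divide_distrib diff_divide_distrib)
  also have "\<dots> = (\<Sum>i=1..k. \<Sum>j\<in>{1..k} - {i}. \<Sum>A\<in>D i. \<Sum>B\<in>D j. q A B) / 2"
    by (simp only: sum_pairs_minus_blocks)
  also have "(\<Sum>i=1..k. \<Sum>j\<in>{1..k} - {i}. \<Sum>A\<in>D i. \<Sum>B\<in>D j. q A B) =
    (\<Sum>i=1..k. \<Sum>j\<in>{1..k} - {i}. \<Sum>A\<in>D i. \<Sum>B\<in>D j.
      (\<Sum>C\<in>I. coeff x e C A A * coeff x e C B B - (coeff x e C A B)\<^sup>2) + c)"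
  proof (intro sum.cong refl)
    fix i j A B assume ij: "i \<in> {1..k}" "j \<in> {1..k} - {i}" "A \<in> D i" "B \<in> D j"
    then have "A \<in> I" "B \<in> I" "A \<noteq> B" using disjoint[of i j] I_eq by auto
    then show "q A B = (\<Sum>C\<in>I. coeff x e C A A * coeff x e C B B - (coeff x e C A B)\<^sup>2) + c"
      by (simp add: q_def \<Omega>_def orthonormal_onD[OF e(1)] coeff_def sum_subtractf power2_eq_square
          normal_inner_expand[OF x finite_I e(1) span h_normal[OF x] h_normal[OF x]])
  qed
  also have "\<dots> = (\<Sum>i=1..k. \<Sum>j\<in>{1..k} - {i}. \<Sum>A\<in>D i. \<Sum>B\<in>D j. \<Sum>C\<in>I.
        coeff x e C A A * coeff x e C B B - (coeff x e C A B)\<^sup>2)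
      + (\<Sum>i=1..k. \<Sum>j\<in>{1..k} - {i}. real (ns i) * real (ns j)) * c"
    by (simp add: sum.distrib card_D sum_distrib_right mult.assoc)
  \<comment> \<open>The left-hand side is \<open>n\<^sup>2\<close> minus the sum of the squares of
    the \<open>ns i\<close>; the linear terms on the right cancel because the \<open>ns i\<close>
    add up to the dimension.\<close>
  also have "(\<Sum>i=1..k. \<Sum>j\<in>{1..k} - {i}. real (ns i) * real (ns j)) =
      real DIM('a) * (real DIM('a) - 1) - (\<Sum>i=1..k. real (ns i) * (real (ns i) - 1))"
    unfolding sum_offdiagonal_product[OF finite_K] n[symmetric]
    by (simp add: algebra_simps sum_subtractf power2_eq_square)
  finally show ?thesis .
qed

end


section \<open>The inequality at a point\<close>

lemma smooth_on_subset:
  assumes "smooth_on S f" "T \<subseteq> S" shows "smooth_on T f"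
proof -
  have "Ck_on k S f \<Longrightarrow> Ck_on k T f" for k
    using \<open>T \<subseteq> S\<close> by (induction k arbitrary: f) (auto intro: continuous_on_subset)
  then show ?thesis using assms(1) by (simp add: smooth_on_def)
qed

section \<open>Index blocks and adapted bases\<close>

lemma block_eq: "i \<ge> 1 \<Longrightarrow> block ns i = {(\<Sum>j=1..i - 1. ns j)<..(\<Sum>j=1..i. ns j)}"
  by (cases i) (auto simp: block_def atLeastLessThanSuc_atLeastAtMost)

lemma card_block: "i \<ge> 1 \<Longrightarrow> card (block ns i) = ns i"
  by (cases i) (simp_all add: block_eq)

lemma block_disjoint:
  assumes "1 \<le> i" "i < j" shows "block ns i \<inter> block ns j = {}"
proof -
  have "(\<Sum>l=1..i. ns l) \<le> (\<Sum>l=1..j - 1. ns l)"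
    using assms by (intro sum_mono2) auto
  then show ?thesis using assms by (auto simp: block_eq)
qed

lemma Union_block: "(\<Union>i\<in>{1..k}. block ns i) = {1..\<Sum>i=1..k. ns i}"
proof (induction k)
  case (Suc k)
  have "(\<Union>i\<in>{1..Suc k}. block ns i) = block ns (Suc k) \<union> (\<Union>i\<in>{1..k}. block ns i)"
    by (auto simp: atLeastAtMostSuc_conv)
  also have "\<dots> = {1..\<Sum>i=1..Suc k. ns i}"
    unfolding Suc by (auto simp: block_eq)
  finally show ?case .
qed simp

lemma index_blocks_block:
  assumes "\<And>i. i \<in> {1..k} \<Longrightarrow> ns i > 0"
  shows "index_blocks {1..k} (block ns) {1..\<Sum>i=1..k. ns i}"
proof
  fix i j assume "i \<in> {1..k}" "j \<in> {1..k}" "i \<noteq> j"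
  then show "block ns i \<inter> block ns j = {}"
    using block_disjoint[of i j ns] block_disjoint[of j i ns] by (cases "i < j") auto
next
  fix i assume i: "i \<in> {1..k}"
  then have "card (block ns i) > 0" using card_block assms by simp
  then show "block ns i \<noteq> {}" "finite (block ns i)" by (auto simp: card_gt_0_iff)
qed (simp, rule Union_block[symmetric])

text \<open>Pairs of a block and a position avoid offsets when a basis is assembled block by
  block.\<close>

lemma index_blocks_Sigma:
  assumes "\<And>i. i \<in> {1..k} \<Longrightarrow> ns i > 0"
  shows "index_blocks {1..k::nat} (\<lambda>i. {i} \<times> {1..ns i::nat}) (SIGMA i:{1..k}. {1..ns i})"
  by standard (use assms in \<open>force simp: Suc_le_eq\<close>)+

text \<open>Cutting one orthonormal basis into blocks produces a tuple. Nonemptiness lets a common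
  lower bound pass to the infimum in \<open>delta\<close>.\<close>

lemma orthogonal_tuples_nonempty:
  assumes b: "inner_product (G x :: 'a::euclidean_space \<Rightarrow> 'a \<Rightarrow> real)"
    and pos: "\<And>i. i \<in> {1..k} \<Longrightarrow> ns i > 0" and n: "(\<Sum>i=1..k. ns i) = DIM('a)"
  shows "orthogonal_tuples G x k ns \<noteq> {}"
proof -
  interpret index_blocks "{1..k}" "block ns" "{1..DIM('a)}"
    by (rule index_blocks_block[of k ns, OF pos, unfolded n])
  obtain e where e: "orthonormal_on (G x) {1..DIM('a)} e"
    using onb_exists[OF b subspace_UNIV] by (auto simp: onb_iff)
  note bl = inner_product_bilinear[OF b]
  have sub: "orthonormal_on (G x) (block ns i) e" if "i \<in> {1..k}" for i
    by (rule orthonormal_on_subset[OF e]) (use that I_eq in blast)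
  have "G x u v = 0" if ij: "i \<in> {1..k}" "j \<in> {1..k}" "i \<noteq> j"
    and u: "u \<in> span (e ` block ns i)" and v: "v \<in> span (e ` block ns j)" for i j u v
  proof -
    have "G x u v = G x (\<Sum>A\<in>block ns i. G x u (e A) *\<^sub>R e A) (\<Sum>B\<in>block ns j. G x v (e B) *\<^sub>R e B)"
      using orthonormal_expand[OF b finite_D sub u] orthonormal_expand[OF b finite_D sub v] ij by simp
    also have "\<dots> = (\<Sum>A\<in>block ns i. \<Sum>B\<in>block ns j. G x v (e B) * (G x u (e A) * G x (e A) (e B)))"
      unfolding bilinear_sum_left[OF bl] unfolding bilinear_sum_right[OF bl]
      by (simp add: bilinear_simps[OF bl])
    also have "\<dots> = 0"
    proof (intro sum.neutral ballI)
      fix A B assume AB: "A \<in> block ns i" "B \<in> block ns j"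
      then have "A \<noteq> B" "A \<in> {1..DIM('a)}" "B \<in> {1..DIM('a)}"
        using disjoint[OF ij] ij unfolding I_eq by blast+
      then show "G x v (e B) * (G x u (e A) * G x (e A) (e B)) = 0"
        by (simp add: orthonormal_onD[OF e])
    qed
    finally show ?thesis .
  qed
  moreover have "dim (span (e ` block ns i)) = ns i" if "i \<in> {1..k}" for i
    using orthonormal_dim_span[OF b finite_D sub] that card_block by simp
  ultimately have "(\<lambda>i. span (e ` block ns i)) \<in> orthogonal_tuples G x k ns"
    unfolding orthogonal_tuples_def by auto
  then show ?thesis by blast
qed

lemma adapted_basis_exists:
  assumes b: "inner_product (G x :: 'a::euclidean_space \<Rightarrow> 'a \<Rightarrow> real)"
    and L: "L \<in> orthogonal_tuples G x k ns"
  shows "\<exists>e. orthonormal_on (G x) (SIGMA i:{1..k}. {1..ns i}) e \<and> (\<forall>i\<in>{1..k}. e ` ({i} \<times> {1..ns i}) \<subseteq> L i)"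
proof -
  have L': "subspace (L i)" "dim (L i) = ns i" if "i \<in> {1..k}" for i
    using that L by (auto simp: orthogonal_tuples_def)
  have orth: "G x u v = 0" if "i \<in> {1..k}" "j \<in> {1..k}" "i \<noteq> j" "u \<in> L i" "v \<in> L j" for i j u v
    using that L by (auto simp: orthogonal_tuples_def)
  have "\<forall>i\<in>{1..k}. \<exists>E. orthonormal_on (G x) {1..ns i} E \<and> E ` {1..ns i} \<subseteq> L i"
    using orthonormal_exists[OF b L'(1)] L'(2) by (metis order_refl)
  then obtain E where E: "\<And>i. i \<in> {1..k} \<Longrightarrow> orthonormal_on (G x) {1..ns i} (E i)"
    "\<And>i. i \<in> {1..k} \<Longrightarrow> E i ` {1..ns i} \<subseteq> L i" by metis
  have "orthonormal_on (G x) (SIGMA i:{1..k}. {1..ns i}) (\<lambda>(i, a). E i a)"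
    unfolding orthonormal_on_def
  proof clarify
    fix i a j a' assume *: "i \<in> {1..k}" "a \<in> {1..ns i}" "j \<in> {1..k}" "a' \<in> {1..ns j}"
    show "G x (E i a) (E j a') = (if (i, a) = (j, a') then 1 else 0)"
    proof (cases "i = j")
      case True
      then show ?thesis using orthonormal_onD[OF E(1)[OF *(1)], of a a'] * by simp
    next
      case False
      have "E i a \<in> L i" "E j a' \<in> L j" using E(2) * by blast+
      then show ?thesis using orth[OF *(1,3) False] False by simp
    qed
  qed
  moreover have "(\<lambda>(i, a). E i a) ` ({i} \<times> {1..ns i}) \<subseteq> L i" if "i \<in> {1..k}" for i
    using E(2)[OF that] by auto
  ultimately show ?thesis by blast
qed

context lagrangian_space_form
begin

text \<open>The estimate for one tuple and one basis adapted to it; the infimum over tuples enters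
  only afterwards.\<close>

lemma delta_inequality:
  assumes x: "x \<in> W" and k: "k \<ge> 1" and two: "\<And>i. i \<in> {1..k} \<Longrightarrow> 2 \<le> ns i"
    and mono: "\<And>i j. i \<in> {1..k} \<Longrightarrow> j \<in> {1..k} \<Longrightarrow> i \<le> j \<Longrightarrow> ns i \<le> ns j"
    and n: "(\<Sum>i=1..k. ns i) = DIM('a)"
    and blocks: "index_blocks {1..k} D I" and card_D: "\<And>i. i \<in> {1..k} \<Longrightarrow> card (D i) = ns i"
    and L: "L \<in> orthogonal_tuples g x k ns"
    and e: "orthonormal_on (g x) I e" "\<And>i. i \<in> {1..k} \<Longrightarrow> e ` D i \<subseteq> L i"
    and bound: "bound =
      (real DIM('a))\<^sup>2 * (real k - 1 - 2 * (\<Sum>i=2..k. 1 / (real (ns i) + 2)))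
        / (2 * (real k - 2 * (\<Sum>i=2..k. 1 / (real (ns i) + 2))))
        * G (F x) (mean_curvature g G F x) (mean_curvature g G F x)
      + 1 / 2 * (real DIM('a) * (real DIM('a) - 1) - (\<Sum>i=1..k. real (ns i) * (real (ns i) - 1))) * c"
  defines "\<delta> \<equiv> tau g x UNIV - (\<Sum>i=1..k. tau g x (L i))"
  shows "\<delta> \<le> bound"
    and "\<delta> = bound \<Longrightarrow> i \<in> {1..k} \<Longrightarrow> j \<in> {1..k} \<Longrightarrow> i \<noteq> j \<Longrightarrow> A \<in> D i \<Longrightarrow> B \<in> D j \<Longrightarrow> C \<in> I \<Longrightarrow>
      C \<noteq> A \<Longrightarrow> C \<noteq> B \<Longrightarrow> coeff x e C A B = 0"
    and "\<delta> = bound \<Longrightarrow> l \<in> {1..k} \<Longrightarrow> \<gamma> \<in> D l \<Longrightarrow> i \<in> {1..k} \<Longrightarrow> i \<noteq> l \<Longrightarrow> \<alpha> \<in> D i \<Longrightarrow>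
      (\<Sum>\<beta>\<in>D l. coeff x e \<gamma> \<beta> \<beta>) = (real (ns i) + 2) * coeff x e \<gamma> \<alpha> \<alpha>"
    and "\<delta> = bound \<Longrightarrow> l \<in> {1..k} \<Longrightarrow> \<gamma> \<in> D l \<Longrightarrow> ns 1 < ns l \<Longrightarrow> (\<Sum>\<beta>\<in>D l. coeff x e \<gamma> \<beta> \<beta>) = 0"
proof -
  interpret index_blocks "{1..k}" D I by (rule blocks)
  define s where "s = (\<Sum>i=2..k. 1 / (real (ns i) + 2))"
  define W' where "W' = (\<lambda>l. 2 * real (card {1..k}) - 4 * (\<Sum>i\<in>{1..k} - {l}. 1 / (real (card (D i)) + 2)))"
  \<comment> \<open>This is \<open>W' 1\<close>: omitting the first block, which is a smallest one,
    omits the largest reciprocal and so gives the largest \<open>W' l\<close>.\<close>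
  define M where "M = 2 * real k - 4 * s"
  define X where "X = (\<Sum>i\<in>{1..k}. \<Sum>j\<in>{1..k} - {i}. \<Sum>A\<in>D i. \<Sum>B\<in>D j. \<Sum>C\<in>I.
        coeff x e C A A * coeff x e C B B - (coeff x e C A B)\<^sup>2)"
  define Y where "Y = 2 * (1 / 2 - 1 / M) * (\<Sum>C\<in>I. (\<Sum>A\<in>I. coeff x e C A A)\<^sup>2)"
  have W'_eq: "W' l = 2 * real k - 4 * (\<Sum>i\<in>{1..k} - {l}. 1 / (real (ns i) + 2))" for l
    by (simp add: W'_def card_D)
  have W'_pos: "W' l > 0" if l: "l \<in> {1..k}" for l
  proof -
    \<comment> \<open>Sizes at least 2 give \<open>W' l \<ge> 2 * k - (k - 1) > 0\<close>.\<close>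
    have "1 / (real (ns i) + 2) \<le> 1 / 4" if "i \<in> {1..k} - {l}" for i
      using two[of i] that by (intro divide_left_mono) auto
    then have "(\<Sum>i\<in>{1..k} - {l}. 1 / (real (ns i) + 2)) \<le> (\<Sum>i\<in>{1..k} - {l}. 1 / 4)"
      by (intro sum_mono)
    also have "\<dots> = (real k - 1) / 4" using l k by (simp add: card_Diff_singleton)
    finally show ?thesis using k by (simp add: W'_eq)
  qed
  have W'_diff: "M - W' l = 4 / (real (ns 1) + 2) - 4 / (real (ns l) + 2)" if l: "l \<in> {1..k}" for l
  proof -
    have "s = (\<Sum>i\<in>{1..k} - {1}. 1 / (real (ns i) + 2))"
      unfolding s_def by (intro sum.cong) auto
    then show ?thesis
      using l k by (simp add: M_def W'_eq sum_diff1)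
  qed
  have W'_le: "W' l \<le> M" if l: "l \<in> {1..k}" for l
  proof -
    have "4 / (real (ns l) + 2) \<le> 4 / (real (ns 1) + 2)"
      using mono[of 1 l] l k by (intro divide_left_mono) auto
    then show ?thesis using W'_diff[OF l] by linarith
  qed
  have W'_less: "W' l < M" if l: "l \<in> {1..k}" "ns 1 < ns l" for l
  proof -
    have "4 / (real (ns l) + 2) < 4 / (real (ns 1) + 2)"
      using l(2) by (intro divide_strict_left_mono) auto
    then show ?thesis using W'_diff[OF l(1)] by linarith
  qed
  have "M > 0" using W'_pos[of 1] W'_le[of 1] k by force
  have card_I: "card I = DIM('a)"
    using sum_I[of "\<lambda>_. 1::nat"] finite_I finite_D n card_D by simp
  \<comment> \<open>With \<open>M = 2 * (k - 2 * s)\<close> the fraction in the bound is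
    \<open>1 / 2 - 1 / M\<close>.\<close>
  have M_eq: "1 / 2 - 1 / M = (real k - 1 - 2 * s) / (2 * (real k - 2 * s))"
    using \<open>M > 0\<close> by (simp add: M_def divide_simps) (simp add: algebra_simps)
  have half: "2 * a * b / 2 = a * b" for a b :: real by simp
  have "Y / 2 = (real DIM('a))\<^sup>2 * (real k - 1 - 2 * s) / (2 * (real k - 2 * s))
      * G (F x) (mean_curvature g G F x) (mean_curvature g G F x)"
    unfolding Y_def mean_curvature_norm[OF x finite_I e(1) card_I, symmetric] M_eq half
    by (simp only: times_divide_eq_left times_divide_eq_right mult_ac)
  moreover define R where "R = real DIM('a) * (real DIM('a) - 1) - (\<Sum>i=1..k. real (ns i) * (real (ns i) - 1))"
  ultimately have "bound = Y / 2 + 1 / 2 * R * c" by (simp only: bound s_def)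
  moreover have "\<delta> = (X + R * c) / 2"
    unfolding \<delta>_def X_def R_def by (rule tau_defect[OF x blocks card_D n L e])
  ultimately have bound_eq: "bound - \<delta> = (Y - X) / 2" by (simp add: field_simps)
  note ineq = cross_blocks_inequality[where h = "coeff x e" and M = M, OF coeff_commute[OF x],
      folded X_def Y_def, OF W'_pos[unfolded W'_def] W'_le[unfolded W'_def]]
  show "\<delta> \<le> bound" using ineq(1) bound_eq by simp
  assume "\<delta> = bound"
  then have eq: "X = Y" using bound_eq by simp
  show "coeff x e C A B = 0" if "i \<in> {1..k}" "j \<in> {1..k}" "i \<noteq> j" "A \<in> D i" "B \<in> D j" "C \<in> I" "C \<noteq> A" "C \<noteq> B"
    for i j A B C
    by (rule ineq(2)[OF _ _ eq that])
  show "(\<Sum>\<beta>\<in>D l. coeff x e \<gamma> \<beta> \<beta>) = (real (ns i) + 2) * coeff x e \<gamma> \<alpha> \<alpha>"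
    if "l \<in> {1..k}" "\<gamma> \<in> D l" "i \<in> {1..k}" "i \<noteq> l" "\<alpha> \<in> D i" for l \<gamma> i \<alpha>
    by (rule ineq(3)[OF _ _ eq that, unfolded card_D[OF that(3)]])
  show "(\<Sum>\<beta>\<in>D l. coeff x e \<gamma> \<beta> \<beta>) = 0" if "l \<in> {1..k}" "\<gamma> \<in> D l" "ns 1 < ns l" for l \<gamma>
    by (rule ineq(4)[OF _ _ eq that(1,2) W'_less[OF that(1,3), unfolded W'_def]])
qed

end


section \<open>The global statement\<close>

text \<open>All claims concern one point, so one pair of charts suffices. The coordinate domain is
  the part of the chart of \<open>\<phi>\<close> that \<open>f\<close> maps into the chart of
  \<open>\<psi>\<close>; it is open by continuity of \<open>f\<close>.\<close>

lemma lagrangian_space_form_charts: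
  fixes \<A> :: "('m::{t2_space,second_countable_topology}, 'a::euclidean_space) chart set"
    and \<B> :: "('q::{t2_space,second_countable_topology}, 'b::euclidean_space) chart set"
  assumes M: "riemannian_manifold \<A> g" and N: "complex_space_form \<B> G J (4 * c)"
    and lag: "lagrangian_immersion \<A> g \<B> G J f" and \<phi>: "\<phi> \<in> \<A>" and \<psi>: "\<psi> \<in> \<B>"
  shows "lagrangian_space_form (chart_image \<psi>) (G \<psi>) (J \<psi>) (snd \<phi> ` {q \<in> fst \<phi>. f q \<in> fst \<psi>})
    (coord_rep \<phi> \<psi> f) (g \<phi>) c"
proof -
  define V where "V = chart_image \<psi>"
  define Q where "Q = {q \<in> fst \<phi>. f q \<in> fst \<psi>}"
  define W where "W = snd \<phi> ` Q"
  define F where "F = coord_rep \<phi> \<psi> f"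
  have K: "kaehler_manifold \<B> G J" using N by (simp add: complex_space_form_def)
  have R: "riemannian_manifold \<B> G" and AC: "almost_complex_structure \<B> J"
    using K by (auto simp: kaehler_manifold_def)
  have iso: "isometric_immersion \<A> g \<B> G f" using lag by (simp add: lagrangian_immersion_def)
  have f: "smooth_map \<A> \<B> f" using iso by (simp add: isometric_immersion_def)
  have chart_M: "open (fst \<phi>)" "open (chart_image \<phi>)"
      "homeomorphism (fst \<phi>) (chart_image \<phi>) (snd \<phi>) (chart_inv \<phi>)"
    using M \<phi> by (auto simp: riemannian_manifold_def smooth_manifold_def)
  have open_V: "open V" using R \<psi> by (auto simp: V_def riemannian_manifold_def smooth_manifold_def)
  have open_\<psi>: "open (fst \<psi>)" using R \<psi> by (auto simp: riemannian_manifold_def smooth_manifold_def)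
  have "continuous_on (fst \<phi>) f"
    using f \<phi> by (auto simp: smooth_map_def carrier_def intro: continuous_on_subset)
  then have "open (fst \<phi> \<inter> f -` fst \<psi>)"
    by (rule continuous_open_preimage[OF _ chart_M(1) open_\<psi>])
  moreover have "Q = fst \<phi> \<inter> f -` fst \<psi>" by (auto simp: Q_def)
  ultimately have "openin (top_of_set (fst \<phi>)) Q"
    by (simp add: openin_open_eq[OF chart_M(1)])
  from homeomorphism_imp_open_map[OF chart_M(3) this]
  have open_W: "open W" and W_sub: "W \<subseteq> chart_image \<phi>"
    unfolding openin_open_eq[OF chart_M(2)] W_def by auto
  have point: "\<exists>q\<in>fst \<phi>. f q \<in> fst \<psi> \<and> x = snd \<phi> q \<and> F x = snd \<psi> (f q)" if "x \<in> W" for x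
  proof -
    obtain q where q: "q \<in> fst \<phi>" "f q \<in> fst \<psi>" "x = snd \<phi> q" using \<open>x \<in> W\<close> by (auto simp: W_def Q_def)
    then have "chart_inv \<phi> x = q" using homeomorphism_apply1[OF chart_M(3)] by simp
    with q show ?thesis by (auto simp: F_def coord_rep_def)
  qed
  have F_V: "F x \<in> V" if "x \<in> W" for x
    using point[OF that] by (auto simp: V_def chart_image_def)
  have g: "g \<phi> x u v = G \<psi> (F x) (frechet_derivative F (at x) u) (frechet_derivative F (at x) v)"
    if x: "x \<in> W" for x u v
  proof -
    have "\<forall>q\<in>fst \<phi>. f q \<in> fst \<psi> \<longrightarrow> (\<forall>u v. g \<phi> (snd \<phi> q) u v = G \<psi> (snd \<psi> (f q))
        (frechet_derivative F (at (snd \<phi> q)) u) (frechet_derivative F (at (snd \<phi> q)) v))"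
      using iso \<phi> \<psi> unfolding isometric_immersion_def Let_def F_def by blast
    then show ?thesis using point[OF x] by force
  qed
  have lagr: "J \<psi> (F x) ` range (frechet_derivative F (at x)) \<subseteq>
        {w. \<forall>t\<in>range (frechet_derivative F (at x)). G \<psi> (F x) w t = 0}"
      "J \<psi> (F x) ` {w. \<forall>t\<in>range (frechet_derivative F (at x)). G \<psi> (F x) w t = 0} \<subseteq>
        range (frechet_derivative F (at x))" if x: "x \<in> W" for x
  proof -
    obtain q where q: "q \<in> fst \<phi>" "f q \<in> fst \<psi>" "x = snd \<phi> q" "F x = snd \<psi> (f q)"
      using point[OF x] by blast
    note * = lag[unfolded lagrangian_immersion_def Let_def, THEN conjunct2, rule_format, OF \<phi> \<psi> q(1,2),
        folded q(3,4) F_def]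
    show "J \<psi> (F x) ` range (frechet_derivative F (at x)) \<subseteq>
        {w. \<forall>t\<in>range (frechet_derivative F (at x)). G \<psi> (F x) w t = 0}"
      using * by (rule conjunct1)
    show "J \<psi> (F x) ` {w. \<forall>t\<in>range (frechet_derivative F (at x)). G \<psi> (F x) w t = 0} \<subseteq>
        range (frechet_derivative F (at x))"
      using * by (rule conjunct2)
  qed
  have J_linear: "linear (J \<psi> y)" if "y \<in> V" for y
    using that \<psi> AC by (auto simp: V_def almost_complex_structure_def)
  have "lagrangian_space_form V (G \<psi>) (J \<psi>) W F (g \<phi>) c"
  proof
    show "inner_product (G \<psi> y)" "J \<psi> y (J \<psi> y v) = - v"
      "G \<psi> y (J \<psi> y u) (J \<psi> y v) = G \<psi> y u v"
      "cov_deriv (G \<psi>) (\<lambda>y. J \<psi> y v) y u = J \<psi> y (cov_deriv (G \<psi>) (\<lambda>_. v) y u)"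
      "u \<noteq> 0 \<Longrightarrow> sectional_curvature (G \<psi>) y u (J \<psi> y u) = 4 * c" if "y \<in> V" for y u v
      using that \<psi> R AC K N
      by (auto simp: V_def riemannian_manifold_def almost_complex_structure_def kaehler_manifold_def
          complex_space_form_def)
    show "smooth_on V (\<lambda>x. G \<psi> x v w)" for v w
      using R \<psi> by (simp add: V_def riemannian_manifold_def)
    show "smooth_on V (\<lambda>y. J \<psi> y v)" for v
      using AC \<psi> by (simp add: V_def almost_complex_structure_def)
    show "smooth_on W F"
      using f \<phi> \<psi> by (simp add: smooth_map_def W_def Q_def F_def)
    show "inner_product (g \<phi> x)" if "x \<in> W" for x
      using that W_sub M \<phi> by (auto simp: riemannian_manifold_def)
    show "smooth_on W (\<lambda>x. g \<phi> x v w)" for v w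
      by (rule smooth_on_subset[OF _ W_sub]) (use M \<phi> in \<open>simp add: riemannian_manifold_def\<close>)
    show "G \<psi> (F x) (J \<psi> (F x) (frechet_derivative F (at x) u)) (frechet_derivative F (at x) v) = 0"
      if "x \<in> W" for x u v
      using lagr(1)[OF that] by blast
    show "J \<psi> (F x) w \<in> range (frechet_derivative F (at x))"
      if "x \<in> W" "\<And>u. G \<psi> (F x) w (frechet_derivative F (at x) u) = 0" for x w
      using lagr(2)[OF that(1)] that(2) by blast
  qed (use open_V open_W F_V g J_linear in \<open>auto simp: linear_add linear_cmul\<close>)
  then show ?thesis by (simp add: V_def W_def Q_def F_def)
qed

theorem theorem3p2:
  fixes \<A> :: "('m::{t2_space,second_countable_topology}, 'a::euclidean_space) chart set"
    and g :: "('m, 'a) chart \<Rightarrow> 'a \<Rightarrow> 'a \<Rightarrow> 'a \<Rightarrow> real"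
    and \<B> :: "('q::{t2_space,second_countable_topology}, 'b::euclidean_space) chart set"
    and G :: "('q, 'b) chart \<Rightarrow> 'b \<Rightarrow> 'b \<Rightarrow> 'b \<Rightarrow> real"
    and J :: "('q, 'b) chart \<Rightarrow> 'b \<Rightarrow> 'b \<Rightarrow> 'b"
    and f :: "'m \<Rightarrow> 'q"
    and c :: real
    and n k :: nat
    and ns :: "nat \<Rightarrow> nat"
    and \<phi> :: "('m, 'a) chart" and \<psi> :: "('q, 'b) chart"
    and p :: 'm and x :: 'a and F :: "'a \<Rightarrow> 'b" and bound :: real
  assumes "n = DIM('a)" and "DIM('b) = 2 * n"
    and "riemannian_manifold \<A> g"
    and "complex_space_form \<B> G J (4 * c)"
    and "lagrangian_immersion \<A> g \<B> G J f"
    and "\<forall>i\<in>{1..k}. 2 \<le> ns i \<and> ns i \<le> n - 1"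
    and "\<forall>i\<in>{1..k}. \<forall>j\<in>{1..k}. i \<le> j \<longrightarrow> ns i \<le> ns j"
    and "(\<Sum>i=1..k. ns i) = n"
    and "p \<in> carrier \<A>"
    and "\<phi> \<in> \<A>" and "p \<in> fst \<phi>" and "\<psi> \<in> \<B>" and "f p \<in> fst \<psi>"
    and "x = snd \<phi> p" and "F = coord_rep \<phi> \<psi> f"
    and bound: "bound =
      (real n)\<^sup>2 * (real k - 1 - 2 * (\<Sum>i=2..k. 1 / (real (ns i) + 2)))
        / (2 * (real k - 2 * (\<Sum>i=2..k. 1 / (real (ns i) + 2))))
        * G \<psi> (F x) (mean_curvature (g \<phi>) (G \<psi>) F x) (mean_curvature (g \<phi>) (G \<psi>) F x)
      + 1 / 2 * (real n * (real n - 1) - (\<Sum>i=1..k. real (ns i) * (real (ns i) - 1))) * c"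
  shows "delta (g \<phi>) x k ns \<le> bound \<and>
    (delta (g \<phi>) x k ns = bound \<longrightarrow>
      (\<forall>L e h.
        L \<in> orthogonal_tuples (g \<phi>) x k ns \<longrightarrow>
        (\<forall>L'\<in>orthogonal_tuples (g \<phi>) x k ns.
           (\<Sum>i=1..k. tau (g \<phi>) x (L i)) \<le> (\<Sum>i=1..k. tau (g \<phi>) x (L' i))) \<longrightarrow>
        onb (g \<phi> x) UNIV e \<longrightarrow>
        (\<forall>i\<in>{1..k}. \<forall>A\<in>block ns i. e A \<in> L i) \<longrightarrow>
        (\<forall>A B C. h C A B = G \<psi> (F x) (second_fundamental_form (G \<psi>) F x (e A) (e B))
                             (J \<psi> (F x) (frechet_derivative F (at x) (e C)))) \<longrightarrow>
        (\<forall>i\<in>{1..k}. \<forall>j\<in>{1..k}. i \<noteq> j \<longrightarrow>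
           (\<forall>\<alpha>i\<in>block ns i. \<forall>\<alpha>j\<in>block ns j. \<forall>A\<in>{1..n}.
              A \<noteq> \<alpha>i \<longrightarrow> A \<noteq> \<alpha>j \<longrightarrow> h A \<alpha>i \<alpha>j = 0)) \<and>
        (\<forall>j\<in>{1..k}. ns j \<noteq> Min (ns ` {1..k}) \<longrightarrow>
           (\<forall>\<beta>\<in>block ns j.
              (\<forall>i\<in>{1..k}. i \<noteq> j \<longrightarrow> (\<forall>\<alpha>i\<in>block ns i. h \<beta> \<alpha>i \<alpha>i = 0)) \<and>
              (\<Sum>\<alpha>j\<in>block ns j. h \<beta> \<alpha>j \<alpha>j) = 0)) \<and>
        (\<forall>j\<in>{1..k}. ns j = Min (ns ` {1..k}) \<longrightarrow>
           (\<forall>\<beta>\<in>block ns j. \<forall>i\<in>{1..k}. i \<noteq> j \<longrightarrow> (\<forall>\<alpha>i\<in>block ns i.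
              (\<Sum>\<alpha>j\<in>block ns j. h \<beta> \<alpha>j \<alpha>j) = (real (ns i) + 2) * h \<beta> \<alpha>i \<alpha>i)))))"
proof -
  note n = assms(1) and sizes = assms(6) and mono = assms(7) and sum_ns = assms(8)
  define W where "W = snd \<phi> ` {q \<in> fst \<phi>. f q \<in> fst \<psi>}"
  have xW: "x \<in> W" using assms(11,13,14) by (auto simp: W_def)
  interpret lagrangian_space_form "chart_image \<psi>" "G \<psi>" "J \<psi>" W F "g \<phi>" c
    unfolding W_def \<open>F = _\<close> by (rule lagrangian_space_form_charts) (use assms in auto)
  have k: "k \<ge> 1" using sum_ns n DIM_positive[where 'a = 'a] by (cases k) auto
  have two: "2 \<le> ns i" if "i \<in> {1..k}" for i using sizes that by blast
  have mono': "ns i \<le> ns j" if "i \<in> {1..k}" "j \<in> {1..k}" "i \<le> j" for i j using mono that by blast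
  have pos: "ns i > 0" if "i \<in> {1..k}" for i using two[OF that] by simp
  have sum_ns': "(\<Sum>i=1..k. ns i) = DIM('a)" using sum_ns n by simp
  note bound' = bound[unfolded n]
  note ip_x = sub.ip[OF xW]
  have Min_ns: "Min (ns ` {1..k}) = ns 1"
    using k mono' by (intro Min_eqI) auto
  let ?T = "orthogonal_tuples (g \<phi>) x k ns"
  let ?S = "\<lambda>L. \<Sum>i=1..k. tau (g \<phi>) x (L i)"
  \<comment> \<open>Each tuple gets its own adapted basis, indexed by pairs, so the bound is uniform
    over the set that defines the infimum.\<close>
  have le: "tau (g \<phi>) x UNIV - ?S L \<le> bound" if L: "L \<in> ?T" for L
  proof -
    obtain e where e: "orthonormal_on (g \<phi> x) (SIGMA i:{1..k}. {1..ns i}) e"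
      "\<And>i. i \<in> {1..k} \<Longrightarrow> e ` ({i} \<times> {1..ns i}) \<subseteq> L i"
      using adapted_basis_exists[OF ip_x L] by blast
    show ?thesis
      by (rule delta_inequality(1)[OF xW k two mono' sum_ns' index_blocks_Sigma[OF pos] _ L e bound']) simp_all
  qed
  have nonempty: "?T \<noteq> {}" by (rule orthogonal_tuples_nonempty[where G = "g \<phi>", OF ip_x _ sum_ns']) (rule pos)
  have Inf_ge: "tau (g \<phi>) x UNIV - bound \<le> (INF L\<in>?T. ?S L)"
    by (rule cINF_greatest[OF nonempty]) (use le in force)
  show ?thesis
  proof (intro conjI impI allI ballI)
    show "delta (g \<phi>) x k ns \<le> bound" using Inf_ge by (simp add: delta_def)
    fix L e and h :: "nat \<Rightarrow> nat \<Rightarrow> nat \<Rightarrow> real"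
    assume eq: "delta (g \<phi>) x k ns = bound" and L: "L \<in> ?T" and min: "\<forall>L'\<in>?T. ?S L \<le> ?S L'"
      and onb: "onb (g \<phi> x) UNIV e" and adapted: "\<forall>i\<in>{1..k}. \<forall>A\<in>block ns i. e A \<in> L i"
      and h: "\<forall>A B C. h C A B = G \<psi> (F x) (second_fundamental_form (G \<psi>) F x (e A) (e B))
                             (J \<psi> (F x) (frechet_derivative F (at x) (e C)))"
    have h_eq: "h = coeff x e" using h by (intro ext) (simp add: coeff_def)
    \<comment> \<open>Minimality makes the value at \<open>L\<close> a lower bound of the set, so
      the infimum is attained at \<open>L\<close> and equality for \<open>delta\<close> becomes
      equality in the estimate for this tuple.\<close>
    have "(INF L\<in>?T. ?S L) = ?S L"
    proof (rule antisym)
      show "(INF L\<in>?T. ?S L) \<le> ?S L"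
        by (rule cINF_lower[OF bdd_belowI2[of _ "?S L"] L]) (use min in blast)
      show "?S L \<le> (INF L\<in>?T. ?S L)"
        by (rule cINF_greatest[OF nonempty]) (use min in blast)
    qed
    then have attained: "tau (g \<phi>) x UNIV - ?S L = bound" using eq by (simp add: delta_def)
    have e: "orthonormal_on (g \<phi> x) {1..\<Sum>i=1..k. ns i} e" using onb unfolding onb_iff sum_ns' by simp
    have e_L: "e ` block ns i \<subseteq> L i" if "i \<in> {1..k}" for i using adapted that by blast
    have card: "card (block ns i) = ns i" if "i \<in> {1..k}" for i using that card_block by simp
    note concl = delta_inequality(2-4)[OF xW k two mono' sum_ns' index_blocks_block[OF pos] card L e e_L bound' attained,
        folded h_eq, unfolded sum_ns]
    show "h A \<alpha>i \<alpha>j = 0"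
      if "i \<in> {1..k}" "j \<in> {1..k}" "i \<noteq> j" "\<alpha>i \<in> block ns i" "\<alpha>j \<in> block ns j" "A \<in> {1..n}"
        "A \<noteq> \<alpha>i" "A \<noteq> \<alpha>j" for i j \<alpha>i \<alpha>j A
      using concl(1) that by blast
    show trace: "(\<Sum>\<alpha>j\<in>block ns j. h \<beta> \<alpha>j \<alpha>j) = (real (ns i) + 2) * h \<beta> \<alpha>i \<alpha>i"
      if "j \<in> {1..k}" "\<beta> \<in> block ns j" "i \<in> {1..k}" "i \<noteq> j" "\<alpha>i \<in> block ns i" for j \<beta> i \<alpha>i
      using concl(2) that by blast
    show trace_0: "(\<Sum>\<alpha>j\<in>block ns j. h \<beta> \<alpha>j \<alpha>j) = 0"
      if "j \<in> {1..k}" "ns j \<noteq> Min (ns ` {1..k})" "\<beta> \<in> block ns j" for j \<beta>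
    proof -
      have "ns 1 < ns j" using mono'[of 1 j] that(1,2) k unfolding Min_ns by simp
      then show ?thesis using concl(3) that(1,3) by blast
    qed
    \<comment> \<open>The relation \<open>trace\<close> holds in every block; since
      \<open>ns i + 2\<close> is nonzero, a vanishing block sum forces these diagonal entries to
      vanish.\<close>
    show "h \<beta> \<alpha>i \<alpha>i = 0"
      if "j \<in> {1..k}" "ns j \<noteq> Min (ns ` {1..k})" "\<beta> \<in> block ns j" "i \<in> {1..k}" "i \<noteq> j" "\<alpha>i \<in> block ns i" for j \<beta> i \<alpha>i
      using trace[OF that(1,3-6)] trace_0[OF that(1-3)] by (auto simp: add_eq_0_iff)
  qed
qed

end
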